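(* Let $M$ be a Hadamard manifold with constant sectional curvature $-k^2$, where $k>0$, and let $p\in M$. Given orthogonal unit vectors $\eta,\theta\in T_pM$ and $r,s>0$, define $y:=\exp_p(-s\eta)$ and $z:=\exp_p(r\theta)$. Then $$H_p(y,z)=\frac{s}{k}\log(\cosh(kr)),\qquad H_p(z,y)=\frac{r}{k}\log(\cosh(ks)).$$ Consequently, $$H_p(z,y)-H_p(y,z)=rs\,[\varphi(ks)-\varphi(kr)],\qquad\text{where }\varphi(t)=\frac{\log(\cosh t)}{t},\ t>0.$$ In particular, if $0<r<s$, then $H_p(z,y)>H_p(y,z)$.
   Context: A Hadamard manifold is a complete, simply connected Riemannian manifold of nonpositive sectional curvature; $d$ is its Riemannian distance and $\exp$ its exponential map (each $\exp_p$ is a diffeomorphism). For $q\in M$ and a unit vector $u\in T_qM$, $B_u^q(x)=\lim_{t\to+\infty}\bigl(d(x,\exp_q(tu))-t\bigr)$ is the Busemann function; for a nonzero $u\in T_qM$, $B_u^q:=B_{u/\|u\|}^q$. Busemann coupling with base point $p$: $H_p:M\times M\to\mathbb{R}$, $H_p(z,y)=d(p,z)\,B^p_{-\exp_p^{-1}z}(y)$ if $z\ne p$, and $H_p(p,y)=0$. *)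

theory Defs
  imports "HOL-Analysis.Analysis"
begin

text \<open>
  The manifold is the whole of a Hausdorff, second countable topological type \<open>'m\<close>; its dimension
  is that of the Euclidean model space \<open>'e\<close>. A chart is a pair of an open domain and a coordinate
  map; the values of the map outside the domain are irrelevant.
\<close>

type_synonym ('m, 'e) chart = "'m set \<times> ('m \<Rightarrow> 'e)"

definition cdom :: "('m, 'e) chart \<Rightarrow> 'm set"
  where "cdom c = fst c"

definition cmap :: "('m, 'e) chart \<Rightarrow> 'm \<Rightarrow> 'e"
  where "cmap c = snd c"

definition cinv :: "('m, 'e) chart \<Rightarrow> 'e \<Rightarrow> 'm"
  where "cinv c = inv_into (cdom c) (cmap c)"

definition is_chart :: "('m::topological_space, 'e::euclidean_space) chart \<Rightarrow> bool"
  where "is_chart c \<longleftrightarrow>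
    open (cdom c) \<and> open (cmap c ` cdom c) \<and>
    homeomorphism (cdom c) (cmap c ` cdom c) (cmap c) (cinv c)"

text \<open>Only meant for open sets \<open>S\<close>, where the full derivative \<open>at x\<close> depends on \<open>f\<close> on \<open>S\<close> alone.\<close>

primrec Ck_on ::
  "nat \<Rightarrow> 'a::euclidean_space set \<Rightarrow> ('a \<Rightarrow> 'b::real_normed_vector) \<Rightarrow> bool"
  where
    "Ck_on 0 S f \<longleftrightarrow> continuous_on S f"
  | "Ck_on (Suc n) S f \<longleftrightarrow>
      (\<forall>x\<in>S. f differentiable (at x)) \<and>
      (\<forall>v. Ck_on n S (\<lambda>x. frechet_derivative f (at x) v))"

definition smooth_on :: "'a::euclidean_space set \<Rightarrow> ('a \<Rightarrow> 'b::real_normed_vector) \<Rightarrow> bool"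
  where "smooth_on S f \<longleftrightarrow> (\<forall>n. Ck_on n S f)"

definition smooth_atlas ::
  "('m::{t2_space,second_countable_topology}, 'e::euclidean_space) chart set \<Rightarrow> bool"
  where "smooth_atlas A \<longleftrightarrow>
    (\<forall>c\<in>A. is_chart c) \<and> (\<Union>c\<in>A. cdom c) = UNIV \<and>
    (\<forall>c\<in>A. \<forall>d\<in>A. smooth_on (cmap c ` (cdom c \<inter> cdom d)) (cmap d \<circ> cinv c))"

text \<open>
  A tangent vector at \<open>p\<close> is a rule that assigns to each chart around \<open>p\<close> a coordinate vector,
  subject to the transformation law under change of charts. It is set to \<open>0\<close> on all other charts,
  so that equality of tangent vectors is equality of functions.
\<close>

type_synonym ('m, 'e) tvec = "('m, 'e) chart \<Rightarrow> 'e"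

definition chart_change ::
  "('m, 'e::euclidean_space) chart \<Rightarrow> ('m, 'e) chart \<Rightarrow> 'm \<Rightarrow> 'e \<Rightarrow> 'e"
  where "chart_change c d p = frechet_derivative (cmap d \<circ> cinv c) (at (cmap c p))"

definition tangent_space ::
  "('m, 'e::euclidean_space) chart set \<Rightarrow> 'm \<Rightarrow> ('m, 'e) tvec set"
  where "tangent_space A p =
    {u. (\<forall>c. c \<notin> A \<or> p \<notin> cdom c \<longrightarrow> u c = 0) \<and>
        (\<forall>c\<in>A. \<forall>d\<in>A. p \<in> cdom c \<and> p \<in> cdom d \<longrightarrow> u d = chart_change c d p (u c))}"

definition tscale :: "real \<Rightarrow> ('m, 'e::real_vector) tvec \<Rightarrow> ('m, 'e) tvec"
  where "tscale r u = (\<lambda>c. r *\<^sub>R u c)"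

text \<open>The tangent vector at \<open>p\<close> with coordinates \<open>a\<close> in the chart \<open>c\<close>.\<close>

definition coord_vec ::
  "('m, 'e::euclidean_space) chart set \<Rightarrow> ('m, 'e) chart \<Rightarrow> 'm \<Rightarrow> 'e \<Rightarrow> ('m, 'e) tvec"
  where "coord_vec A c p a =
    (\<lambda>d. if d \<in> A \<and> p \<in> cdom d then chart_change c d p a else 0)"

definition velocity ::
  "('m, 'e::euclidean_space) chart set \<Rightarrow> (real \<Rightarrow> 'm) \<Rightarrow> real \<Rightarrow> ('m, 'e) tvec"
  where "velocity A \<gamma> t =
    (\<lambda>c. if c \<in> A \<and> \<gamma> t \<in> cdom c then vector_derivative (cmap c \<circ> \<gamma>) (at t) else 0)"

type_synonym ('m, 'e) metric = "'m \<Rightarrow> ('m, 'e) tvec \<Rightarrow> ('m, 'e) tvec \<Rightarrow> real"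

text \<open>The metric in the coordinates of the chart \<open>c\<close>, as a bilinear form at the coordinate point \<open>x\<close>.\<close>

definition coord_metric ::
  "('m, 'e::euclidean_space) chart set \<Rightarrow> ('m, 'e) metric \<Rightarrow> ('m, 'e) chart
    \<Rightarrow> 'e \<Rightarrow> 'e \<Rightarrow> 'e \<Rightarrow> real"
  where "coord_metric A g c x a b =
    g (cinv c x) (coord_vec A c (cinv c x) a) (coord_vec A c (cinv c x) b)"

definition riemannian_manifold ::
  "('m::{t2_space,second_countable_topology}, 'e::euclidean_space) chart set
    \<Rightarrow> ('m, 'e) metric \<Rightarrow> bool"
  where "riemannian_manifold A g \<longleftrightarrow>
    smooth_atlas A \<and>
    (\<forall>c\<in>A. \<forall>x\<in>cmap c ` cdom c.
        bilinear (coord_metric A g c x) \<and>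
        (\<forall>a b. coord_metric A g c x a b = coord_metric A g c x b a) \<and>
        (\<forall>a. a \<noteq> 0 \<longrightarrow> coord_metric A g c x a a > 0)) \<and>
    (\<forall>c\<in>A. \<forall>a b. smooth_on (cmap c ` cdom c) (\<lambda>x. coord_metric A g c x a b))"

definition tnorm :: "('m, 'e) metric \<Rightarrow> 'm \<Rightarrow> ('m, 'e) tvec \<Rightarrow> real"
  where "tnorm g p u = sqrt (g p u u)"

text \<open>One-sided at the end points: derivatives are taken within the interval.\<close>

definition C1_curve ::
  "('m::topological_space, 'e::euclidean_space) chart set
    \<Rightarrow> (real \<Rightarrow> 'm) \<Rightarrow> real \<Rightarrow> real \<Rightarrow> bool"
  where "C1_curve A \<gamma> a b \<longleftrightarrow>
    a < b \<and> continuous_on {a..b} \<gamma> \<and>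
    (\<forall>c\<in>A. \<exists>v. continuous_on {t\<in>{a..b}. \<gamma> t \<in> cdom c} v \<and>
       (\<forall>t\<in>{a..b}. \<gamma> t \<in> cdom c \<longrightarrow>
          ((cmap c \<circ> \<gamma>) has_vector_derivative v t) (at t within {a..b})))"

inductive piecewise_C1_curve ::
  "('m::topological_space, 'e::euclidean_space) chart set
    \<Rightarrow> (real \<Rightarrow> 'm) \<Rightarrow> real \<Rightarrow> real \<Rightarrow> bool"
  for A :: "('m, 'e) chart set" and \<gamma> :: "real \<Rightarrow> 'm"
  where
    piece: "C1_curve A \<gamma> a b \<Longrightarrow> piecewise_C1_curve A \<gamma> a b"
  | join: "piecewise_C1_curve A \<gamma> a b \<Longrightarrow> piecewise_C1_curve A \<gamma> b c
      \<Longrightarrow> piecewise_C1_curve A \<gamma> a c"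

text \<open>
  For a piecewise \<open>C\<^sup>1\<close> curve the velocity is meaningful off the finitely many break points, which do
  not contribute to the integral.
\<close>

definition curve_length ::
  "('m, 'e::euclidean_space) chart set \<Rightarrow> ('m, 'e) metric \<Rightarrow> (real \<Rightarrow> 'm) \<Rightarrow> real \<Rightarrow> real \<Rightarrow> real"
  where "curve_length A g \<gamma> a b = integral {a..b} (\<lambda>t. tnorm g (\<gamma> t) (velocity A \<gamma> t))"

definition riem_dist ::
  "('m::topological_space, 'e::euclidean_space) chart set \<Rightarrow> ('m, 'e) metric \<Rightarrow> 'm \<Rightarrow> 'm \<Rightarrow> real"
  where "riem_dist A g p q =
    Inf {curve_length A g \<gamma> 0 1 | \<gamma>. piecewise_C1_curve A \<gamma> 0 1 \<and> \<gamma> 0 = p \<and> \<gamma> 1 = q}"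

text \<open>
  Levi-Civita connection in the coordinates of \<open>c\<close>: \<open>christoffel A g c x a b\<close> is the covariant
  derivative at \<open>x\<close> of the constant vector field \<open>b\<close> in the direction \<open>a\<close>, determined by the Koszul
  formula (the index raising is the definite description).
\<close>

definition christoffel ::
  "('m, 'e::euclidean_space) chart set \<Rightarrow> ('m, 'e) metric \<Rightarrow> ('m, 'e) chart
    \<Rightarrow> 'e \<Rightarrow> 'e \<Rightarrow> 'e \<Rightarrow> 'e"
  where "christoffel A g c x a b =
    (THE v. \<forall>w. 2 * coord_metric A g c x v w =
         frechet_derivative (\<lambda>y. coord_metric A g c y b w) (at x) a
       + frechet_derivative (\<lambda>y. coord_metric A g c y a w) (at x) b
       - frechet_derivative (\<lambda>y. coord_metric A g c y a b) (at x) w)"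

text \<open>Geodesics defined on the whole real line, through the equation \<open>x'' = - \<Gamma>(x', x')\<close>.\<close>

definition geodesic ::
  "('m::topological_space, 'e::euclidean_space) chart set \<Rightarrow> ('m, 'e) metric
    \<Rightarrow> (real \<Rightarrow> 'm) \<Rightarrow> bool"
  where "geodesic A g \<gamma> \<longleftrightarrow>
    continuous_on UNIV \<gamma> \<and>
    (\<forall>c\<in>A. \<forall>t. \<gamma> t \<in> cdom c \<longrightarrow>
       (cmap c \<circ> \<gamma>) differentiable (at t) \<and>
       ((\<lambda>s. vector_derivative (cmap c \<circ> \<gamma>) (at s)) has_vector_derivative
          - christoffel A g c (cmap c (\<gamma> t))
              (vector_derivative (cmap c \<circ> \<gamma>) (at t))
              (vector_derivative (cmap c \<circ> \<gamma>) (at t))) (at t))"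

definition geodesically_complete ::
  "('m::topological_space, 'e::euclidean_space) chart set \<Rightarrow> ('m, 'e) metric \<Rightarrow> bool"
  where "geodesically_complete A g \<longleftrightarrow>
    (\<forall>p. \<forall>u\<in>tangent_space A p. \<exists>\<gamma>. geodesic A g \<gamma> \<and> \<gamma> 0 = p \<and> velocity A \<gamma> 0 = u)"

definition riem_exp ::
  "('m::topological_space, 'e::euclidean_space) chart set \<Rightarrow> ('m, 'e) metric
    \<Rightarrow> 'm \<Rightarrow> ('m, 'e) tvec \<Rightarrow> 'm"
  where "riem_exp A g p u =
    (THE \<gamma>. geodesic A g \<gamma> \<and> \<gamma> 0 = p \<and> velocity A \<gamma> 0 = u) 1"

definition riem_log ::
  "('m::topological_space, 'e::euclidean_space) chart set \<Rightarrow> ('m, 'e) metric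
    \<Rightarrow> 'm \<Rightarrow> 'm \<Rightarrow> ('m, 'e) tvec"
  where "riem_log A g p = inv_into (tangent_space A p) (riem_exp A g p)"

text \<open>
  \<open>R(a, b) v = \<nabla>\<^sub>a \<nabla>\<^sub>b v - \<nabla>\<^sub>b \<nabla>\<^sub>a v\<close> for constant coordinate vector fields, which commute.
  With this sign the sectional curvature below is positive on round spheres.
\<close>

definition curvature_tensor ::
  "('m, 'e::euclidean_space) chart set \<Rightarrow> ('m, 'e) metric \<Rightarrow> ('m, 'e) chart
    \<Rightarrow> 'e \<Rightarrow> 'e \<Rightarrow> 'e \<Rightarrow> 'e \<Rightarrow> 'e"
  where "curvature_tensor A g c x a b v =
      frechet_derivative (\<lambda>y. christoffel A g c y b v) (at x) a
    - frechet_derivative (\<lambda>y. christoffel A g c y a v) (at x) b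
    + christoffel A g c x a (christoffel A g c x b v)
    - christoffel A g c x b (christoffel A g c x a v)"

definition sectional_curvature ::
  "('m, 'e::euclidean_space) chart set \<Rightarrow> ('m, 'e) metric \<Rightarrow> ('m, 'e) chart
    \<Rightarrow> 'e \<Rightarrow> 'e \<Rightarrow> 'e \<Rightarrow> real"
  where "sectional_curvature A g c x a b =
    coord_metric A g c x (curvature_tensor A g c x a b b) a /
    (coord_metric A g c x a a * coord_metric A g c x b b - (coord_metric A g c x a b)\<^sup>2)"

definition nonpositive_curvature ::
  "('m, 'e::euclidean_space) chart set \<Rightarrow> ('m, 'e) metric \<Rightarrow> bool"
  where "nonpositive_curvature A g \<longleftrightarrow>
    (\<forall>c\<in>A. \<forall>x\<in>cmap c ` cdom c. \<forall>a b.
       a \<noteq> b \<and> independent {a, b} \<longrightarrow> sectional_curvature A g c x a b \<le> 0)"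

definition constant_curvature ::
  "('m, 'e::euclidean_space) chart set \<Rightarrow> ('m, 'e) metric \<Rightarrow> real \<Rightarrow> bool"
  where "constant_curvature A g \<kappa> \<longleftrightarrow>
    (\<forall>c\<in>A. \<forall>x\<in>cmap c ` cdom c. \<forall>a b.
       a \<noteq> b \<and> independent {a, b} \<longrightarrow> sectional_curvature A g c x a b = \<kappa>)"

definition hadamard_manifold ::
  "('m::{t2_space,second_countable_topology}, 'e::euclidean_space) chart set
    \<Rightarrow> ('m, 'e) metric \<Rightarrow> bool"
  where "hadamard_manifold A g \<longleftrightarrow>
    riemannian_manifold A g \<and> geodesically_complete A g \<and>
    simply_connected (UNIV :: 'm set) \<and> nonpositive_curvature A g"

definition busemann ::
  "('m::topological_space, 'e::euclidean_space) chart set \<Rightarrow> ('m, 'e) metric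
    \<Rightarrow> 'm \<Rightarrow> ('m, 'e) tvec \<Rightarrow> 'm \<Rightarrow> real"
  where "busemann A g q u x =
    Lim at_top (\<lambda>t::real.
      riem_dist A g x (riem_exp A g q (tscale t (tscale (1 / tnorm g q u) u))) - t)"

definition busemann_coupling ::
  "('m::topological_space, 'e::euclidean_space) chart set \<Rightarrow> ('m, 'e) metric
    \<Rightarrow> 'm \<Rightarrow> 'm \<Rightarrow> 'm \<Rightarrow> real"
  where "busemann_coupling A g p z y =
    (if z = p then 0
     else riem_dist A g p z * busemann A g p (tscale (- 1) (riem_log A g p z)) y)"

definition log_cosh_ratio :: "real \<Rightarrow> real"
  where "log_cosh_ratio t = ln (cosh t) / t"

end

theory Submission
  imports Defs
begin

text \<open>
  On the sum of the tangent bundle and a trivial line bundle consider the connection whose parallel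
  sections are the pairs of a gradient field \<open>V = grad f\<close> and a function \<open>f\<close> with \<open>Hess f = k\<^sup>2 f g\<close>. It is
  flat because the curvature is \<open>- k\<^sup>2\<close>, and so, \<open>M\<close> being simply connected, every value at a point extends
  to a global parallel section. Such functions play the role of the linear coordinates of the hyperboloid
  model: \<open>f\<close> solves \<open>f'' = k\<^sup>2 f\<close> along unit speed geodesics, and \<open>g V V' - k\<^sup>2 f f'\<close> is constant for any two
  sections. Let \<open>h\<close> be the function of the section with value \<open>(0, 1)\<close> at \<open>q\<close>. Then
  \<open>|grad h|\<^sup>2 = k\<^sup>2 (h\<^sup>2 - 1)\<close>, so \<open>arcosh h / k\<close> bounds the distance to \<open>q\<close> from below, and geodesics
  along \<open>- grad h\<close> attain the bound once one knows that they end at \<open>q\<close>. For \<open>q = exp\<^sub>p v\<close> the values of \<open>h\<close>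
  at points \<open>exp\<^sub>p w\<close> are given by the hyperbolic law of cosines. For orthogonal vectors this is
  \<open>cosh (k |v|) cosh (k |w|)\<close>, and the limit defining the Busemann function can be computed.
\<close>

section \<open>Global sections of local systems\<close>

text \<open>Geodesics are given only as solutions of an equation in charts: existence is assumed,
  while uniqueness and dependence on initial values are not. The sections supply both. Along a
  geodesic every section is an explicit combination of \<open>cosh\<close> and \<open>sinhc\<close>,
  with coefficients read off at time 0, and finitely many sections separate the points of a small
  neighbourhood. Hence geodesics with equal initial data coincide, the definite description in
  \<open>riem_exp\<close> has a value, and endpoints vary continuously with the data. The formulas
  also recover a tangent vector from the values of all sections at its endpoint, which makes
  \<open>riem_exp\<close> injective and \<open>riem_log\<close> its left inverse. The obstacle is
  that sections are known to separate points only locally. Equality of points is therefore never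
  read off from equality of section values alone; each time it is spread by connectedness, over the
  parameter line for two curves and over the manifold for the claim that all minimizing geodesics
  end at \<open>q\<close>.\<close>

lemma continuous_on_open_preimage_iff:
  assumes "continuous_on S H" "open U"
  shows "\<exists>N. open N \<and> (\<forall>l\<in>S. l \<in> N \<longleftrightarrow> H l \<in> U)"
proof -
  obtain N where N: "open N" "N \<inter> S = H -` U \<inter> S"
    using assms unfolding continuous_on_open_invariant by auto
  have "\<forall>l\<in>S. l \<in> N \<longleftrightarrow> H l \<in> U" using N(2) by blast
  then show ?thesis using N(1) by blast
qed

text \<open>
  A local system presented by its flat sections: \<open>P \<sigma> x\<close> says that the germ of \<open>\<sigma>\<close> at \<open>x\<close> is flat, and
  \<open>Fib x\<close> is the fibre over \<open>x\<close>.
\<close>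

locale local_system =
  fixes P :: "('x::topological_space \<Rightarrow> 'j) \<Rightarrow> 'x \<Rightarrow> bool"
    and Fib :: "'x \<Rightarrow> 'j set"
  assumes germ: "\<lbrakk>open U; x \<in> U; \<And>y. y \<in> U \<Longrightarrow> \<sigma> y = \<tau> y; P \<sigma> x\<rbrakk> \<Longrightarrow> P \<tau> x"
    and fibre: "P \<sigma> x \<Longrightarrow> \<sigma> x \<in> Fib x"
    and ex_local: "\<exists>U. open U \<and> x \<in> U \<and> path_connected U \<and>
      (\<forall>x'\<in>U. \<forall>j\<in>Fib x'. \<exists>\<sigma>. \<sigma> x' = j \<and> (\<forall>y\<in>U. P \<sigma> y))"
    and unique_local: "\<lbrakk>open U; x \<in> U; \<And>y. y \<in> U \<Longrightarrow> P \<sigma> y; \<And>y. y \<in> U \<Longrightarrow> P \<tau> y\<rbrakk> \<Longrightarrow>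
      \<exists>W. open W \<and> x \<in> W \<and> ((\<forall>y\<in>W. \<sigma> y = \<tau> y) \<or> (\<forall>y\<in>W. \<sigma> y \<noteq> \<tau> y))"
begin

text \<open>Local data for a continuous lift of \<open>H\<close> to the space of germs of flat
  sections, written without constructing that space. The domain \<open>S\<close> is an arbitrary
  subset, so that paths, squares and subrectangles are treated alike.\<close>

definition lift_germ ::
  "'a::topological_space set \<Rightarrow> ('a \<Rightarrow> 'x) \<Rightarrow> ('a \<Rightarrow> 'j) \<Rightarrow> 'a \<Rightarrow> 'a set \<Rightarrow> 'x set \<Rightarrow> ('x \<Rightarrow> 'j) \<Rightarrow> bool"
  where "lift_germ S H s k N U \<sigma> \<longleftrightarrow> open N \<and> k \<in> N \<and> open U \<and> H ` (N \<inter> S) \<subseteq> U \<and>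
    (\<forall>y\<in>U. P \<sigma> y) \<and> (\<forall>l\<in>N \<inter> S. s l = \<sigma> (H l))"

lemma lift_germD:
  assumes "lift_germ S H s k N U \<sigma>"
  shows "open N" "k \<in> N" "open U" "\<And>l. l \<in> N \<Longrightarrow> l \<in> S \<Longrightarrow> H l \<in> U"
    "\<And>y. y \<in> U \<Longrightarrow> P \<sigma> y" "\<And>l. l \<in> N \<Longrightarrow> l \<in> S \<Longrightarrow> s l = \<sigma> (H l)"
  using assms unfolding lift_germ_def by auto

definition lift :: "'a::topological_space set \<Rightarrow> ('a \<Rightarrow> 'x) \<Rightarrow> ('a \<Rightarrow> 'j) \<Rightarrow> bool"
  where "lift S H s \<longleftrightarrow> continuous_on S H \<and> (\<forall>k\<in>S. \<exists>N U \<sigma>. lift_germ S H s k N U \<sigma>)"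

lemma lift_continuous: "lift S H s \<Longrightarrow> continuous_on S H"
  by (simp add: lift_def)

lemma liftE:
  assumes "lift S H s" "k \<in> S"
  obtains N U \<sigma> where "lift_germ S H s k N U \<sigma>"
  using assms unfolding lift_def by blast

text \<open>It suffices that \<open>H\<close> maps the single point \<open>k\<close> into
  \<open>U\<close>: continuity shrinks \<open>N\<close> until the rest of it follows.\<close>

lemma lift_germI:
  assumes H: "continuous_on S H" and "open N" "k \<in> N" "open U" "H k \<in> U" "k \<in> S"
    and "\<And>y. y \<in> U \<Longrightarrow> P \<sigma> y" "\<And>l. l \<in> N \<Longrightarrow> l \<in> S \<Longrightarrow> s l = \<sigma> (H l)"
  shows "\<exists>N U \<sigma>. lift_germ S H s k N U \<sigma>"
proof -
  obtain N' where N': "open N'" "\<forall>l\<in>S. l \<in> N' \<longleftrightarrow> H l \<in> U"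
    using continuous_on_open_preimage_iff[OF H assms(4)] by blast
  have "lift_germ S H s k (N \<inter> N') U \<sigma>"
    unfolding lift_germ_def
  proof (intro conjI ballI)
    show "k \<in> N \<inter> N'" using N'(2) assms(3,5,6) by simp
    show "H ` (N \<inter> N' \<inter> S) \<subseteq> U" using N'(2) by blast
  qed (use assms(2,4,7,8) N'(1) in \<open>simp_all add: open_Int\<close>)
  then show ?thesis by (intro exI)
qed

lemma lift_fibre: "lift S H s \<Longrightarrow> k \<in> S \<Longrightarrow> s k \<in> Fib (H k)"
proof -
  assume "lift S H s" and k: "k \<in> S"
  then obtain N U \<sigma> where "lift_germ S H s k N U \<sigma>" by (rule liftE)
  note N = lift_germD[OF this]
  show ?thesis using fibre[OF N(5)[OF N(4)[OF N(2) k]]] N(6)[OF N(2) k] by simp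
qed

lemma lift_cong:
  assumes "lift S H s" and eq: "\<And>k. k \<in> S \<Longrightarrow> H k = H' k"
  shows "lift S H' s"
proof -
  have "continuous_on S H' = continuous_on S H" by (rule continuous_on_cong) (simp_all add: eq)
  moreover have "lift_germ S H' s = lift_germ S H s"
    using eq by (intro ext) (auto simp: lift_germ_def)
  ultimately show ?thesis using assms(1) unfolding lift_def by simp
qed

text \<open>One reparametrization rule serves for edges of squares, halves of joined paths and
  reversed paths.\<close>

lemma lift_compose:
  assumes "lift S H s" "continuous_on T \<phi>" "\<phi> ` T \<subseteq> S"
  shows "lift T (H \<circ> \<phi>) (s \<circ> \<phi>)"
  unfolding lift_def
proof (intro conjI ballI)
  show c: "continuous_on T (H \<circ> \<phi>)"
    by (rule continuous_on_compose[OF assms(2) continuous_on_subset[OF lift_continuous[OF assms(1)] assms(3)]])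
  fix k assume k: "k \<in> T"
  then have "\<phi> k \<in> S" using assms by blast
  then obtain N U \<sigma> where "lift_germ S H s (\<phi> k) N U \<sigma>"
    by (rule liftE[OF assms(1)])
  note N = lift_germD[OF this]
  obtain N' where N': "open N'" "\<forall>l\<in>T. l \<in> N' \<longleftrightarrow> \<phi> l \<in> N"
    using continuous_on_open_preimage_iff[OF assms(2) N(1)] by blast
  show "\<exists>N U \<sigma>. lift_germ T (H \<circ> \<phi>) (s \<circ> \<phi>) k N U \<sigma>"
  proof (rule lift_germI[OF c N'(1) _ N(3) _ k N(5)])
    show "k \<in> N'" using N'(2) k N(2) by simp
    show "(H \<circ> \<phi>) k \<in> U" using N(4)[OF N(2)] \<open>\<phi> k \<in> S\<close> by simp
    show "(s \<circ> \<phi>) l = \<sigma> ((H \<circ> \<phi>) l)" if "l \<in> N'" "l \<in> T" for l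
      using N(6)[of "\<phi> l"] N'(2) that assms(3) by auto
  qed
qed

lemma lift_subset: "lift S H s \<Longrightarrow> T \<subseteq> S \<Longrightarrow> lift T H s"
  using lift_compose[of S H s T id] by (simp add: comp_def)

lemma lift_section:
  assumes "continuous_on S H" "open U" "H ` S \<subseteq> U" "\<And>y. y \<in> U \<Longrightarrow> P \<sigma> y"
  shows "lift S H (\<sigma> \<circ> H)"
  unfolding lift_def
proof (intro conjI ballI)
  fix k assume "k \<in> S"
  then show "\<exists>N U' \<sigma>'. lift_germ S H (\<sigma> \<circ> H) k N U' \<sigma>'"
    by (intro lift_germI[OF assms(1) open_UNIV _ assms(2) _ _ assms(4)]) (use assms in auto)
qed (rule assms)

text \<open>The dichotomy of \<open>unique_local\<close>, pulled back along \<open>H\<close>. Both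
  alternatives hold on open sets, which plays the role of the Hausdorff property for the space of
  germs.\<close>

lemma locally_constant_equality:
  assumes "open U" "open N" "k \<in> N" "k \<in> S" "continuous_on S H" "H k \<in> U"
    "\<And>y. y \<in> U \<Longrightarrow> P \<sigma> y" "\<And>y. y \<in> U \<Longrightarrow> P \<tau> y"
  shows "\<exists>N'. open N' \<and> k \<in> N' \<and> N' \<subseteq> N \<and>
    ((\<forall>l\<in>N' \<inter> S. \<sigma> (H l) = \<tau> (H l)) \<or> (\<forall>l\<in>N' \<inter> S. \<sigma> (H l) \<noteq> \<tau> (H l)))"
proof -
  obtain W where W: "open W" "H k \<in> W" "(\<forall>y\<in>W. \<sigma> y = \<tau> y) \<or> (\<forall>y\<in>W. \<sigma> y \<noteq> \<tau> y)"
    using unique_local[OF assms(1,6), of \<sigma> \<tau>] assms(7,8) by blast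
  obtain N' where N': "open N'" "\<forall>l\<in>S. l \<in> N' \<longleftrightarrow> H l \<in> W"
    using continuous_on_open_preimage_iff[OF assms(5) W(1)] by blast
  then show ?thesis
    using W N' assms by (intro exI[of _ "N \<inter> N'"]) auto
qed

text \<open>The set where two lifts agree is relatively open, and so is its complement.\<close>

lemma lift_unique:
  assumes "lift S H s" "lift S H t" "connected S" "k \<in> S" "s k = t k" "l \<in> S"
  shows "s l = t l"
proof -
  have loc: "\<exists>N. open N \<and> k \<in> N \<and> ((\<forall>l\<in>N \<inter> S. s l = t l) \<or> (\<forall>l\<in>N \<inter> S. s l \<noteq> t l))"
    if k: "k \<in> S" for k
  proof -
    have H: "continuous_on S H" using assms(1) by (rule lift_continuous)
    obtain N U \<sigma> where "lift_germ S H s k N U \<sigma>" using assms(1) k by (rule liftE)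
    note N = lift_germD[OF this]
    obtain N' U' \<sigma>' where "lift_germ S H t k N' U' \<sigma>'" using assms(2) k by (rule liftE)
    note N' = lift_germD[OF this]
    obtain N'' where "open N''" "k \<in> N''" "N'' \<subseteq> N \<inter> N'"
      "(\<forall>l\<in>N'' \<inter> S. \<sigma> (H l) = \<sigma>' (H l)) \<or> (\<forall>l\<in>N'' \<inter> S. \<sigma> (H l) \<noteq> \<sigma>' (H l))"
      using locally_constant_equality[of "U \<inter> U'" "N \<inter> N'" k S H \<sigma> \<sigma>'] N N' k H by auto
    moreover have "s l = \<sigma> (H l) \<and> t l = \<sigma>' (H l)" if "l \<in> N'' \<inter> S" for l
      using N(6)[of l] N'(6)[of l] calculation(3) that by blast
    ultimately show ?thesis by (intro exI[of _ N'']) simp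
  qed
  show ?thesis
  proof (rule connected_induction_simple[of S k l "\<lambda>a. s a = t a", OF assms(3,4,6,5)])
    fix a assume a: "a \<in> S"
    obtain N where "open N" "a \<in> N" "((\<forall>l\<in>N \<inter> S. s l = t l) \<or> (\<forall>l\<in>N \<inter> S. s l \<noteq> t l))"
      using loc[OF a] by blast
    then show "\<exists>T. openin (top_of_set S) T \<and> a \<in> T \<and> (\<forall>x\<in>T. \<forall>y\<in>T. s x = t x \<longrightarrow> s y = t y)"
      using a by (intro exI[of _ "S \<inter> N"]) (auto simp: openin_open)
  qed
qed

text \<open>The value may be prescribed at any point of \<open>Q\<close>, not just at a corner; this
  lets two pieces be glued starting from either of them.\<close>

definition full_lift :: "(real \<times> real \<Rightarrow> 'x) \<Rightarrow> (real \<times> real) set \<Rightarrow> bool"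
  where "full_lift H Q \<longleftrightarrow> (\<forall>k\<in>Q. \<forall>j\<in>Fib (H k). \<exists>s. lift Q H s \<and> s k = j)"

text \<open>The lift over \<open>Q2\<close> is started at \<open>m\<close> with the value already
  reached there, and connectedness of the overlap makes the two lifts agree on all of it. Since the
  pieces are closed, a point outside the overlap has a neighbourhood that meets only one of
  them.\<close>

lemma full_lift_Un_aux:
  assumes H: "continuous_on (Q1 \<union> Q2) H"
    and Q: "closed Q1" "closed Q2" "connected Q1" "connected Q2" "connected (Q1 \<inter> Q2)" "m \<in> Q1 \<inter> Q2"
    and F: "full_lift H Q1" "full_lift H Q2"
    and k: "k \<in> Q1" "j \<in> Fib (H k)"
  shows "\<exists>s. lift (Q1 \<union> Q2) H s \<and> s k = j"
proof -
  obtain s1 where s1: "lift Q1 H s1" "s1 k = j" using F k unfolding full_lift_def by blast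
  have "s1 m \<in> Fib (H m)" using lift_fibre s1(1) Q(6) by blast
  then obtain s2 where s2: "lift Q2 H s2" "s2 m = s1 m" using F Q unfolding full_lift_def by blast
  have eq: "s1 l = s2 l" if "l \<in> Q1" "l \<in> Q2" for l
    using lift_unique[of "Q1 \<inter> Q2" H s1 s2 m l] lift_subset s1 s2 Q that by (metis Int_iff inf_le1 inf_le2)
  define s where "s = (\<lambda>l. if l \<in> Q1 then s1 l else s2 l)"
  have "lift (Q1 \<union> Q2) H s"
    unfolding lift_def
  proof (intro conjI ballI H)
    fix a assume a: "a \<in> Q1 \<union> Q2"
    consider "a \<in> Q1" "a \<notin> Q2" | "a \<notin> Q1" "a \<in> Q2" | "a \<in> Q1" "a \<in> Q2" using a by blast
    then show "\<exists>N U \<sigma>. lift_germ (Q1 \<union> Q2) H s a N U \<sigma>"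
    proof cases
      case 1
      obtain N U \<sigma> where "lift_germ Q1 H s1 a N U \<sigma>" using s1(1) 1(1) by (rule liftE)
      note N = lift_germD[OF this]
      have o: "open (N \<inter> - Q2)" using N Q by auto
      show ?thesis
        by (rule lift_germI[OF H o _ N(3) _ a N(5)]) (use N 1 in \<open>auto simp: s_def\<close>)
    next
      case 2
      obtain N U \<sigma> where "lift_germ Q2 H s2 a N U \<sigma>" using s2(1) 2(2) by (rule liftE)
      note N = lift_germD[OF this]
      have o: "open (N \<inter> - Q1)" using N Q by auto
      show ?thesis
        by (rule lift_germI[OF H o _ N(3) _ a N(5)]) (use N 2 in \<open>auto simp: s_def\<close>)
    next
      case 3
      obtain N U \<sigma> where "lift_germ Q1 H s1 a N U \<sigma>" using s1(1) 3(1) by (rule liftE)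
      note N = lift_germD[OF this]
      obtain N' U' \<sigma>' where "lift_germ Q2 H s2 a N' U' \<sigma>'" using s2(1) 3(2) by (rule liftE)
      note N' = lift_germD[OF this]
      \<comment> \<open>Agreement at \<open>a\<close> excludes the alternative of nowhere equal
        sections, so one local section serves on both sides of the overlap.\<close>
      have "\<sigma> (H a) = \<sigma>' (H a)" using N(6)[of a] N'(6)[of a] N(2) N'(2) 3 eq by auto
      then obtain N'' where N'': "open N''" "a \<in> N''" "N'' \<subseteq> N \<inter> N'"
        "\<forall>l\<in>N'' \<inter> (Q1 \<union> Q2). \<sigma> (H l) = \<sigma>' (H l)"
        using locally_constant_equality[of "U \<inter> U'" "N \<inter> N'" a "Q1 \<union> Q2" H \<sigma> \<sigma>'] N N' a 3 H by auto
      show ?thesis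
        by (rule lift_germI[OF H N''(1,2) N(3) _ a N(5)])
          (use N(2,4,6) N'(6) N'' 3 in \<open>auto simp: s_def subset_iff\<close>)
    qed
  qed
  then show ?thesis using s1 k by (auto simp: s_def)
qed

lemma full_lift_Un:
  assumes H: "continuous_on (Q1 \<union> Q2) H"
    and Q: "closed Q1" "closed Q2" "connected Q1" "connected Q2" "connected (Q1 \<inter> Q2)" "Q1 \<inter> Q2 \<noteq> {}"
    and F: "full_lift H Q1" "full_lift H Q2"
  shows "full_lift H (Q1 \<union> Q2)"
proof -
  obtain m where m: "m \<in> Q1 \<inter> Q2" using Q by blast
  show ?thesis
    using full_lift_Un_aux[OF H Q(1-5) m F] full_lift_Un_aux[of Q2 Q1 H m] H Q(1-5) m F
    unfolding full_lift_def by (auto simp: Un_commute Int_commute)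
qed

text \<open>Near \<open>k\<close> the map stays in one open set over which every fibre value extends
  to a flat section; composing it with \<open>H\<close> lifts every subset.\<close>

lemma full_lift_small:
  assumes "continuous_on S H" "k \<in> S"
  shows "\<exists>N. open N \<and> k \<in> N \<and> (\<forall>Q. Q \<subseteq> N \<inter> S \<longrightarrow> full_lift H Q)"
proof -
  obtain U where U: "open U" "H k \<in> U"
    "\<forall>x'\<in>U. \<forall>j\<in>Fib x'. \<exists>\<sigma>. \<sigma> x' = j \<and> (\<forall>y\<in>U. P \<sigma> y)"
    using ex_local by blast
  obtain N where N: "open N" "\<forall>l\<in>S. l \<in> N \<longleftrightarrow> H l \<in> U"
    using continuous_on_open_preimage_iff[OF assms(1) U(1)] by blast
  have "full_lift H Q" if Q: "Q \<subseteq> N \<inter> S" for Q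
    unfolding full_lift_def
  proof (intro ballI)
    fix l j assume l: "l \<in> Q" "j \<in> Fib (H l)"
    have HQ: "H ` Q \<subseteq> U" using Q N by auto
    then obtain \<sigma> where \<sigma>: "\<sigma> (H l) = j" "\<forall>y\<in>U. P \<sigma> y" using U l by blast
    have "lift Q H (\<sigma> \<circ> H)"
      by (rule lift_section[OF _ U(1) HQ]) (use Q assms \<sigma> continuous_on_subset in auto)
    then show "\<exists>s. lift Q H s \<and> s l = j" using \<sigma> by (intro exI[of _ "\<sigma> \<circ> H"]) auto
  qed
  then show ?thesis using N U assms by (intro exI[of _ N]) auto
qed

text \<open>Two nested bisections replace a Lebesgue number: the outer one cuts the square into
  vertical strips, the inner one cuts a narrow strip into small rectangles.\<close>

lemma full_lift_rect:
  assumes H: "continuous_on ({0..1} \<times> {0..1}) H"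
  shows "full_lift H ({0..1} \<times> {0..1})"
proof -
  let ?R = "\<lambda>a b c d. 0 \<le> a \<and> b \<le> 1 \<and> 0 \<le> c \<and> d \<le> 1 \<and> a \<le> b \<and> c \<le> d \<longrightarrow> full_lift H ({a..b} \<times> {c..d})"
  have sub: "continuous_on ({a..b} \<times> {c..d}) H" if "0 \<le> a" "b \<le> 1" "0 \<le> c" "d \<le> 1" for a b c d
    by (rule continuous_on_subset[OF H]) (use that in auto)
  have con: "connected ({a..b} \<times> {c..d})" for a b c d :: real
    by (intro convex_connected convex_Times) auto
  have "?R 0 1 0 1"
  proof (rule Bolzano[of 0 1 "\<lambda>a b. ?R a b 0 1"])
    fix a b c assume 1: "?R a b 0 1" "?R b c 0 1" "a \<le> b" "b \<le> (c::real)"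
    show "?R a c 0 1"
    proof safe
      assume 2: "0 \<le> a" "c \<le> 1"
      have u: "{a..c} \<times> {0..1::real} = {a..b} \<times> {0..1} \<union> {b..c} \<times> {0..1}" using 1 by auto
      have i: "({a..b} \<times> {0..1}) \<inter> ({b..c} \<times> {0..1::real}) = {b..b} \<times> {0..1}" using 1 by auto
      have "full_lift H ({a..b} \<times> {0..1} \<union> {b..c} \<times> {0..1})"
        by (rule full_lift_Un) (use 1 2 con sub[of a c 0 1] in \<open>auto simp: i u[symmetric] closed_Times simp del: atLeastAtMost_singleton\<close>)
      then show "full_lift H ({a..c} \<times> {0..1})" by (simp add: u)
    qed
  next
    fix x :: real assume x: "0 \<le> x" "x \<le> 1"
    \<comment> \<open>The admissible width of the strip around \<open>x\<close> may depend on the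
      heights \<open>c\<close> and \<open>d\<close>; joining two rectangles takes the smaller
      width.\<close>
    let ?L = "\<lambda>c d. \<exists>\<delta>>0. \<forall>a b. a \<le> x \<and> x \<le> b \<and> b - a < \<delta> \<longrightarrow> ?R a b c d"
    have "?L 0 1"
    proof (rule Bolzano[of 0 1 "\<lambda>c d. ?L c d"])
      fix c d e :: real assume 1: "?L c d" "?L d e" "c \<le> d" "d \<le> e"
      obtain \<delta>1 where d1: "\<delta>1 > 0" "\<And>a b. a \<le> x \<and> x \<le> b \<and> b - a < \<delta>1 \<longrightarrow> ?R a b c d" using 1 by blast
      obtain \<delta>2 where d2: "\<delta>2 > 0" "\<And>a b. a \<le> x \<and> x \<le> b \<and> b - a < \<delta>2 \<longrightarrow> ?R a b d e" using 1 by blast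
      show "?L c e"
      proof (intro exI[of _ "min \<delta>1 \<delta>2"] conjI allI impI)
        fix a b assume 2: "a \<le> x \<and> x \<le> b \<and> b - a < min \<delta>1 \<delta>2"
          and 3: "0 \<le> a \<and> b \<le> 1 \<and> 0 \<le> c \<and> e \<le> 1 \<and> a \<le> b \<and> c \<le> e"
        have u: "{a..b} \<times> {c..e} = {a..b} \<times> {c..d} \<union> {a..b} \<times> {d..e}" using 1 by auto
        have i: "({a..b} \<times> {c..d}) \<inter> ({a..b} \<times> {d..e}) = {a..b} \<times> {d..d}" using 1 by auto
        have f: "full_lift H ({a..b} \<times> {c..d})" "full_lift H ({a..b} \<times> {d..e})"
          using d1(2)[of a b] d2(2)[of a b] 1 2 3 by auto
        have "full_lift H ({a..b} \<times> {c..d} \<union> {a..b} \<times> {d..e})"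
          by (rule full_lift_Un) (use 1 3 f con sub[of a b c e] in \<open>auto simp: i u[symmetric] closed_Times simp del: atLeastAtMost_singleton\<close>)
        then show "full_lift H ({a..b} \<times> {c..e})" by (simp add: u)
      qed (use d1 d2 in auto)
    next
      fix y :: real assume y: "0 \<le> y" "y \<le> 1"
      obtain N where N: "open N" "(x,y) \<in> N" "\<forall>Q. Q \<subseteq> N \<inter> ({0..1} \<times> {0..1}) \<longrightarrow> full_lift H Q"
        using full_lift_small[OF H, of "(x,y)"] x y by auto
      obtain A B where AB: "open A" "open B" "(x,y) \<in> A \<times> B" "A \<times> B \<subseteq> N"
        using N(1,2) by (rule open_prod_elim)
      obtain e1 where e1: "e1 > 0" "ball x e1 \<subseteq> A" using AB(3) open_contains_ball_eq[OF AB(1), of x] by auto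
      obtain e2 where e2: "e2 > 0" "ball y e2 \<subseteq> B" using AB(3) open_contains_ball_eq[OF AB(2), of y] by auto
      show "\<exists>d>0. \<forall>c e. c \<le> y \<and> y \<le> e \<and> e - c < d \<longrightarrow> ?L c e"
      proof (rule exI[of _ e2], intro conjI allI impI)
        fix c d
        assume 2: "c \<le> y \<and> y \<le> d \<and> d - c < e2"
        show "?L c d"
        proof (rule exI[of _ e1], intro conjI allI impI)
          fix a b
          assume 4: "a \<le> x \<and> x \<le> b \<and> b - a < e1"
            and 3: "0 \<le> a \<and> b \<le> 1 \<and> 0 \<le> c \<and> d \<le> 1 \<and> a \<le> b \<and> c \<le> d"
          have "{a..b} \<subseteq> ball x e1" "{c..d} \<subseteq> ball y e2" using 2 4 by (auto simp: dist_real_def)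
          then have "{a..b} \<times> {c..d} \<subseteq> N" using AB(4) e1(2) e2(2) by blast
          moreover have "{a..b} \<times> {c..d} \<subseteq> {0..1} \<times> {0..1}" using 3 by auto
          ultimately show "full_lift H ({a..b} \<times> {c..d})" using N by auto
        qed (rule e1)
      qed (rule e2)
    qed auto
    then show "\<exists>d>0. \<forall>a b. a \<le> x \<and> x \<le> b \<and> b - a < d \<longrightarrow> ?R a b 0 1" .
  qed auto
  then show ?thesis by auto
qed

text \<open>A path is regarded as a square that is constant in its first variable.\<close>

lemma ex_lift_path:
  assumes "path \<gamma>" "j \<in> Fib (\<gamma> 0)"
  shows "\<exists>s. lift {0..1} \<gamma> s \<and> s 0 = j"
proof -
  have "continuous_on ({0..1} \<times> {0..1}) (\<lambda>k::real\<times>real. \<gamma> (snd k))"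
    by (rule continuous_on_compose2[of "{0..1}" \<gamma>]) (use assms in \<open>auto simp: path_def intro!: continuous_intros\<close>)
  then obtain s where s: "lift ({0..1} \<times> {0..1}) (\<lambda>k::real\<times>real. \<gamma> (snd k)) s" "s (0,0) = j"
    using full_lift_rect assms unfolding full_lift_def by (metis atLeastAtMost_iff mem_Sigma_iff order_refl snd_conv zero_le_one)
  have "lift {0..1} ((\<lambda>k::real\<times>real. \<gamma> (snd k)) \<circ> Pair 0) (s \<circ> Pair 0)"
    by (rule lift_compose[OF s(1)]) (auto intro!: continuous_intros)
  then show ?thesis using s by (intro exI[of _ "s \<circ> Pair 0"]) (auto simp: comp_def)
qed

lemma lift_const:
  assumes "lift {0..1::real} (\<lambda>_. x) s" "a \<in> {0..1}" "b \<in> {0..1}"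
  shows "s a = s b"
proof -
  obtain N U \<sigma> where "lift_germ {0..1} (\<lambda>_. x) s a N U \<sigma>" using assms(1,2) by (rule liftE)
  note N = lift_germD[OF this]
  have "lift {0..1::real} (\<lambda>_. x) (\<sigma> \<circ> (\<lambda>_. x))"
    by (rule lift_section[OF _ N(3)]) (use N assms in auto)
  from lift_unique[OF assms(1) this connected_Icc assms(2) _ assms(3)] N assms show ?thesis by auto
qed

text \<open>Triviality of monodromy. A free homotopy to a constant loop is lifted to the square. The
  lift has equal values at the two ends of the constant edge, and the two lateral edges lie over the
  same path, because the homotopy runs through loops; uniqueness along them carries the equality
  back to the given loop.\<close>

lemma lift_loop_closes:
  assumes sc: "simply_connected (UNIV :: 'x set)"
    and p: "path p" "p 0 = p 1" and s: "lift {0..1} p s"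
  shows "s 0 = s 1"
proof -
  have "homotopic_loops UNIV p (\<lambda>_. p 0)"
    using sc p unfolding simply_connected_def by (auto simp: pathfinish_def pathstart_def path_def)
  then obtain h where h: "continuous_on ({0..1::real} \<times> {0..1::real}) h"
    "\<And>x. x \<in> {0..1} \<Longrightarrow> h (0,x) = p x" "\<And>x. x \<in> {0..1} \<Longrightarrow> h (1,x) = p 0"
    "\<And>t. t \<in> {0..1} \<Longrightarrow> h (t,1) = h (t,0)"
    unfolding homotopic_loops by (auto simp: pathfinish_def pathstart_def)
  have "s 0 \<in> Fib (h (0,0))" using lift_fibre[OF s, of 0] h(2)[of 0] by auto
  then obtain S where S: "lift ({0..1} \<times> {0..1}) h S" "S (0,0) = s 0"
    using full_lift_rect[OF h(1)] unfolding full_lift_def by force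
  have edge: "lift {0..1} (h \<circ> \<phi>) (S \<circ> \<phi>)"
    if "continuous_on {0..1} \<phi>" "\<And>t. t \<in> {0..1} \<Longrightarrow> \<phi> t \<in> {0..1} \<times> {0..1}" for \<phi> :: "real \<Rightarrow> real \<times> real"
    by (rule lift_compose[OF S(1) that(1)]) (use that(2) in blast)
  have l0: "lift {0..1} p (S \<circ> Pair 0)"
    by (rule lift_cong[OF edge]) (auto intro!: continuous_intros simp: h(2))
  have l1: "lift {0..1} (\<lambda>_. p 0) (S \<circ> Pair 1)"
    by (rule lift_cong[OF edge]) (auto intro!: continuous_intros simp: h(3))
  have m0: "lift {0..1} (\<lambda>t. h (t,0)) (S \<circ> (\<lambda>t. (t,0)))"
    by (rule lift_cong[OF edge]) (auto intro!: continuous_intros)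
  have m1: "lift {0..1} (\<lambda>t. h (t,0)) (S \<circ> (\<lambda>t. (t,1)))"
    by (rule lift_cong[OF edge]) (auto intro!: continuous_intros simp: h(4))
  have "S (1,0) = S (1,1)" using lift_const[OF l1, of 0 1] by auto
  then have "S (0,0) = S (0,1)"
    using lift_unique[OF m0 m1 connected_Icc, of 1 0] by auto
  moreover have "S (0,1) = s 1" "S (0,0) = s 0"
    using lift_unique[OF l0 s connected_Icc, of 0 1] S(2) by auto
  ultimately show ?thesis by simp
qed

text \<open>A free homotopy between two constant loops traces a path from one point to the
  other.\<close>

lemma path_connected_UNIV:
  assumes sc: "simply_connected (UNIV :: 'x set)"
  shows "\<exists>\<gamma>. path \<gamma> \<and> \<gamma> 0 = x \<and> \<gamma> 1 = (y::'x)"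
proof -
  have "homotopic_loops UNIV (\<lambda>_. x) (\<lambda>_. y)"
    using sc unfolding simply_connected_def by (auto simp: pathfinish_def pathstart_def path_def)
  then obtain h where h: "continuous_on ({0..1::real} \<times> {0..1::real}) h"
    "\<And>t. t \<in> {0..1} \<Longrightarrow> h (0,t) = x" "\<And>t. t \<in> {0..1} \<Longrightarrow> h (1,t) = y"
    unfolding homotopic_loops by auto
  have "continuous_on {0..1} (\<lambda>t. h (t,0))"
    by (rule continuous_on_compose2[OF h(1)]) (auto intro!: continuous_intros)
  then show ?thesis using h by (intro exI[of _ "\<lambda>t. h (t,0)"]) (auto simp: path_def)
qed

text \<open>The value at \<open>x0\<close> is transported along paths. Two paths to the same point
  give the same value by the loop lemma for one of them followed by the reverse of the other. Near
  \<open>x\<close> the result coincides with a flat section, because a path to \<open>x\<close> can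
  be prolonged inside a path connected neighbourhood.\<close>

theorem ex_global_section:
  assumes sc: "simply_connected (UNIV :: 'x set)" and j0: "j0 \<in> Fib x0"
  shows "\<exists>\<sigma>. \<sigma> x0 = j0 \<and> (\<forall>x. P \<sigma> x)"
proof -
  define reach where "reach x j \<longleftrightarrow> (\<exists>\<gamma> s. path \<gamma> \<and> \<gamma> 0 = x0 \<and> \<gamma> 1 = x \<and> lift {0..1} \<gamma> s \<and> s 0 = j0 \<and> s 1 = j)"
    for x j
  have ex: "\<exists>j. reach x j" for x
  proof -
    obtain \<gamma> where "path \<gamma>" "\<gamma> 0 = x0" "\<gamma> 1 = x" using path_connected_UNIV[OF sc] by blast
    then show ?thesis using ex_lift_path[of \<gamma> j0] j0 unfolding reach_def by auto
  qed
  have half1: "lift {0..1} \<gamma> (\<lambda>t. s (t/2))" if "lift {0..1} (\<gamma> +++ \<delta>) s" for \<gamma> \<delta> s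
  proof (rule lift_cong)
    have *: "continuous_on {0..1} (\<lambda>t::real. t/2)" "(\<lambda>t::real. t/2) ` {0..1} \<subseteq> {0..1}"
      by (auto intro!: continuous_intros)
    show "lift {0..1} ((\<gamma> +++ \<delta>) \<circ> (\<lambda>t. t/2)) (\<lambda>t. s (t/2))"
      using lift_compose[OF that *] by (simp add: comp_def)
  qed (auto simp: joinpaths_def)
  have uniq: "i = j" if ri: "reach x i" and rj: "reach x j" for x i j
  proof -
    obtain \<gamma> s where g: "path \<gamma>" "\<gamma> 0 = x0" "\<gamma> 1 = x" "lift {0..1} \<gamma> s" "s 0 = j0" "s 1 = i"
      using ri unfolding reach_def by auto
    obtain \<delta> t where d: "path \<delta>" "\<delta> 0 = x0" "\<delta> 1 = x" "lift {0..1} \<delta> t" "t 0 = j0" "t 1 = j"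
      using rj unfolding reach_def by auto
    let ?p = "\<gamma> +++ reversepath \<delta>"
    have p: "path ?p" using g(1,3) d(1,3) by (intro path_join_imp path_reversepath[THEN iffD2]) (simp_all add: pathfinish_def pathstart_def reversepath_def)
    have p01: "?p 0 = x0" "?p 1 = x0" using g d by (auto simp: joinpaths_def reversepath_def)
    obtain S where S: "lift {0..1} ?p S" "S 0 = j0" using ex_lift_path[OF p, of j0] j0 p01 by auto
    have S1: "S 1 = j0" using lift_loop_closes[OF sc p _ S(1)] p01 S by auto
    have "s 1 = S (1/2)"
      using lift_unique[OF g(4) half1[OF S(1)] connected_Icc, of 0 1] g S by auto
    have dl: "lift {0..1} \<delta> (\<lambda>t. S (1 - t/2))"
    proof (rule lift_cong)
      have *: "continuous_on {0..1} (\<lambda>t::real. 1 - t/2)" "(\<lambda>t::real. 1 - t/2) ` {0..1} \<subseteq> {0..1}"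
        by (auto intro!: continuous_intros)
      show "lift {0..1} (?p \<circ> (\<lambda>t. 1 - t/2)) (\<lambda>t. S (1 - t/2))"
        using lift_compose[OF S(1) *] by (simp add: comp_def)
      \<comment> \<open>At \<open>t = 1\<close> the argument is \<open>1/2\<close>, where
        \<open>+++\<close> evaluates the first path; hence the separate case.\<close>
      show "(?p \<circ> (\<lambda>t. 1 - t/2)) t = \<delta> t" if "t \<in> {0..1}" for t
        using that d(3) g(3) by (cases "t = 1") (auto simp: joinpaths_def reversepath_def)
    qed
    have "t 1 = S (1/2)"
      using lift_unique[OF d(4) dl connected_Icc, of 0 1] d S1 by auto
    then show ?thesis using \<open>s 1 = S (1/2)\<close> g d by simp
  qed
  define \<sigma> where "\<sigma> x = (THE j. reach x j)" for x
  have r\<sigma>: "reach x (\<sigma> x)" for x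
    unfolding \<sigma>_def by (rule theI') (use ex uniq in blast)
  then have \<sigma>: "reach x j \<Longrightarrow> \<sigma> x = j" for x j using uniq by blast
  have "P \<sigma> x" for x
  proof -
    obtain U where U: "open U" "x \<in> U" "path_connected U"
      "\<forall>x'\<in>U. \<forall>j\<in>Fib x'. \<exists>\<sigma>. \<sigma> x' = j \<and> (\<forall>y\<in>U. P \<sigma> y)"
      using ex_local by blast
    obtain \<gamma> s where g: "path \<gamma>" "\<gamma> 0 = x0" "\<gamma> 1 = x" "lift {0..1} \<gamma> s" "s 0 = j0" "s 1 = \<sigma> x"
      using r\<sigma>[of x] unfolding reach_def by auto
    have "\<sigma> x \<in> Fib x" using lift_fibre[OF g(4), of 1] g by auto
    then obtain \<tau> where \<tau>: "\<tau> x = \<sigma> x" "\<forall>y\<in>U. P \<tau> y" using U by blast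
    have "\<tau> y = \<sigma> y" if y: "y \<in> U" for y
    proof -
      obtain c where c: "path c" "path_image c \<subseteq> U" "c 0 = x" "c 1 = y"
        using U y unfolding path_connected_def pathstart_def pathfinish_def by blast
      have p: "path (\<gamma> +++ c)" using g c by (intro path_join_imp) (auto simp: pathfinish_def pathstart_def)
      have p01: "(\<gamma> +++ c) 0 = x0" "(\<gamma> +++ c) 1 = y" using g c by (auto simp: joinpaths_def)
      obtain S where S: "lift {0..1} (\<gamma> +++ c) S" "S 0 = j0" using ex_lift_path[OF p, of j0] j0 p01 by auto
      have S2: "S (1/2) = \<sigma> x"
        using lift_unique[OF g(4) half1[OF S(1)] connected_Icc, of 0 1] g S by auto
      have *: "continuous_on {0..1} (\<lambda>t::real. (1+t)/2)" "(\<lambda>t::real. (1+t)/2) ` {0..1} \<subseteq> {0..1}"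
        by (auto intro!: continuous_intros)
      have cl: "lift {0..1} c (\<lambda>t. S ((1+t)/2))"
      proof (rule lift_cong)
        show "lift {0..1} ((\<gamma> +++ c) \<circ> (\<lambda>t. (1+t)/2)) (\<lambda>t. S ((1+t)/2))"
          using lift_compose[OF S(1) *] by (simp add: comp_def)
        show "((\<gamma> +++ c) \<circ> (\<lambda>t. (1+t)/2)) t = c t" if "t \<in> {0..1}" for t
          using that g(3) c(3) by (cases "t = 0") (auto simp: joinpaths_def field_simps)
      qed
      have cl2: "lift {0..1} c (\<tau> \<circ> c)"
        by (rule lift_section[OF _ U(1)]) (use c \<tau> in \<open>auto simp: path_def path_image_def\<close>)
      have "S 1 = \<tau> y"
        using lift_unique[OF cl cl2 connected_Icc, of 0 1] S2 c \<tau> by auto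
      moreover have "reach y (S 1)" unfolding reach_def using p p01 S by blast
      ultimately show ?thesis using \<sigma> by auto
    qed
    then show ?thesis using germ[OF U(1,2)] \<tau> U(2) by blast
  qed
  moreover have "\<sigma> x0 = j0"
  proof (rule \<sigma>)
    have "path (\<lambda>_::real. x0)" by (simp add: path_def)
    moreover obtain s where s: "lift {0..1} (\<lambda>_::real. x0) s" "s 0 = j0"
      using ex_lift_path[OF calculation] j0 by auto
    moreover have "s 1 = j0" using lift_const[OF s(1), of 0 1] s by auto
    ultimately show "reach x0 j0" unfolding reach_def by blast
  qed
  ultimately show ?thesis by blast
qed

end

section \<open>Linear differential systems\<close>

text \<open>Energy method: \<open>exp (- L * t) * (\<phi> t \<bullet> \<phi> t +
  \<epsilon>\<^sup>2)\<close> does not increase. Adding \<open>\<epsilon>\<^sup>2\<close> to the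
  energy absorbs the inhomogeneous term through \<open>2 * norm (\<phi> t) * \<epsilon> \<le> (norm
  (\<phi> t))\<^sup>2 + \<epsilon>\<^sup>2\<close>; the price is the summand 1 in \<open>L\<close>.
  The case of vanishing \<epsilon> is allowed and gives uniqueness.\<close>

lemma gronwall_unit_interval:
  fixes \<phi> :: "real \<Rightarrow> 'a::real_inner"
  assumes der: "\<And>t. t \<in> {0..1} \<Longrightarrow> (\<phi> has_vector_derivative \<phi>' t) (at t within {0..1})"
    and bound: "\<And>t. t \<in> {0..1} \<Longrightarrow> norm (\<phi>' t) \<le> K * norm (\<phi> t) + \<epsilon>"
    and "\<phi> 0 = 0" "K \<ge> 0" "\<epsilon> \<ge> 0"
  shows "norm (\<phi> 1) \<le> \<epsilon> * exp (K + 1)"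
proof -
  define L where "L = 2 * K + 1"
  define u where "u t = - (exp (- L * t) * (\<phi> t \<bullet> \<phi> t + \<epsilon>\<^sup>2))" for t
  have cont: "continuous_on {0..1} \<phi>"
    using der by (rule continuous_on_vector_derivative)
  have "u 0 \<le> u 1"
  proof (rule DERIV_nonneg_imp_increasing_open[where f = u])
    show "continuous_on {0..1} u" unfolding u_def by (intro continuous_intros cont)
    fix t :: real assume t: "0 < t" "t < 1"
    have d: "(\<phi> has_vector_derivative \<phi>' t) (at t)"
      using der[of t] t by (metis at_within_Icc_at atLeastAtMost_iff less_eq_real_def)
    have di: "((\<lambda>t. \<phi> t \<bullet> \<phi> t) has_real_derivative (2 * (\<phi> t \<bullet> \<phi>' t))) (at t)"
      using bounded_bilinear.has_vector_derivative[OF bounded_bilinear_inner d d]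
      by (simp add: has_real_derivative_iff_has_vector_derivative inner_commute)
    have "(u has_real_derivative (- (exp (- L * t) * (2 * (\<phi> t \<bullet> \<phi>' t)) + exp (- L * t) * (- L) * (\<phi> t \<bullet> \<phi> t + \<epsilon>\<^sup>2)))) (at t)"
      unfolding u_def by (rule derivative_eq_intros di refl | simp)+
    moreover have "2 * (\<phi> t \<bullet> \<phi>' t) \<le> L * (\<phi> t \<bullet> \<phi> t + \<epsilon>\<^sup>2)"
    proof -
      have "\<phi> t \<bullet> \<phi>' t \<le> norm (\<phi> t) * norm (\<phi>' t)" by (rule norm_cauchy_schwarz)
      also have "\<dots> \<le> norm (\<phi> t) * (K * norm (\<phi> t) + \<epsilon>)"
        using bound[of t] t by (intro mult_left_mono) auto
      finally have "2 * (\<phi> t \<bullet> \<phi>' t) \<le> 2 * K * (norm (\<phi> t))\<^sup>2 + 2 * norm (\<phi> t) * \<epsilon>"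
        by (simp add: power2_eq_square algebra_simps)
      also have "2 * norm (\<phi> t) * \<epsilon> \<le> (norm (\<phi> t))\<^sup>2 + \<epsilon>\<^sup>2"
        by (rule sum_squares_bound)
      also have "2 * K * (norm (\<phi> t))\<^sup>2 + ((norm (\<phi> t))\<^sup>2 + \<epsilon>\<^sup>2) \<le> L * ((norm (\<phi> t))\<^sup>2 + \<epsilon>\<^sup>2)"
        using \<open>K \<ge> 0\<close> by (simp add: L_def algebra_simps)
      finally show ?thesis by (simp add: power2_norm_eq_inner)
    qed
    then have "exp (- L * t) * (2 * (\<phi> t \<bullet> \<phi>' t)) \<le> exp (- L * t) * (L * (\<phi> t \<bullet> \<phi> t + \<epsilon>\<^sup>2))"
      by (intro mult_left_mono) auto
    ultimately show "\<exists>y. (u has_real_derivative y) (at t) \<and> y \<ge> 0"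
      by (intro exI conjI) (auto simp: algebra_simps)
  qed simp
  then have "exp (- L) * (\<phi> 1 \<bullet> \<phi> 1 + \<epsilon>\<^sup>2) \<le> \<epsilon>\<^sup>2" using \<open>\<phi> 0 = 0\<close> by (simp add: u_def)
  then have "(norm (\<phi> 1))\<^sup>2 + \<epsilon>\<^sup>2 \<le> \<epsilon>\<^sup>2 * exp L"
    by (simp add: exp_minus field_simps power2_norm_eq_inner)
  also have "\<dots> \<le> \<epsilon>\<^sup>2 * exp (2 * (K + 1))"
    by (intro mult_left_mono) (auto simp: L_def)
  also have "\<dots> = (\<epsilon> * exp (K + 1))\<^sup>2"
    by (simp only: power_mult_distrib exp_double)
  finally have "(norm (\<phi> 1))\<^sup>2 \<le> (\<epsilon> * exp (K + 1))\<^sup>2"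
    using zero_le_power2[of \<epsilon>] by linarith
  then show ?thesis by (rule power2_le_imp_le) (use \<open>\<epsilon> \<ge> 0\<close> in simp)
qed

text \<open>Picard iteration; the weight \<open>exp (2 * K * t)\<close> makes the iterates decay geometrically.\<close>

lemma linear_ode_unit_interval:
  fixes M :: "real \<Rightarrow> 'a::banach \<Rightarrow>\<^sub>L 'a"
  assumes M: "continuous_on {0..1} M"
  shows "\<exists>s. s 0 = s0 \<and> (\<forall>t\<in>{0..1}. (s has_vector_derivative M t (s t)) (at t within {0..1}))"
proof -
  have "bounded (M ` {0..1})" using M compact_continuous_image compact_imp_bounded by blast
  then obtain K where K: "K > 0" "\<And>t. t \<in> {0..1} \<Longrightarrow> norm (M t) \<le> K"
    unfolding bounded_pos by blast
  \<comment> \<open>\<open>P n\<close> is the n-th term of the Picard series, not its partial sum: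
    only \<open>P 0\<close> carries the initial value, the later terms vanish at 0, and the solution
    is the sum of all terms.\<close>
  define P where "P = rec_nat (\<lambda>_. s0) (\<lambda>_ f t. integral {0..t} (\<lambda>\<tau>. M \<tau> (f \<tau>)))"
  have P0: "P 0 = (\<lambda>_. s0)" and PS: "P (Suc n) = (\<lambda>t. integral {0..t} (\<lambda>\<tau>. M \<tau> (P n \<tau>)))" for n
    by (simp_all add: P_def)
  have Pc: "continuous_on {0..1} (P n)" for n
  proof (induction n)
    case (Suc n)
    have "continuous_on {0..1} (\<lambda>\<tau>. M \<tau> (P n \<tau>))" by (intro continuous_intros M Suc)
    then show ?case unfolding PS
      by (rule continuous_on_vector_derivative[OF integral_has_vector_derivative])
  qed (simp add: P0)
  have Pd: "(P (Suc n) has_vector_derivative M t (P n t)) (at t within {0..1})" if "t \<in> {0..1}" for n t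
    unfolding PS by (rule integral_has_vector_derivative[OF _ that]) (intro continuous_intros M Pc)
  define C where "C = norm s0"
  have Pb: "norm (P n t) \<le> C * exp (2 * K * t) / 2 ^ n" if "t \<in> {0..1}" for n t
    using that
  proof (induction n arbitrary: t)
    case 0
    then have "1 \<le> exp (2 * K * t)" using K by simp
    then have "C * 1 \<le> C * exp (2 * K * t)" by (intro mult_left_mono) (auto simp: C_def)
    then show ?case by (simp add: P0 C_def)
  next
    case (Suc n)
    show ?case
    proof (cases "t = 0")
      case True then show ?thesis by (simp add: PS C_def)
    next
      case False
      have "norm (P (Suc n) t - P (Suc n) 0) \<le> C * exp (2 * K * t) / 2 ^ Suc n - C * exp (2 * K * 0) / 2 ^ Suc n"
      proof (rule differentiable_bound_general[where a = 0 and b = t])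
        show "0 < t" using False Suc.prems by auto
        show "continuous_on {0..t} (P (Suc n))" by (rule continuous_on_subset[OF Pc]) (use Suc.prems in auto)
        show "continuous_on {0..t} (\<lambda>t. C * exp (2 * K * t) / 2 ^ Suc n)" by (intro continuous_intros) auto
        fix x assume x: "0 < x" "x < t"
        then have x': "x \<in> {0..1}" "0 < x" "x < 1" using Suc.prems by auto
        show "(P (Suc n) has_vector_derivative M x (P n x)) (at x)"
          using Pd[OF x'(1), of n] x' by (simp add: at_within_Icc_at)
        have "((\<lambda>t. C * exp (2 * K * t) / 2 ^ Suc n) has_real_derivative (K * (C * exp (2 * K * x) / 2 ^ n))) (at x)"
          by (auto intro!: derivative_eq_intros)
        then show "((\<lambda>t. C * exp (2 * K * t) / 2 ^ Suc n) has_vector_derivative (K * (C * exp (2 * K * x) / 2 ^ n))) (at x)"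
          by (simp add: has_real_derivative_iff_has_vector_derivative)
        have "norm (M x (P n x)) \<le> norm (M x) * norm (P n x)" by (rule norm_blinfun)
        also have "\<dots> \<le> K * (C * exp (2 * K * x) / 2 ^ n)"
          using K x' Suc.IH by (intro mult_mono) auto
        finally show "norm (M x (P n x)) \<le> K * (C * exp (2 * K * x) / 2 ^ n)" .
      qed
      moreover have "P (Suc n) 0 = 0" by (simp add: PS)
      moreover have "C * exp (2 * K * 0) / 2 ^ Suc n \<ge> 0" by (simp add: C_def)
      ultimately show ?thesis by simp
    qed
  qed
  define B where "B = C * exp (2 * K)"
  have Pb': "norm (P n t) \<le> B * (1/2) ^ n" if "t \<in> {0..1}" for n t
  proof -
    have "C * exp (2 * K * t) \<le> B" unfolding B_def using that K by (intro mult_left_mono) (auto simp: C_def)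
    then have "C * exp (2 * K * t) / 2 ^ n \<le> B / 2 ^ n" by (intro divide_right_mono) auto
    then show ?thesis using Pb[OF that, of n] by (simp add: power_one_over)
  qed
  have geo: "summable (\<lambda>n. B * (1/2::real) ^ n)" by (intro summable_mult summable_geometric) auto
  have sm: "summable (\<lambda>n. P n t)" if "t \<in> {0..1}" for t
    using Pb'[OF that] by (intro summable_comparison_test[OF _ geo]) auto
  define s where "s t = (\<Sum>n. P n t)" for t
  have unif: "uniform_limit {0..1} (\<lambda>n t. \<Sum>i<n. P i t) s sequentially"
    unfolding s_def by (rule Weierstrass_m_test[OF _ geo]) (use Pb' in auto)
  define P' where "P' n x = (case n of 0 \<Rightarrow> (\<lambda>_. 0) | Suc m \<Rightarrow> (\<lambda>h. h *\<^sub>R M x (P m x)))" for n x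
  have "\<exists>g. \<forall>x\<in>{0..1}. (\<lambda>n. P n x) sums g x \<and> (g has_derivative (\<lambda>h. h *\<^sub>R M x (s x))) (at x within {0..1})"
  proof (rule has_derivative_series[where f = P and f' = P' and x = 0 and l = "s 0"])
    show "(P n has_derivative P' n x) (at x within {0..1})" if "x \<in> {0..1}" for n x
    proof (cases n)
      case 0 then show ?thesis by (simp add: P0 P'_def)
    next
      case (Suc m)
      then show ?thesis using Pd[OF that, of m] by (simp add: has_vector_derivative_def P'_def)
    qed
    fix e :: real assume e: "e > 0"
    have "\<forall>\<^sub>F n in sequentially. \<forall>x\<in>{0..1}. dist (\<Sum>i<n. P i x) (s x) < e / K"
      using uniform_limitD[OF unif, of "e / K"] e K by auto
    \<comment> \<open>The shift by one arises because the derivative of \<open>P (Suc m)\<close> is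
      \<open>M\<close> applied to \<open>P m\<close>, while \<open>P 0\<close> has derivative 0: the
      first \<open>n\<close> derivatives add up to \<open>M\<close> applied to \<open>n - 1\<close>
      terms.\<close>
    then have "\<forall>\<^sub>F n in sequentially. \<forall>x\<in>{0..1}. dist (\<Sum>i<n-1. P i x) (s x) < e / K"
      by (rule filterlim_minus_const_nat_at_top[of 1, unfolded filterlim_iff, rule_format])
    then show "\<forall>\<^sub>F n in sequentially. \<forall>x\<in>{0..1}. \<forall>h. norm ((\<Sum>i<n. P' i x h) - h *\<^sub>R M x (s x)) \<le> e * norm h"
      using eventually_gt_at_top[of 0]
    proof eventually_elim
      case (elim n)
      show ?case
      proof (intro ballI allI)
        fix x h assume x: "x \<in> {0..1::real}"
        obtain m where m: "n = Suc m" using elim by (cases n) auto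
        have "(\<Sum>i<n. P' i x h) = h *\<^sub>R M x (\<Sum>i<m. P i x)"
          unfolding m sum.lessThan_Suc_shift by (simp add: P'_def blinfun.sum_right scaleR_sum_right)
        then have eq: "norm ((\<Sum>i<n. P' i x h) - h *\<^sub>R M x (s x)) = \<bar>h\<bar> * norm (M x ((\<Sum>i<m. P i x) - s x))"
          by (simp add: blinfun.diff_right flip: scaleR_diff_right)
        have "norm (M x ((\<Sum>i<m. P i x) - s x)) \<le> norm (M x) * norm ((\<Sum>i<m. P i x) - s x)"
          by (rule norm_blinfun)
        also have "\<dots> \<le> K * (e / K)"
          using K(2)[OF x] elim(1) x K(1) m by (intro mult_mono) (auto simp: dist_norm less_imp_le)
        finally have "norm (M x ((\<Sum>i<m. P i x) - s x)) \<le> e" using K(1) by simp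
        then have "\<bar>h\<bar> * norm (M x ((\<Sum>i<m. P i x) - s x)) \<le> \<bar>h\<bar> * e" by (intro mult_left_mono) auto
        with eq show "norm ((\<Sum>i<n. P' i x h) - h *\<^sub>R M x (s x)) \<le> e * norm h"
          by (simp add: mult.commute)
      qed
    qed
  qed (use sm[of 0] in \<open>auto simp: s_def intro: summable_sums\<close>)
  then obtain g where g: "\<And>x. x \<in> {0..1} \<Longrightarrow> (\<lambda>n. P n x) sums g x"
    "\<And>x. x \<in> {0..1} \<Longrightarrow> (g has_derivative (\<lambda>h. h *\<^sub>R M x (s x))) (at x within {0..1})"
    by blast
  have gs: "g x = s x" if "x \<in> {0..1}" for x
    using g(1)[OF that] by (simp add: s_def sums_iff)
  have "(\<lambda>n. P n 0) = (\<lambda>n. if n = 0 then s0 else 0)"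
  proof
    fix n show "P n 0 = (if n = 0 then s0 else 0)" by (cases n) (simp_all add: P0 PS)
  qed
  then have "(\<lambda>n. P n 0) sums s0" using sums_If_finite_set[of "{0}" "\<lambda>_. s0"] by simp
  then have "g 0 = s0" using g(1)[of 0] sums_unique2 by auto
  then show ?thesis using g(2) gs by (intro exI[of _ g]) (auto simp: has_vector_derivative_def)
qed

text \<open>A compact neighbourhood of \<open>K\<close> inside \<open>U\<close> makes
  \<open>f'\<close> uniformly continuous, so one \<delta> serves for all base points in
  \<open>K\<close>. This is needed because the linearization is used simultaneously at all points of
  a segment.\<close>

lemma uniform_linearization:
  fixes f :: "'a::euclidean_space \<Rightarrow> 'b::real_normed_vector"
    and f' :: "'a \<Rightarrow> 'a \<Rightarrow>\<^sub>L 'b"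
  assumes U: "open U" and der: "\<And>x. x \<in> U \<Longrightarrow> (f has_derivative f' x) (at x)"
    and cont: "continuous_on U f'" and K: "compact K" "K \<subseteq> U" and "\<eta> > 0"
  shows "\<exists>\<delta>>0. \<forall>x\<in>K. \<forall>v. norm v < \<delta> \<longrightarrow> x + v \<in> U \<and> norm (f (x + v) - f x - f' x v) \<le> \<eta> * norm v"
proof -
  obtain e where e: "e > 0" "(\<Union>x\<in>K. cball x e) \<subseteq> U"
    by (rule compact_subset_open_imp_cball_epsilon_subset[OF K(1) U K(2)])
  have cb: "cball x e = (\<Union>y\<in>cball 0 e. {x + y})" for x :: 'a
  proof -
    have "cball x e = (+) x ` cball 0 e" by simp
    then show ?thesis by blast
  qed
  have "(\<Union>x\<in>K. cball x e) = (\<Union>x\<in>K. \<Union>y\<in>cball 0 e. {x + y})"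
    by (intro SUP_cong refl cb)
  then have C: "compact (\<Union>x\<in>K. cball x e)"
    using compact_sums'[OF K(1) compact_cball, of 0 e] by presburger
  have "uniformly_continuous_on (\<Union>x\<in>K. cball x e) f'"
    by (rule compact_uniformly_continuous[OF continuous_on_subset[OF cont e(2)] C])
  from this[unfolded uniformly_continuous_on_def, rule_format, OF \<open>\<eta> > 0\<close>]
  obtain d where d: "d > 0"
    "\<forall>x\<in>(\<Union>x\<in>K. cball x e). \<forall>y\<in>(\<Union>x\<in>K. cball x e). dist y x < d \<longrightarrow> dist (f' y) (f' x) < \<eta>"
    by (elim exE conjE)
  show ?thesis
  proof (intro exI[of _ "min d e"] conjI ballI allI impI)
    fix x v :: 'a assume x: "x \<in> K" and v: "norm v < min d e"
    have sub: "ball x (min d e) \<subseteq> (\<Union>x\<in>K. cball x e)" using x by auto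
    have "x + v \<in> cball x e" using v by (simp add: dist_norm)
    then show "x + v \<in> U" using e(2) x by blast
    have "norm (f (x + v) - f x - f' x (x + v - x)) \<le> norm (x + v - x) * \<eta>"
    proof (rule differentiable_bound_linearization[where S = "ball x (min d e)"])
      fix t :: real assume t: "t \<in> {0..1}"
      have "\<bar>t\<bar> * norm v \<le> 1 * norm v" using t by (intro mult_right_mono) auto
      then show "x + t *\<^sub>R (x + v - x) \<in> ball x (min d e)" using v by (simp add: dist_norm)
    next
      fix y assume y: "y \<in> ball x (min d e)"
      then have "y \<in> U" using sub e(2) by blast
      then show "(f has_derivative f' y) (at y within ball x (min d e))"
        by (rule has_derivative_at_withinI[OF der])
      have "dist (f' y) (f' x) < \<eta>"
      proof (rule d(2)[rule_format])
        show "x \<in> (\<Union>x\<in>K. cball x e)" using x e(1) by (intro UN_I[of x]) auto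
        show "y \<in> (\<Union>x\<in>K. cball x e)" using y sub by blast
        show "dist y x < d" using y by (simp add: dist_commute)
      qed
      then show "onorm (blinfun_apply (f' y) - blinfun_apply (f' x)) \<le> \<eta>"
        by (simp add: dist_norm norm_blinfun.rep_eq minus_blinfun.rep_eq fun_diff_def)
    qed (use d(1) e(1) in simp)
    then show "norm (f (x + v) - f x - f' x v) \<le> \<eta> * norm v" by (simp add: mult.commute)
  qed (use d(1) e(1) in simp)
qed

lemma norm_blinfun2: "norm (blinfun_apply (blinfun_apply F x) y) \<le> norm F * norm x * norm y"
  by (meson mult_right_mono norm_blinfun norm_ge_zero order_trans)

text \<open>
  The solution is obtained by solving an ordinary differential equation along each ray from \<open>x0\<close>. Flatness makes the candidate \<open>t \<mapsto> \<sigma> t + t *\<^sub>R A a (\<sigma> t)\<close> agree to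
  first order in \<open>a\<close> with the solution along the ray to \<open>x + a\<close>, so no differentiability in
  parameters has to be known beforehand.
\<close>

theorem frobenius_linear:
  fixes A :: "'e::euclidean_space \<Rightarrow> 'e \<Rightarrow>\<^sub>L 'w::euclidean_space \<Rightarrow>\<^sub>L 'w"
    and A' :: "'e \<Rightarrow> 'e \<Rightarrow>\<^sub>L 'e \<Rightarrow>\<^sub>L 'w \<Rightarrow>\<^sub>L 'w"
  assumes U: "open U" "convex U" and der: "\<And>x. x \<in> U \<Longrightarrow> (A has_derivative A' x) (at x)"
    and cont: "continuous_on U A'"
    and flat: "\<And>x a b w. x \<in> U \<Longrightarrow> A' x a b w + A x b (A x a w) = A' x b a w + A x a (A x b w)"
    and x0: "x0 \<in> U"
  shows "\<exists>S. S x0 = s0 \<and> (\<forall>x\<in>U. (S has_derivative (\<lambda>a. A x a (S x))) (at x))"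
proof -
  let ?p = "\<lambda>x t. x0 + t *\<^sub>R (x - x0)"
  have seg: "?p x t \<in> U" if "x \<in> U" "t \<in> {0..1}" for x t
  proof -
    have "?p x t = (1 - t) *\<^sub>R x0 + t *\<^sub>R x" by (simp add: algebra_simps)
    then show ?thesis using U(2) x0 that by (simp add: convex_alt)
  qed
  have Ac: "continuous_on U A"
    using der by (meson continuous_at_imp_continuous_on has_derivative_continuous)
  have "\<exists>s. s 0 = s0 \<and> (\<forall>t\<in>{0..1}. (s has_vector_derivative A (?p x t) (x - x0) (s t)) (at t within {0..1}))"
    if x: "x \<in> U" for x
  proof -
    have "continuous_on {0..1} (\<lambda>t. A (?p x t))"
      by (rule continuous_on_compose2[OF Ac]) (use seg[OF x] in \<open>auto intro!: continuous_intros\<close>)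
    then have "continuous_on {0..1} (\<lambda>t. A (?p x t) (x - x0))" by (intro continuous_intros)
    from linear_ode_unit_interval[OF this] show ?thesis .
  qed
  then obtain \<sigma> where \<sigma>0: "\<And>x. x \<in> U \<Longrightarrow> \<sigma> x 0 = s0"
    and \<sigma>d: "\<And>x t. x \<in> U \<Longrightarrow> t \<in> {0..1} \<Longrightarrow>
      (\<sigma> x has_vector_derivative A (?p x t) (x - x0) (\<sigma> x t)) (at t within {0..1})"
    by metis
  define S where "S x = \<sigma> x 1" for x
  have Sx0: "S x0 = s0"
  proof -
    have "(\<sigma> x0 has_derivative (\<lambda>h. 0)) (at t within {0..1})" if "t \<in> {0..1}" for t
      using \<sigma>d[OF x0 that] by (simp add: has_vector_derivative_def blinfun.zero_right blinfun.zero_left)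
    then have "\<sigma> x0 1 = \<sigma> x0 0"
      by (intro has_derivative_zero_unique[of "{0..1}"]) auto
    then show ?thesis by (simp add: S_def \<sigma>0[OF x0])
  qed
  have "(S has_derivative (\<lambda>a. A x a (S x))) (at x)" if x: "x \<in> U" for x
  proof -
    define h where "h = x - x0"
    define K where "K = ?p x ` {0..1}"
    have K: "compact K" "K \<subseteq> U"
      using seg[OF x] by (auto simp: K_def intro!: compact_continuous_image continuous_intros)
    have \<sigma>c: "compact (\<sigma> x ` {0..1})"
      by (intro compact_continuous_image continuous_on_vector_derivative[OF \<sigma>d[OF x]] compact_Icc)
    have bd: "\<exists>B\<ge>0. \<forall>y\<in>X. norm (f y) \<le> B" if "compact (f ` X)"
      for f :: "'x \<Rightarrow> 'y::real_normed_vector" and X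
      using compact_imp_bounded[OF that] unfolding bounded_pos by (auto intro: less_imp_le)
    obtain B1 where B1: "B1 \<ge> 0" "\<forall>y\<in>K. norm (A y) \<le> B1"
      using bd[OF compact_continuous_image[OF continuous_on_subset[OF Ac K(2)] K(1)]] by blast
    obtain B2 where B2: "B2 \<ge> 0" "\<forall>y\<in>K. norm (A' y) \<le> B2"
      using bd[OF compact_continuous_image[OF continuous_on_subset[OF cont K(2)] K(1)]] by blast
    obtain B3 where B3: "B3 \<ge> 0" "\<forall>t\<in>{0..1}. norm (\<sigma> x t) \<le> B3"
      using bd[OF \<sigma>c] by blast
    \<comment> \<open>A single bound for all quantities along the segment; the summand 1 makes
      powers of \<open>C\<close> comparable.\<close>
    define C where "C = 1 + norm h + B1 + B2 + B3"
    have C: "C \<ge> 1" "norm h \<le> C" using B1(1) B2(1) B3(1) by (simp_all add: C_def)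
    have CA: "norm (A y) \<le> C" "norm (A' y) \<le> C" if "y \<in> K" for y
      using B1(2)[rule_format, OF that] B2(2)[rule_format, OF that] B1(1) B2(1) B3(1) norm_ge_zero[of h]
      unfolding C_def by linarith+
    have C\<sigma>: "norm (\<sigma> x t) \<le> C" if "t \<in> {0..1}" for t
      using B3(2)[rule_format, OF that] B1(1) B2(1) norm_ge_zero[of h] unfolding C_def by linarith
    \<comment> \<open>The Gronwall factor for the rate \<open>6 * C\<^sup>2\<close>, which arises
      below from \<open>3 * C\<close> for the coefficient at the displaced point and
      \<open>2 * C\<close> for \<open>h + a\<close>.\<close>
    define M where "M = exp (6 * C\<^sup>2 + 1)"
    have M: "M > 0" by (simp add: M_def)
    have main: "\<exists>\<delta>>0. \<forall>a. norm a < \<delta> \<longrightarrow> norm (S (x + a) - S x - A x a (S x)) \<le> \<epsilon> * norm a" if \<epsilon>: "\<epsilon> > 0" for \<epsilon>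
    proof -
      \<comment> \<open>The final error is \<open>norm a\<close> times
        \<open>4 * C ^ 3 * \<eta> * M + 4 * C ^ 4 * norm a * M\<close>. The choice of \<eta> here
        and that of \<delta> below make each summand at most half of \<epsilon>.\<close>
      define \<eta> where "\<eta> = min 1 (\<epsilon> / (8 * C ^ 3 * M))"
      have \<eta>: "\<eta> > 0" "\<eta> \<le> 1" "4 * C ^ 3 * \<eta> * M \<le> \<epsilon> / 2"
      proof -
        show "\<eta> > 0" "\<eta> \<le> 1" using \<epsilon> C M by (simp_all add: \<eta>_def)
        have "\<eta> \<le> \<epsilon> / (8 * C ^ 3 * M)" by (simp add: \<eta>_def)
        then show "4 * C ^ 3 * \<eta> * M \<le> \<epsilon> / 2" using C M by (simp add: field_simps)
      qed
      obtain \<delta>1 where \<delta>1: "\<delta>1 > 0" "\<And>y v. y \<in> K \<Longrightarrow> norm v < \<delta>1 \<Longrightarrow> y + v \<in> U \<and> norm (A (y + v) - A y - A' y v) \<le> \<eta> * norm v"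
        using uniform_linearization[OF U(1) der cont K \<eta>(1)] by auto
      define \<delta> where "\<delta> = min \<delta>1 (min 1 (\<epsilon> / (8 * C ^ 4 * M)))"
      have \<delta>: "\<delta> > 0" "\<delta> \<le> \<delta>1" "\<delta> \<le> 1" "4 * C ^ 4 * \<delta> * M \<le> \<epsilon> / 2"
      proof -
        show "\<delta> > 0" "\<delta> \<le> \<delta>1" "\<delta> \<le> 1" using \<epsilon> C M \<delta>1 by (simp_all add: \<delta>_def)
        have "\<delta> \<le> \<epsilon> / (8 * C ^ 4 * M)" by (simp add: \<delta>_def)
        then show "4 * C ^ 4 * \<delta> * M \<le> \<epsilon> / 2" using C M by (simp add: field_simps)
      qed
      have "norm (S (x + a) - S x - A x a (S x)) \<le> \<epsilon> * norm a" if a: "norm a < \<delta>" for a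
      proof -
        have a1: "norm a \<le> 1" using a \<delta> by linarith
        have "x \<in> K" unfolding K_def by (rule image_eqI[of _ _ 1]) auto
        then have xa: "x + a \<in> U" using \<delta>1(2)[of x a] a \<delta> by auto
        \<comment> \<open>The defect of the candidate. Its value at \<open>t = 1\<close> is exactly
          the error in the differentiability of \<open>S\<close> at \<open>x\<close>.\<close>
        define D where "D t = \<sigma> (x + a) t - \<sigma> x t - t *\<^sub>R A (?p x t) a (\<sigma> x t)" for t
        define D' where "D' t = A (?p x t + t *\<^sub>R a) (h + a) (\<sigma> (x + a) t) - A (?p x t) h (\<sigma> x t)
           - (A (?p x t) a (\<sigma> x t) + t *\<^sub>R (A' (?p x t) h a (\<sigma> x t) + A (?p x t) a (A (?p x t) h (\<sigma> x t))))" for t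
        have "norm (D 1) \<le> (norm a * (4 * C ^ 3 * \<eta> + 4 * C ^ 4 * norm a)) * exp (6 * C\<^sup>2 + 1)"
        proof (rule gronwall_unit_interval[where \<phi>' = D'])
          show "D 0 = 0" using \<sigma>0 x xa by (simp add: D_def)
          fix t :: real assume t: "t \<in> {0..1}"
          have tK: "?p x t \<in> K" unfolding K_def using t by (rule imageI)
          have p: "?p (x + a) t = ?p x t + t *\<^sub>R a" by (simp add: algebra_simps)
          have d1: "(\<sigma> (x + a) has_vector_derivative A (?p x t + t *\<^sub>R a) (h + a) (\<sigma> (x + a) t)) (at t within {0..1})"
            using \<sigma>d[OF xa t] unfolding p h_def by (simp add: algebra_simps)
          have d2: "(\<sigma> x has_vector_derivative A (?p x t) h (\<sigma> x t)) (at t within {0..1})"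
            using \<sigma>d[OF x t] by (simp add: h_def)
          have "((\<lambda>t. A (?p x t)) has_derivative (\<lambda>u. A' (?p x t) (u *\<^sub>R h))) (at t within {0..1})"
            by (rule has_derivative_compose[where f = "?p x", OF _ der[OF seg[OF x t]]])
              (auto intro!: derivative_eq_intros simp: h_def)
          then have "((\<lambda>t. A (?p x t)) has_vector_derivative A' (?p x t) h) (at t within {0..1})"
            by (simp add: has_vector_derivative_def blinfun.scaleR_right)
          then have "((\<lambda>t. A (?p x t) a) has_vector_derivative A' (?p x t) h a) (at t within {0..1})"
            by (rule bounded_linear.has_vector_derivative[OF blinfun.bounded_linear_left])
          from blinfun.has_vector_derivative[OF this d2]
          have d3: "((\<lambda>t. A (?p x t) a (\<sigma> x t)) has_vector_derivative A (?p x t) a (A (?p x t) h (\<sigma> x t)) + A' (?p x t) h a (\<sigma> x t)) (at t within {0..1})" .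
          have d4: "((\<lambda>t. t *\<^sub>R A (?p x t) a (\<sigma> x t)) has_vector_derivative
              t *\<^sub>R (A (?p x t) a (A (?p x t) h (\<sigma> x t)) + A' (?p x t) h a (\<sigma> x t)) + 1 *\<^sub>R A (?p x t) a (\<sigma> x t)) (at t within {0..1})"
            by (rule has_vector_derivative_scaleR[OF _ d3]) simp
          show "(D has_vector_derivative D' t) (at t within {0..1})"
            unfolding D_def D'_def
            by (rule has_vector_derivative_eq_rhs[OF has_vector_derivative_diff[OF has_vector_derivative_diff[OF d1 d2] d4]])
              (simp add: algebra_simps)
          define y where "y = ?p x t"
          define s where "s = \<sigma> x t"
          define R where "R = A (y + t *\<^sub>R a) - A y - A' y (t *\<^sub>R a)"
          define Z where "Z = t *\<^sub>R A y a s"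
          \<comment> \<open>What is left of \<open>D'\<close> besides the term linear in
            \<open>D t\<close>. Flatness has removed the terms of first order in \<open>a\<close>:
            each summand is either quadratic in \<open>a\<close> or contains the linearization error
            \<open>R\<close>.\<close>
          define E where "E = t *\<^sub>R A' y a a s + R (h + a) (s + Z) + A y a Z + t *\<^sub>R A' y a (h + a) Z"
          have yU: "y \<in> U" and yK: "y \<in> K" using seg[OF x t] tK by (simp_all add: y_def)
          have fl: "A' y a h s + A y h (A y a s) = A' y h a s + A y a (A y h s)" by (rule flat[OF yU])
          have Ay: "A (y + t *\<^sub>R a) = A y + t *\<^sub>R A' y a + R" by (simp add: R_def blinfun.scaleR_right)
          have "\<sigma> (x + a) t = D t + s + Z" by (simp add: D_def s_def Z_def y_def)
          then have "D' t = A (y + t *\<^sub>R a) (h + a) (D t) + A (y + t *\<^sub>R a) (h + a) (s + Z) - A y h s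
             - (A y a s + t *\<^sub>R (A' y h a s + A y a (A y h s)))"
            by (simp add: D'_def y_def s_def blinfun.add_right)
          also have "\<dots> = A (y + t *\<^sub>R a) (h + a) (D t) + E"
            unfolding fl[symmetric] Ay E_def Z_def
            by (simp add: blinfun.bilinear_simps algebra_simps)
          finally have D'E: "D' t = A (y + t *\<^sub>R a) (h + a) (D t) + E" .
          have t1: "\<bar>t\<bar> \<le> 1" using t by auto
          have ta: "norm (t *\<^sub>R a) \<le> norm a" using t1 by (simp add: mult_left_le_one_le)
          have R: "norm R \<le> \<eta> * norm a"
          proof -
            have "norm R \<le> \<eta> * norm (t *\<^sub>R a)"
              unfolding R_def using \<delta>1(2)[OF yK, of "t *\<^sub>R a"] ta a \<delta> by auto
            also have "\<dots> \<le> \<eta> * norm a" using ta \<eta> by (intro mult_left_mono) auto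
            finally show ?thesis .
          qed
          have s: "norm s \<le> C" using C\<sigma>[OF t] by (simp add: s_def)
          have Z: "norm Z \<le> C * norm a * C"
          proof -
            have "norm Z \<le> norm (A y a s)" using t1 by (simp add: Z_def mult_left_le_one_le)
            also have "\<dots> \<le> norm (A y) * norm a * norm s" by (rule norm_blinfun2)
            also have "\<dots> \<le> C * norm a * C" using CA(1)[OF yK] s C by (intro mult_mono) auto
            finally show ?thesis .
          qed
          have ha: "norm (h + a) \<le> 2 * C" using norm_triangle_ineq[of h a] C a1 by linarith
          have CC: "C \<le> C\<^sup>2" "C\<^sup>2 \<le> C ^ 3" "C ^ 3 \<le> C ^ 4" "C\<^sup>2 \<le> C ^ 4"
            using C by (auto intro!: power_increasing simp: self_le_power)
          have "norm E \<le> norm (t *\<^sub>R A' y a a s) + norm (R (h + a) (s + Z)) + norm (A y a Z) + norm (t *\<^sub>R A' y a (h + a) Z)"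
            unfolding E_def by (intro norm_triangle_le add_mono order_refl)
          also have "\<dots> \<le> C * norm a * norm a * C + \<eta> * norm a * (2 * C) * (2 * C\<^sup>2)
              + C * norm a * (C * norm a * C) + C * norm a * (2 * C) * (C * norm a * C)"
          proof (intro add_mono)
            have A'2: "norm (A' y a b c) \<le> norm (A' y) * norm a * norm b * norm c" for b c
              by (rule order_trans[OF norm_blinfun2]) (intro mult_right_mono norm_blinfun norm_ge_zero)
            have "norm (t *\<^sub>R A' y a a s) \<le> norm (A' y a a s)" using t1 by (simp add: mult_left_le_one_le)
            also have "\<dots> \<le> norm (A' y) * norm a * norm a * norm s" by (rule A'2)
            also have "\<dots> \<le> C * norm a * norm a * C" using CA(2)[OF yK] s C by (intro mult_mono) auto
            finally show "norm (t *\<^sub>R A' y a a s) \<le> C * norm a * norm a * C" .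
            have "C * norm a * C \<le> C * 1 * C" using a1 C by (intro mult_mono) auto
            then have "norm (s + Z) \<le> 2 * C\<^sup>2"
              using norm_triangle_ineq[of s Z] s Z CC(1) by (simp add: power2_eq_square)
            then show "norm (R (h + a) (s + Z)) \<le> \<eta> * norm a * (2 * C) * (2 * C\<^sup>2)"
              using R ha \<eta> C by (intro order_trans[OF norm_blinfun2] mult_mono) auto
            show "norm (A y a Z) \<le> C * norm a * (C * norm a * C)"
              using CA(1)[OF yK] Z C by (intro order_trans[OF norm_blinfun2] mult_mono) auto
            have "norm (t *\<^sub>R A' y a (h + a) Z) \<le> norm (A' y a (h + a) Z)" using t1 by (simp add: mult_left_le_one_le)
            also have "\<dots> \<le> norm (A' y) * norm a * norm (h + a) * norm Z" by (rule A'2)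
            also have "\<dots> \<le> C * norm a * (2 * C) * (C * norm a * C)"
              using CA(2)[OF yK] Z C ha by (intro mult_mono) auto
            finally show "norm (t *\<^sub>R A' y a (h + a) Z) \<le> C * norm a * (2 * C) * (C * norm a * C)" .
          qed
          also have "\<dots> = norm a * (4 * C ^ 3 * \<eta> + (C\<^sup>2 + C ^ 3 + 2 * C ^ 4) * norm a)"
            by (simp add: power2_eq_square power3_eq_cube power4_eq_xxxx algebra_simps)
          also have "\<dots> \<le> norm a * (4 * C ^ 3 * \<eta> + 4 * C ^ 4 * norm a)"
            using CC by (intro mult_left_mono add_left_mono mult_right_mono) auto
          finally have E: "norm E \<le> norm a * (4 * C ^ 3 * \<eta> + 4 * C ^ 4 * norm a)" .
          have "norm (A (y + t *\<^sub>R a)) \<le> norm (A y) + norm (A' y (t *\<^sub>R a)) + norm R"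
            unfolding Ay blinfun.scaleR_right[symmetric] by (intro norm_triangle_le add_mono order_refl)
          also have "norm (A' y (t *\<^sub>R a)) \<le> C * 1"
            using CA(2)[OF yK] ta a1 C by (intro order_trans[OF norm_blinfun] mult_mono) auto
          also have "norm R \<le> C" using R \<eta> a1 C mult_mono[of \<eta> 1 "norm a" 1] by auto
          also have "norm (A y) \<le> C" by (rule CA(1)[OF yK])
          finally have "norm (A (y + t *\<^sub>R a)) \<le> 3 * C" by simp
          then have "norm (A (y + t *\<^sub>R a) (h + a) (D t)) \<le> (3 * C) * (2 * C) * norm (D t)"
            using ha C by (intro order_trans[OF norm_blinfun2] mult_mono) auto
          then show "norm (D' t) \<le> 6 * C\<^sup>2 * norm (D t) + norm a * (4 * C ^ 3 * \<eta> + 4 * C ^ 4 * norm a)"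
            unfolding D'E using E by (intro norm_triangle_le) (simp add: power2_eq_square)
        qed (use C \<eta> in \<open>auto intro!: mult_nonneg_nonneg add_nonneg_nonneg\<close>)
        also have "\<dots> = norm a * (4 * C ^ 3 * \<eta> * M + 4 * C ^ 4 * norm a * M)"
          by (simp add: M_def algebra_simps)
        also have "\<dots> \<le> norm a * (\<epsilon> / 2 + \<epsilon> / 2)"
        proof (intro mult_left_mono add_mono)
          have "4 * C ^ 4 * norm a * M \<le> 4 * C ^ 4 * \<delta> * M"
            using a C M by (intro mult_right_mono mult_left_mono) auto
          then show "4 * C ^ 4 * norm a * M \<le> \<epsilon> / 2" using \<delta>(4) by linarith
        qed (use \<eta> in auto)
        finally show ?thesis by (simp add: D_def S_def mult.commute)
      qed
      then show ?thesis using \<delta>(1) by blast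
    qed
    show ?thesis
      unfolding has_derivative_at_alt
    proof (intro conjI allI impI)
      show "bounded_linear (\<lambda>a. A x a (S x))"
        by (intro bounded_linear_intros)
      fix e :: real assume "0 < e"
      from main[OF this] obtain \<delta> where \<delta>: "\<delta> > 0"
        "\<forall>a. norm a < \<delta> \<longrightarrow> norm (S (x + a) - S x - A x a (S x)) \<le> e * norm a" by blast
      show "\<exists>d>0. \<forall>y. norm (y - x) < d \<longrightarrow> norm (S y - S x - A x (y - x) (S x)) \<le> e * norm (y - x)"
      proof (intro exI[of _ \<delta>] conjI allI impI \<delta>(1))
        fix y assume "norm (y - x) < \<delta>"
        with \<delta>(2) have "norm (S (x + (y - x)) - S x - A x (y - x) (S x)) \<le> e * norm (y - x)" by blast
        then show "norm (S y - S x - A x (y - x) (S x)) \<le> e * norm (y - x)" by simp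
      qed
    qed
  qed
  then show ?thesis using Sx0 by blast
qed

section \<open>Second derivatives and linear equations with parameters\<close>

lemma smooth_on_directional: "smooth_on S f \<Longrightarrow> smooth_on S (\<lambda>x. frechet_derivative f (at x) v)"
  unfolding smooth_on_def by (metis Ck_on.simps(2))

lemma smooth_on_differentiable: "smooth_on S f \<Longrightarrow> x \<in> S \<Longrightarrow> f differentiable (at x)"
  unfolding smooth_on_def by (metis Ck_on.simps(2))

lemma smooth_on_continuous: "smooth_on S f \<Longrightarrow> continuous_on S f"
  unfolding smooth_on_def by (metis Ck_on.simps(1))

lemma smooth_on_has_derivative:
  "smooth_on S f \<Longrightarrow> x \<in> S \<Longrightarrow> (f has_derivative frechet_derivative f (at x)) (at x)"
  using smooth_on_differentiable frechet_derivative_works by blast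

text \<open>By the mean value theorem in the direction \<open>a\<close>, the second difference is
  \<open>h\<close> times a difference of derivatives along \<open>a\<close> at two points near
  \<open>x\<close>. Linearizing that derivative at the single point \<open>x\<close> gives the
  estimate; \<open>n\<close> converts \<open>h\<close> into a bound on the distances from
  \<open>x\<close>.\<close>

lemma second_difference_estimate:
  fixes f :: "'a::real_normed_vector \<Rightarrow> real"
  assumes S: "open S" "x \<in> S" and f: "\<And>y. y \<in> S \<Longrightarrow> (f has_derivative f' y) (at y)"
    and A: "((\<lambda>y. f' y a) has_derivative A) (at x)" and \<epsilon>: "\<epsilon> > 0"
  shows "\<exists>\<delta>>0. \<forall>h. 0 < h \<and> h < \<delta> \<longrightarrow>
    \<bar>f (x + h *\<^sub>R a + h *\<^sub>R b) - f (x + h *\<^sub>R a) - f (x + h *\<^sub>R b) + f x - h\<^sup>2 * A b\<bar> \<le> \<epsilon> * h\<^sup>2"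
proof -
  define n where "n = norm a + norm b + 1"
  have n: "n > 0" unfolding n_def using norm_ge_zero[of a] norm_ge_zero[of b] by linarith
  obtain d0 where d0: "d0 > 0" "ball x d0 \<subseteq> S" using S open_contains_ball_eq by blast
  have "\<epsilon> / (2 * n) > 0" using \<epsilon> n by simp
  then obtain d1 where d1: "d1 > 0"
    "\<And>y. norm (y - x) < d1 \<Longrightarrow> norm (f' y a - f' x a - A (y - x)) \<le> \<epsilon> / (2 * n) * norm (y - x)"
    using A unfolding has_derivative_at_alt by blast
  have linA: "linear A" using A has_derivative_linear by blast
  define d where "d = min d0 d1 / n"
  show ?thesis
  proof (intro exI[of _ d] conjI allI impI)
    show "d > 0" using d0 d1 n by (simp add: d_def)
    fix h assume h: "0 < h \<and> h < d"
    have hn: "h * n < min d0 d1" using h n by (simp add: d_def field_simps)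
    have small: "norm (\<xi> *\<^sub>R a + \<eta> *\<^sub>R b) \<le> h * n" if "0 \<le> \<xi>" "\<xi> \<le> h" "0 \<le> \<eta>" "\<eta> \<le> h" for \<xi> \<eta>
    proof -
      have "norm (\<xi> *\<^sub>R a + \<eta> *\<^sub>R b) \<le> \<xi> * norm a + \<eta> * norm b"
        using norm_triangle_ineq[of "\<xi> *\<^sub>R a" "\<eta> *\<^sub>R b"] that by simp
      also have "\<dots> \<le> h * norm a + h * norm b" using that by (intro add_mono mult_right_mono) auto
      also have "\<dots> \<le> h * n" using h by (simp add: n_def algebra_simps)
      finally show ?thesis .
    qed
    define \<phi> where "\<phi> s = f (x + s *\<^sub>R a + h *\<^sub>R b) - f (x + s *\<^sub>R a)" for s
    define \<phi>' where "\<phi>' s = f' (x + s *\<^sub>R a + h *\<^sub>R b) a - f' (x + s *\<^sub>R a) a" for s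
    have der: "(\<phi> has_real_derivative \<phi>' s) (at s)" if s: "0 \<le> s" "s \<le> h" for s
    proof -
      have in_ball: "x + w \<in> S" if "norm w \<le> h * n" for w
      proof -
        have "x + w \<in> ball x d0" using that hn by (simp add: dist_norm)
        then show ?thesis using d0(2) by blast
      qed
      have in_S: "x + s *\<^sub>R a + h *\<^sub>R b \<in> S" "x + s *\<^sub>R a \<in> S"
        using in_ball[OF small[of s h]] in_ball[OF small[of s 0]] s h by (simp_all add: add.assoc)
      have 1: "((\<lambda>s. f (x + s *\<^sub>R a + h *\<^sub>R b)) has_derivative (\<lambda>t. f' (x + s *\<^sub>R a + h *\<^sub>R b) (t *\<^sub>R a))) (at s)"
        by (rule has_derivative_compose[where f = "\<lambda>s. x + s *\<^sub>R a + h *\<^sub>R b", OF _ f[OF in_S(1)]])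
          (auto intro!: derivative_eq_intros)
      have 2: "((\<lambda>s. f (x + s *\<^sub>R a)) has_derivative (\<lambda>t. f' (x + s *\<^sub>R a) (t *\<^sub>R a))) (at s)"
        by (rule has_derivative_compose[where f = "\<lambda>s. x + s *\<^sub>R a", OF _ f[OF in_S(2)]])
          (auto intro!: derivative_eq_intros)
      have l: "linear (f' (x + s *\<^sub>R a + h *\<^sub>R b))" "linear (f' (x + s *\<^sub>R a))"
        using f in_S has_derivative_linear by blast+
      show ?thesis unfolding \<phi>_def has_field_derivative_def
        by (rule has_derivative_eq_rhs[OF has_derivative_diff[OF 1 2]])
          (auto simp: \<phi>'_def fun_eq_iff linear_cmul[OF l(1)] linear_cmul[OF l(2)] right_diff_distrib mult.commute)
    qed
    obtain \<xi> where \<xi>: "0 < \<xi>" "\<xi> < h" "\<phi> h - \<phi> 0 = (h - 0) * \<phi>' \<xi>"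
      using MVT2[of 0 h \<phi> \<phi>'] der h by auto
    let ?u = "\<xi> *\<^sub>R a + h *\<^sub>R b" and ?v = "\<xi> *\<^sub>R a + 0 *\<^sub>R b"
    have nu: "norm ?u \<le> h * n" "norm ?v \<le> h * n" by (rule small; use \<xi> h in simp)+
    have e: "norm (f' (x + w) a - f' x a - A w) \<le> \<epsilon> / (2 * n) * (h * n)" if "norm w \<le> h * n" for w
    proof -
      have "norm (f' (x + w) a - f' x a - A w) \<le> \<epsilon> / (2 * n) * norm w"
        using d1(2)[of "x + w"] that hn by simp
      also have "\<dots> \<le> \<epsilon> / (2 * n) * (h * n)" using that \<epsilon> n by (intro mult_left_mono) auto
      finally show ?thesis .
    qed
    have "\<phi>' \<xi> = f' (x + ?u) a - f' (x + ?v) a" by (simp add: \<phi>'_def algebra_simps)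
    moreover have "A ?u - A ?v = h * A b" by (simp add: linear_add[OF linA] linear_cmul[OF linA])
    ultimately have "\<bar>\<phi>' \<xi> - h * A b\<bar> \<le> \<epsilon> / (2 * n) * (h * n) + \<epsilon> / (2 * n) * (h * n)"
      using e[OF nu(1)] e[OF nu(2)] by simp
    also have "\<dots> = \<epsilon> * h" using n by simp
    finally have 3: "\<bar>\<phi>' \<xi> - h * A b\<bar> \<le> \<epsilon> * h" .
    have "f (x + h *\<^sub>R a + h *\<^sub>R b) - f (x + h *\<^sub>R a) - f (x + h *\<^sub>R b) + f x - h\<^sup>2 * A b
        = h * (\<phi>' \<xi> - h * A b)"
      using \<xi>(3) by (simp add: \<phi>_def algebra_simps power2_eq_square)
    also have "\<bar>\<dots>\<bar> \<le> h * (\<epsilon> * h)"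
      unfolding abs_mult using h 3 by (intro mult_mono) auto
    finally show "\<bar>f (x + h *\<^sub>R a + h *\<^sub>R b) - f (x + h *\<^sub>R a) - f (x + h *\<^sub>R b) + f x - h\<^sup>2 * A b\<bar> \<le> \<epsilon> * h\<^sup>2"
      by (simp add: power2_eq_square mult_ac)
  qed
qed

text \<open>The second difference is symmetric in the two directions, so \<open>A b\<close> and
  \<open>B a\<close> approximate the same quantity. Two errors of a third of their gap cannot add up
  to the gap.\<close>

theorem symmetric_second_derivative_real:
  fixes f :: "'a::real_normed_vector \<Rightarrow> real"
  assumes S: "open S" "x \<in> S" and f: "\<And>y. y \<in> S \<Longrightarrow> (f has_derivative f' y) (at y)"
    and A: "((\<lambda>y. f' y a) has_derivative A) (at x)" and B: "((\<lambda>y. f' y b) has_derivative B) (at x)"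
  shows "A b = B a"
proof (rule ccontr)
  assume "A b \<noteq> B a"
  define \<epsilon> where "\<epsilon> = \<bar>A b - B a\<bar> / 3"
  have \<epsilon>: "\<epsilon> > 0" using \<open>A b \<noteq> B a\<close> by (simp add: \<epsilon>_def)
  from second_difference_estimate[OF S f A \<epsilon>, of b] obtain d1 where d1: "d1 > 0"
    "\<And>h. 0 < h \<and> h < d1 \<Longrightarrow> \<bar>f (x + h *\<^sub>R a + h *\<^sub>R b) - f (x + h *\<^sub>R a) - f (x + h *\<^sub>R b) + f x - h\<^sup>2 * A b\<bar> \<le> \<epsilon> * h\<^sup>2"
    by blast
  from second_difference_estimate[OF S f B \<epsilon>, of a] obtain d2 where d2: "d2 > 0"
    "\<And>h. 0 < h \<and> h < d2 \<Longrightarrow> \<bar>f (x + h *\<^sub>R b + h *\<^sub>R a) - f (x + h *\<^sub>R b) - f (x + h *\<^sub>R a) + f x - h\<^sup>2 * B a\<bar> \<le> \<epsilon> * h\<^sup>2"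
    by blast
  define h where "h = min d1 d2 / 2"
  have h: "0 < h \<and> h < d1" "0 < h \<and> h < d2" using d1 d2 by (auto simp: h_def)
  have "\<bar>h\<^sup>2 * A b - h\<^sup>2 * B a\<bar> \<le> 2 * \<epsilon> * h\<^sup>2"
    using d1(2)[OF h(1)] d2(2)[OF h(2)] by (simp add: add.commute add.left_commute)
  moreover have "h\<^sup>2 * \<bar>A b - B a\<bar> = \<bar>h\<^sup>2 * A b - h\<^sup>2 * B a\<bar>" by (simp add: abs_mult flip: right_diff_distrib)
  ultimately have "h\<^sup>2 * \<bar>A b - B a\<bar> \<le> h\<^sup>2 * (2 * \<epsilon>)" by (simp only: mult_ac)
  then have "\<bar>A b - B a\<bar> \<le> 2 * \<epsilon>" using h by simp
  then show False using \<epsilon> by (simp add: \<epsilon>_def)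
qed

lemma smooth_on_second_derivative_commute:
  fixes f :: "'a::euclidean_space \<Rightarrow> 'b::real_inner"
  assumes S: "open S" "x \<in> S" and f: "smooth_on S f"
  shows "frechet_derivative (\<lambda>y. frechet_derivative f (at y) a) (at x) b
    = frechet_derivative (\<lambda>y. frechet_derivative f (at y) b) (at x) a"
proof -
  have 1: "((\<lambda>y. f y \<bullet> c) has_derivative (\<lambda>v. frechet_derivative f (at y) v \<bullet> c)) (at y)" if "y \<in> S" for y c
    by (intro has_derivative_inner_left smooth_on_has_derivative[OF f that])
  have 2: "((\<lambda>y. frechet_derivative f (at y) a \<bullet> c) has_derivative
      (\<lambda>b. frechet_derivative (\<lambda>y. frechet_derivative f (at y) a) (at x) b \<bullet> c)) (at x)" for a c
    by (intro has_derivative_inner_left smooth_on_has_derivative[OF smooth_on_directional[OF f] S(2)])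
  have "frechet_derivative (\<lambda>y. frechet_derivative f (at y) a) (at x) b \<bullet> c
    = frechet_derivative (\<lambda>y. frechet_derivative f (at y) b) (at x) a \<bullet> c" for c
    by (rule symmetric_second_derivative_real[OF S 1 2 2])
  then show ?thesis by (rule vector_eq_rdot[THEN iffD1, OF allI])
qed

text \<open>Building block for expanding a bilinear map in a basis. It is bounded linear in
  \<open>c\<close>, so derivatives and continuity of the entries pass to the expanded map.\<close>

definition bilinear_elementary :: "'a::real_inner \<Rightarrow> 'b::real_inner \<Rightarrow> 'c::real_normed_vector \<Rightarrow> 'a \<Rightarrow>\<^sub>L 'b \<Rightarrow>\<^sub>L 'c"
  where "bilinear_elementary i j c =
    blinfun_scaleR_left (blinfun_scaleR_left c o\<^sub>L blinfun_inner_left j) o\<^sub>L blinfun_inner_left i"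

lemma bilinear_elementary_apply [simp]:
  "bilinear_elementary i j c a b = (a \<bullet> i) *\<^sub>R (b \<bullet> j) *\<^sub>R c"
  by (simp add: bilinear_elementary_def inner_commute blinfun.scaleR_left)

lemma bounded_linear_bilinear_elementary: "bounded_linear (bilinear_elementary i j)"
  unfolding bilinear_elementary_def
  by (intro bounded_linear_compose[OF bounded_bilinear.bounded_linear_left[OF bounded_bilinear_blinfun_compose]]
      bounded_linear_compose[OF bounded_linear_blinfun_scaleR_left] bounded_linear_blinfun_scaleR_left)

lemma bilinear_euclidean_expansion:
  fixes B :: "'a::euclidean_space \<Rightarrow> 'b::euclidean_space \<Rightarrow> 'c::real_normed_vector"
  assumes "bilinear B"
  shows "B a b = (\<Sum>i\<in>Basis. \<Sum>j\<in>Basis. (a \<bullet> i) *\<^sub>R (b \<bullet> j) *\<^sub>R B i j)"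
proof -
  have "B a b = B (\<Sum>i\<in>Basis. (a \<bullet> i) *\<^sub>R i) (\<Sum>j\<in>Basis. (b \<bullet> j) *\<^sub>R j)" by (simp add: euclidean_representation)
  also have "\<dots> = (\<Sum>(i,j)\<in>Basis \<times> Basis. B ((a \<bullet> i) *\<^sub>R i) ((b \<bullet> j) *\<^sub>R j))"
    by (rule bilinear_sum[OF assms])
  also have "\<dots> = (\<Sum>i\<in>Basis. \<Sum>j\<in>Basis. (a \<bullet> i) *\<^sub>R (b \<bullet> j) *\<^sub>R B i j)"
    by (simp add: sum.cartesian_product bilinear_lmul[OF assms] bilinear_rmul[OF assms] mult.commute)
  finally show ?thesis .
qed

text \<open>Smoothness of the metric is given separately for each pair of vectors, whereas the
  theorem on linear systems and the perturbation lemmas ask for derivatives in operator norm. In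
  finite dimension the finitely many basis entries suffice to pass from one to the other.\<close>

lemma C1_bilinear_blinfun:
  fixes B :: "'x::euclidean_space \<Rightarrow> 'a::euclidean_space \<Rightarrow> 'b::euclidean_space \<Rightarrow> 'c::real_normed_vector"
  assumes bil: "\<And>x. x \<in> U \<Longrightarrow> bilinear (B x)" and bil': "\<And>x v. x \<in> U \<Longrightarrow> bilinear (B' x v)"
    and der: "\<And>x a b. x \<in> U \<Longrightarrow> ((\<lambda>x. B x a b) has_derivative (\<lambda>v. B' x v a b)) (at x)"
    and cont: "\<And>v a b. continuous_on U (\<lambda>x. B' x v a b)"
  shows "\<exists>A A'. (\<forall>x\<in>U. (\<forall>a b. blinfun_apply (blinfun_apply (A x) a) b = B x a b) \<and>
      (\<forall>v a b. blinfun_apply (blinfun_apply (blinfun_apply (A' x) v) a) b = B' x v a b) \<and>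
      (A has_derivative blinfun_apply (A' x)) (at x)) \<and> continuous_on U A'"
proof -
  define A where "A x = (\<Sum>i\<in>Basis. \<Sum>j\<in>Basis. bilinear_elementary i j (B x i j))" for x
  define D where "D x v = (\<Sum>i\<in>Basis. \<Sum>j\<in>Basis. bilinear_elementary i j (B' x v i j))" for x v
  define A' where "A' x = (\<Sum>v\<in>Basis. blinfun_scaleR_left (D x v) o\<^sub>L blinfun_inner_left v)" for x
  have dA: "(A has_derivative D x) (at x)" if "x \<in> U" for x
    unfolding A_def D_def
    by (intro has_derivative_sum bounded_linear.has_derivative[OF bounded_linear_bilinear_elementary] der that)
  have DA': "D x v = A' x v" if "x \<in> U" for x v
  proof -
    have l: "linear (D x)" using dA[OF that] has_derivative_linear by blast
    have "D x v = D x (\<Sum>i\<in>Basis. (v \<bullet> i) *\<^sub>R i)" by (simp add: euclidean_representation)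
    also have "\<dots> = (\<Sum>i\<in>Basis. (v \<bullet> i) *\<^sub>R D x i)" by (simp add: linear_sum[OF l] linear_cmul[OF l])
    also have "\<dots> = A' x v" by (simp add: A'_def blinfun.sum_left inner_commute)
    finally show ?thesis .
  qed
  show ?thesis
  proof (intro exI[of _ A] exI[of _ A'] conjI ballI allI)
    show "A x a b = B x a b" if "x \<in> U" for x a b
      by (subst bilinear_euclidean_expansion[OF bil[OF that]]) (simp add: A_def blinfun.sum_left)
    show "A' x v a b = B' x v a b" if "x \<in> U" for x v a b
      unfolding DA'[OF that, symmetric]
      by (subst bilinear_euclidean_expansion[OF bil'[OF that]]) (simp add: D_def blinfun.sum_left)
    show "(A has_derivative A' x) (at x)" if "x \<in> U" for x
    proof -
      have "D x = blinfun_apply (A' x)" by (rule ext) (rule DA'[OF that])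
      then show ?thesis using dA[OF that] by simp
    qed
    have "continuous_on U (\<lambda>x. D x v)" for v
      unfolding D_def
      by (intro continuous_on_sum bounded_linear.continuous_on[OF bounded_linear_bilinear_elementary] cont)
    then show "continuous_on U A'"
      unfolding A'_def
      by (intro continuous_on_sum bounded_bilinear.continuous_on[OF bounded_bilinear_blinfun_compose]
          bounded_linear.continuous_on[OF bounded_linear_blinfun_scaleR_left] continuous_on_const)
  qed
qed

text \<open>For solving \<open>T z (y z) = L z\<close> without inverting \<open>T\<close>: the lower
  bound at \<open>x\<close> alone is enough, since \<open>T z - T x\<close> is eventually below
  \<open>c / 2\<close> in norm and can be absorbed.\<close>

lemma continuous_linear_solution:
  fixes T :: "'x::metric_space \<Rightarrow> 'a::real_normed_vector \<Rightarrow>\<^sub>L 'b::real_normed_vector"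
  assumes U: "open U" "x \<in> U" and T: "isCont T x" and L: "isCont L x"
    and sol: "\<And>z. z \<in> U \<Longrightarrow> T z (y z) = L z"
    and c: "c > 0" "\<And>u. norm (T x u) \<ge> c * norm u"
  shows "isCont y x"
proof -
  have "\<forall>\<^sub>F z in at x. dist (T z) (T x) < c / 2"
    using T c(1) unfolding isCont_def by (intro tendstoD) simp_all
  moreover have "\<forall>\<^sub>F z in at x. z \<in> U" using U eventually_at_topological by blast
  ultimately have bound: "\<forall>\<^sub>F z in at x. norm (y z - y x) \<le> (2 / c) * norm (L z - L x - (T z - T x) (y x))"
  proof eventually_elim
    case (elim z)
    have "c * norm (y z - y x) \<le> norm (T x (y z - y x))" by (rule c)
    also have "T x (y z - y x) = T z (y z - y x) - (T z - T x) (y z - y x)" by (simp add: blinfun.diff_left)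
    also have "norm \<dots> \<le> norm (T z (y z - y x)) + norm ((T z - T x) (y z - y x))" by (rule norm_triangle_ineq4)
    also have "norm ((T z - T x) (y z - y x)) \<le> c / 2 * norm (y z - y x)"
      using elim by (intro order_trans[OF norm_blinfun] mult_right_mono) (auto simp: dist_norm)
    also have "T z (y z - y x) = L z - L x - (T z - T x) (y x)"
      using sol[OF elim(2)] sol[OF U(2)] by (simp add: blinfun.bilinear_simps)
    finally show ?case using c(1) by (simp add: field_simps)
  qed
  have Lt: "((\<lambda>z. L z - L x - (T z - T x) (y x)) \<longlongrightarrow> L x - L x - (T x - T x) (y x)) (at x)"
    using T L unfolding isCont_def by (intro tendsto_intros)
  then have "((\<lambda>z. (2 / c) * norm (L z - L x - (T z - T x) (y x))) \<longlongrightarrow> 0) (at x)"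
    by (intro tendsto_mult_right_zero tendsto_norm_zero) simp
  then have "((\<lambda>z. y z - y x) \<longlongrightarrow> 0) (at x)"
    by (rule Lim_null_comparison[OF bound])
  then show ?thesis unfolding isCont_def by (rule LIM_zero_cancel)
qed

text \<open>The derivative is the one forced by differentiating \<open>T z (y z) = L z\<close>.
  Continuity of \<open>y\<close>, established beforehand, makes the mixed term
  \<open>(T z - T x) (y z - y x)\<close> negligible.\<close>

lemma has_derivative_linear_solution:
  fixes T :: "'x::euclidean_space \<Rightarrow> 'a::real_normed_vector \<Rightarrow>\<^sub>L 'b::real_normed_vector"
  assumes U: "open U" "x \<in> U" and T: "(T has_derivative T') (at x)" and L: "(L has_derivative L') (at x)"
    and sol: "\<And>z. z \<in> U \<Longrightarrow> T z (y z) = L z"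
    and c: "c > 0" "\<And>u. norm (T x u) \<ge> c * norm u"
    and y': "bounded_linear y'" "\<And>v. T x (y' v) = L' v - T' v (y x)"
  shows "(y has_derivative y') (at x)"
proof -
  have Tc: "isCont T x" and "isCont L x" using T L has_derivative_continuous by blast+
  then have yc: "isCont y x" by (intro continuous_linear_solution[where T = T and L = L, OF U _ _ sol c])
  have "((\<lambda>z. L z - T z (y x)) has_derivative (\<lambda>v. L' v - T' v (y x))) (at x)"
    by (intro derivative_intros L bounded_linear.has_derivative[OF blinfun.bounded_linear_left T])
  then have lim1: "((\<lambda>z. norm ((L z - T z (y x)) - (L x - T x (y x)) - (L' (z - x) - T' (z - x) (y x))) / norm (z - x)) \<longlongrightarrow> 0) (at x)"
    unfolding has_derivative_iff_norm by simp
  have lim2: "((\<lambda>z. norm (T z - T x - T' (z - x)) / norm (z - x)) \<longlongrightarrow> 0) (at x)"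
    using T unfolding has_derivative_iff_norm by simp
  obtain K where K: "\<And>v. norm (T' v) \<le> norm v * K"
    using bounded_linear.bounded has_derivative_bounded_linear[OF T] by blast
  have lim3: "((\<lambda>z. norm (y z - y x)) \<longlongrightarrow> 0) (at x)"
    using yc unfolding isCont_def by (intro tendsto_norm_zero LIM_zero)
  let ?e1 = "\<lambda>z. norm ((L z - T z (y x)) - (L x - T x (y x)) - (L' (z - x) - T' (z - x) (y x))) / norm (z - x)"
  let ?e2 = "\<lambda>z. norm (T z - T x - T' (z - x)) / norm (z - x)"
  have lim: "((\<lambda>z. (1 / c) * (?e1 z + (?e2 z + K) * norm (y z - y x))) \<longlongrightarrow> (1 / c) * (0 + (0 + K) * 0)) (at x)"
    by (intro tendsto_intros lim1 lim2 lim3)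
  have ev: "\<forall>\<^sub>F z in at x. norm (norm (y z - y x - y' (z - x)) / norm (z - x)) \<le> (1 / c) * (?e1 z + (?e2 z + K) * norm (y z - y x))"
  proof -
    have gen: "norm (N / n) \<le> (1 / c) * (p + q * Y)" if "c * N \<le> p * n + (q * n) * Y" "n > 0" "N \<ge> 0"
      for N n p q Y :: real
    proof -
      have "c * N \<le> n * (p + q * Y)" using that(1) by (simp add: algebra_simps)
      then show ?thesis using that(2,3) c(1) by (simp add: field_simps)
    qed
    have "\<forall>\<^sub>F z in at x. z \<in> U \<and> z \<noteq> x" using U eventually_at_topological by blast
    then show ?thesis
    proof eventually_elim
      case (elim z)
      have n: "norm (z - x) > 0" using elim by simp
      have s1: "c * norm (y z - y x - y' (z - x)) \<le> norm (T x (y z - y x - y' (z - x)))" by (rule c)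
      have s2: "T x (y z - y x - y' (z - x)) =
         ((L z - T z (y x)) - (L x - T x (y x)) - (L' (z - x) - T' (z - x) (y x))) - (T z - T x) (y z - y x)"
        using sol[of z] sol[OF U(2)] elim by (simp add: blinfun.bilinear_simps y'(2))
      have s3: "norm (T x (y z - y x - y' (z - x))) \<le> ?e1 z * norm (z - x) + norm ((T z - T x) (y z - y x))"
        unfolding s2 using n by (intro order_trans[OF norm_triangle_ineq4]) simp
      have s4: "norm ((T z - T x) (y z - y x)) \<le> norm (T z - T x) * norm (y z - y x)" by (rule norm_blinfun)
      have s5: "norm (T z - T x) * norm (y z - y x) \<le> ((?e2 z + K) * norm (z - x)) * norm (y z - y x)"
      proof (intro mult_right_mono)
        have "norm (T z - T x) \<le> norm (T z - T x - T' (z - x)) + norm (T' (z - x))"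
          using norm_triangle_ineq[of "T z - T x - T' (z - x)" "T' (z - x)"] by simp
        also have "\<dots> \<le> (?e2 z + K) * norm (z - x)" using n K[of "z - x"] by (simp add: algebra_simps)
        finally show "norm (T z - T x) \<le> (?e2 z + K) * norm (z - x)" .
      qed simp
      have key: "c * norm (y z - y x - y' (z - x)) \<le> ?e1 z * norm (z - x) + ((?e2 z + K) * norm (z - x)) * norm (y z - y x)"
        using s1 s3 s4 s5 by linarith
      show ?case by (rule gen[OF key n norm_ge_zero])
    qed
  qed
  have "((\<lambda>z. norm (y z - y x - y' (z - x)) / norm (z - x)) \<longlongrightarrow> 0) (at x)"
    by (rule Lim_null_comparison[OF ev]) (use lim in simp)
  then show ?thesis using y'(1) by (simp add: has_derivative_iff_norm)
qed

section \<open>Metrics in coordinates\<close>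

lemma frechet_derivative_eqI: "(f has_derivative f') (at x) \<Longrightarrow> frechet_derivative f (at x) = f'"
  using frechet_derivative_at by metis

text \<open>Turns definiteness into the coercivity that the lemmas on linear equations require; the
  constant is the minimum of the quadratic form on the unit sphere.\<close>

lemma positive_definite_bounded_below:
  fixes T :: "'a::euclidean_space \<Rightarrow>\<^sub>L 'a \<Rightarrow>\<^sub>L real"
  assumes "\<And>a. a \<noteq> 0 \<Longrightarrow> T a a > 0"
  obtains c where "c > 0" "\<And>u. norm (T u) \<ge> c * norm u"
proof -
  have "continuous_on (sphere 0 1) (\<lambda>u. T u u)" by (intro continuous_intros)
  then obtain m where m: "m \<in> sphere (0::'a) 1" "\<forall>u\<in>sphere 0 1. T m m \<le> T u u"
    using continuous_attains_inf[OF compact_sphere, of 0 1 "\<lambda>u. T u u"] by auto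
  show ?thesis
  proof
    have "m \<noteq> 0" using m(1) by auto
    then show c: "T m m > 0" by (rule assms)
    fix u show "T m m * norm u \<le> norm (T u)"
    proof (cases "u = 0")
      case False
      then have "T m m \<le> T (u /\<^sub>R norm u) (u /\<^sub>R norm u)" by (intro m(2)[rule_format]) simp
      also have "\<dots> = T u u / (norm u * norm u)"
        by (simp add: blinfun.scaleR_right blinfun.scaleR_left field_simps)
      finally have "T m m * norm u * norm u \<le> T u u" using False by (simp add: field_simps)
      also have "\<dots> \<le> norm (T u) * norm u" using norm_blinfun[of "T u" u] by simp
      finally show ?thesis using False by simp
    qed simp
  qed
qed

text \<open>The metric as seen in one chart, so that the local tensor calculus can be done on an
  open set of Euclidean space.\<close>

locale coordinate_metric =
  fixes U :: "'e::euclidean_space set" and G :: "'e \<Rightarrow> 'e \<Rightarrow> 'e \<Rightarrow> real"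
  assumes open_U: "open U"
    and bilinear_G: "x \<in> U \<Longrightarrow> bilinear (G x)"
    and sym_G: "x \<in> U \<Longrightarrow> G x a b = G x b a"
    and pos_G: "x \<in> U \<Longrightarrow> a \<noteq> 0 \<Longrightarrow> G x a a > 0"
    and smooth_G: "smooth_on U (\<lambda>x. G x a b)"
begin

definition dG :: "'e \<Rightarrow> 'e \<Rightarrow> 'e \<Rightarrow> 'e \<Rightarrow> real"
  where "dG x v a b = frechet_derivative (\<lambda>y. G y a b) (at x) v"

definition ddG :: "'e \<Rightarrow> 'e \<Rightarrow> 'e \<Rightarrow> 'e \<Rightarrow> 'e \<Rightarrow> real"
  where "ddG x u v a b = frechet_derivative (\<lambda>y. dG y v a b) (at x) u"

definition Gam :: "'e \<Rightarrow> 'e \<Rightarrow> 'e \<Rightarrow> 'e"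
  where "Gam x a b = (THE v. \<forall>w. 2 * G x v w = dG x a b w + dG x b a w - dG x w a b)"

definition dGam :: "'e \<Rightarrow> 'e \<Rightarrow> 'e \<Rightarrow> 'e \<Rightarrow> 'e"
  where "dGam x v a b = frechet_derivative (\<lambda>y. Gam y a b) (at x) v"

definition Riem :: "'e \<Rightarrow> 'e \<Rightarrow> 'e \<Rightarrow> 'e \<Rightarrow> 'e"
  where "Riem x a b v = dGam x a b v - dGam x b a v + Gam x a (Gam x b v) - Gam x b (Gam x a v)"

section \<open>Derivatives of the metric and the Koszul formula\<close>

lemma has_derivative_G: "x \<in> U \<Longrightarrow> ((\<lambda>x. G x a b) has_derivative (\<lambda>v. dG x v a b)) (at x)"
  using smooth_on_has_derivative[OF smooth_G] unfolding dG_def by blast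

lemma smooth_dG: "smooth_on U (\<lambda>x. dG x v a b)"
  unfolding dG_def by (rule smooth_on_directional[OF smooth_G])

lemma has_derivative_dG: "x \<in> U \<Longrightarrow> ((\<lambda>x. dG x v a b) has_derivative (\<lambda>u. ddG x u v a b)) (at x)"
  using smooth_on_has_derivative[OF smooth_dG] unfolding ddG_def by blast

lemma continuous_on_ddG: "continuous_on U (\<lambda>x. ddG x u v a b)"
  unfolding ddG_def by (intro smooth_on_continuous smooth_on_directional smooth_dG)

lemma ddG_commute: "x \<in> U \<Longrightarrow> ddG x u v a b = ddG x v u a b"
  unfolding ddG_def dG_def by (rule smooth_on_second_derivative_commute[OF open_U _ smooth_G])

lemma G_add: "x \<in> U \<Longrightarrow> G x (a + a') b = G x a b + G x a' b" "x \<in> U \<Longrightarrow> G x b (a + a') = G x b a + G x b a'"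
  and G_scale: "x \<in> U \<Longrightarrow> G x (r *\<^sub>R a) b = r * G x a b" "x \<in> U \<Longrightarrow> G x b (r *\<^sub>R a) = r * G x b a"
  and G_diff: "x \<in> U \<Longrightarrow> G x (a - a') b = G x a b - G x a' b" "x \<in> U \<Longrightarrow> G x b (a - a') = G x b a - G x b a'"
  and G_minus: "x \<in> U \<Longrightarrow> G x (- a) b = - G x a b" "x \<in> U \<Longrightarrow> G x b (- a) = - G x b a"
  and G_zero: "x \<in> U \<Longrightarrow> G x 0 b = 0" "x \<in> U \<Longrightarrow> G x b 0 = 0"
  using bilinear_G[of x]
  by (simp_all add: bilinear_ladd bilinear_radd bilinear_lmul bilinear_rmul bilinear_lsub bilinear_rsub
      bilinear_lneg bilinear_rneg bilinear_lzero bilinear_rzero)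

lemmas G_simps = G_add G_scale G_diff G_minus G_zero

lemma G_nondegenerate:
  assumes "x \<in> U" "\<And>w. G x u w = G x v w"
  shows "u = v"
proof (rule ccontr)
  assume "u \<noteq> v"
  then have "G x (u - v) (u - v) > 0" by (intro pos_G assms) simp
  then show False using assms by (simp add: G_diff)
qed

lemma dG_linear: "x \<in> U \<Longrightarrow> linear (\<lambda>v. dG x v a b)"
  using has_derivative_G has_derivative_linear by blast

lemma dG_direction: "x \<in> U \<Longrightarrow> dG x (v + v') a b = dG x v a b + dG x v' a b"
  "x \<in> U \<Longrightarrow> dG x (r *\<^sub>R v) a b = r * dG x v a b"
  using linear_add[OF dG_linear] linear_cmul[OF dG_linear] by simp_all

lemma bilinear_dG: "x \<in> U \<Longrightarrow> bilinear (dG x v)"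
proof -
  assume x: "x \<in> U"
  \<comment> \<open>Identities for \<open>G\<close> hold on the whole open set \<open>U\<close> and
    may therefore be differentiated; each bilinearity law is inherited in this way.\<close>
  have eqI: "dG x v a b = f' v" if "\<And>y. y \<in> U \<Longrightarrow> G y a b = f y" "(f has_derivative f') (at x)" for a b f f'
  proof -
    have "((\<lambda>x. G x a b) has_derivative f') (at x)"
      by (rule has_derivative_transform_within_open[OF that(2) open_U x]) (simp add: that)
    then show ?thesis unfolding dG_def by (simp add: frechet_derivative_eqI)
  qed
  show ?thesis unfolding bilinear_def
    by (intro conjI allI linearI; (rule eqI, erule G_simps, (auto intro!: derivative_eq_intros has_derivative_G x)))
qed

lemma sym_dG: "x \<in> U \<Longrightarrow> dG x v a b = dG x v b a"
proof -
  assume x: "x \<in> U"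
  have "((\<lambda>x. G x a b) has_derivative (\<lambda>v. dG x v b a)) (at x)"
    by (rule has_derivative_transform_within_open[OF has_derivative_G[OF x] open_U x]) (simp add: sym_G)
  then show ?thesis unfolding dG_def by (simp add: frechet_derivative_eqI)
qed

lemma bilinear_ddG: "x \<in> U \<Longrightarrow> bilinear (ddG x u v)"
proof -
  assume x: "x \<in> U"
  have eqI: "ddG x u v a b = f' u" if "\<And>y. y \<in> U \<Longrightarrow> dG y v a b = f y" "(f has_derivative f') (at x)" for a b f f'
  proof -
    have "((\<lambda>x. dG x v a b) has_derivative f') (at x)"
      by (rule has_derivative_transform_within_open[OF that(2) open_U x]) (simp add: that)
    then show ?thesis unfolding ddG_def by (simp add: frechet_derivative_eqI)
  qed
  show ?thesis unfolding bilinear_def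
    by (intro conjI allI linearI;
      (rule eqI, (erule bilinear_ladd[OF bilinear_dG] bilinear_radd[OF bilinear_dG] bilinear_lmul[OF bilinear_dG] bilinear_rmul[OF bilinear_dG]),
       (auto intro!: derivative_eq_intros has_derivative_dG x)))
qed

text \<open>An injective linear map in finite dimension is surjective. This gives the existence and
  uniqueness behind the definite descriptions of the Christoffel symbols and their
  derivatives.\<close>

lemma Riesz:
  assumes x: "x \<in> U" and l: "linear l"
  shows "\<exists>!v. \<forall>w. G x v w = l w"
proof (rule ex_ex1I)
  define T where "T v = (\<Sum>i\<in>Basis. G x v i *\<^sub>R i)" for v
  have lin: "linear T"
    unfolding T_def by (rule linearI) (simp_all add: G_simps x scaleR_add_left sum.distrib scaleR_sum_right)
  have Gw: "G x v w = (\<Sum>i\<in>Basis. (w \<bullet> i) * G x v i)" for v w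
  proof -
    have "linear (G x v)" using bilinear_G[OF x] by (simp add: bilinear_def)
    then have "G x v (\<Sum>i\<in>Basis. (w \<bullet> i) *\<^sub>R i) = (\<Sum>i\<in>Basis. (w \<bullet> i) * G x v i)"
      by (simp add: linear_sum linear_cmul)
    then show ?thesis by (simp add: euclidean_representation)
  qed
  have "inj T"
  proof (rule linear_injective_0[OF lin, THEN iffD2], intro allI impI)
    fix v assume "T v = 0"
    then have "\<And>i. i \<in> Basis \<Longrightarrow> G x v i = 0"
      unfolding T_def by (metis inner_zero_left inner_sum_left_Basis)
    then have "G x v v = 0" by (subst Gw) simp
    then show "v = 0" using pos_G[OF x, of v] by force
  qed
  then have "surj T" using lin linear_injective_imp_surjective by blast
  then obtain v where v: "T v = (\<Sum>i\<in>Basis. l i *\<^sub>R i)" by (metis surj_def)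
  have vi: "G x v i = l i" if "i \<in> Basis" for i
    using v that unfolding T_def by (metis (no_types) inner_sum_left_Basis)
  have "G x v w = l w" for w
  proof -
    have "l (\<Sum>i\<in>Basis. (w \<bullet> i) *\<^sub>R i) = (\<Sum>i\<in>Basis. (w \<bullet> i) * l i)"
      by (simp add: linear_sum[OF l] linear_cmul[OF l])
    then show ?thesis by (subst Gw) (simp add: vi euclidean_representation)
  qed
  then show "\<exists>v. \<forall>w. G x v w = l w" by blast
qed (use G_nondegenerate[OF x] in metis)

lemma Koszul: 
  assumes x: "x \<in> U"
  shows "2 * G x (Gam x a b) w = dG x a b w + dG x b a w - dG x w a b"
proof -
  have "linear (\<lambda>w. (dG x a b w + dG x b a w - dG x w a b) / 2)"
    by (intro linearI) (simp_all add: bilinear_radd[OF bilinear_dG[OF x]] bilinear_rmul[OF bilinear_dG[OF x]]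
        dG_direction[OF x] algebra_simps add_divide_distrib diff_divide_distrib)
  from Riesz[OF x this] have "\<exists>!v. \<forall>w. 2 * G x v w = dG x a b w + dG x b a w - dG x w a b"
    by (simp add: eq_divide_eq mult.commute)
  from theI'[OF this] show ?thesis unfolding Gam_def by blast
qed

lemma Gam_unique:
  assumes x: "x \<in> U" and "\<And>w. 2 * G x v w = dG x a b w + dG x b a w - dG x w a b"
  shows "Gam x a b = v"
  by (rule G_nondegenerate[OF x]) (use Koszul[OF x, of a b] assms(2) in \<open>metis mult_cancel_left zero_neq_numeral\<close>)

lemma Gam_sym: "x \<in> U \<Longrightarrow> Gam x a b = Gam x b a"
  by (rule Gam_unique) (simp_all add: Koszul sym_dG)

lemma bilinear_Gam: assumes x: "x \<in> U" shows "bilinear (Gam x)"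
proof -
  have l: "linear (\<lambda>a. Gam x a b)" for b
    by (intro linearI Gam_unique x)
      (simp_all add: G_simps x distrib_left right_diff_distrib Koszul[OF x] bilinear_ladd[OF bilinear_dG[OF x]] bilinear_lmul[OF bilinear_dG[OF x]]
        dG_direction[OF x] mult.left_commute[of 2])
  moreover have "Gam x b = (\<lambda>a. Gam x a b)" for b by (rule ext) (rule Gam_sym[OF x])
  ultimately show ?thesis unfolding bilinear_def by metis
qed

text \<open>The sum of two Koszul formulas with \<open>v\<close> and \<open>w\<close> exchanged, in
  which the derivatives along \<open>v\<close> and \<open>w\<close> cancel.\<close>

lemma metric_compatible:
  assumes x: "x \<in> U"
  shows "dG x a v w = G x (Gam x a v) w + G x v (Gam x a w)"
  using Koszul[OF x, of a v w] Koszul[OF x, of a w v] sym_G[OF x, of "Gam x a w" v]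
    sym_dG[OF x, of a v w] sym_dG[OF x, of v a w] sym_dG[OF x, of w a v] by linarith

lemma ddG_direction:
  assumes x: "x \<in> U"
  shows "ddG x u (v + v') a b = ddG x u v a b + ddG x u v' a b" "ddG x u (r *\<^sub>R v) a b = r * ddG x u v a b"
proof -
  have eqI: "ddG x u v a b = f' u" if "\<And>y. y \<in> U \<Longrightarrow> dG y v a b = f y" "(f has_derivative f') (at x)" for v f f'
  proof -
    have "((\<lambda>x. dG x v a b) has_derivative f') (at x)"
      by (rule has_derivative_transform_within_open[OF that(2) open_U x]) (simp add: that)
    then show ?thesis unfolding ddG_def by (simp add: frechet_derivative_eqI)
  qed
  show "ddG x u (v + v') a b = ddG x u v a b + ddG x u v' a b"
    by (rule eqI, erule dG_direction) (auto intro!: derivative_eq_intros has_derivative_dG x)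
  show "ddG x u (r *\<^sub>R v) a b = r * ddG x u v a b"
    by (rule eqI, erule dG_direction) (auto intro!: derivative_eq_intros has_derivative_dG x)
qed

text \<open>Christoffel symbols of the first kind. The vector \<open>b\<close> comes first so that
  for fixed \<open>b\<close> there remains a bilinear form in the direction \<open>a\<close> and the
  test vector \<open>w\<close>, as \<open>C1_bilinear_blinfun\<close> expects.\<close>

definition Kos :: "'e \<Rightarrow> 'e \<Rightarrow> 'e \<Rightarrow> 'e \<Rightarrow> real"
  where "Kos x b a w = (dG x a b w + dG x b a w - dG x w a b) / 2"

definition dKos :: "'e \<Rightarrow> 'e \<Rightarrow> 'e \<Rightarrow> 'e \<Rightarrow> 'e \<Rightarrow> real"
  where "dKos x b u a w = (ddG x u a b w + ddG x u b a w - ddG x u w a b) / 2"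

lemma Kos_Gam: "x \<in> U \<Longrightarrow> G x (Gam x a b) w = Kos x b a w"
  using Koszul[of x a b w] by (simp add: Kos_def)

lemma bilinear_Kos: "x \<in> U \<Longrightarrow> bilinear (Kos x b)"
  unfolding bilinear_def Kos_def
  by (intro conjI allI linearI)
    (simp_all add: bilinear_radd[OF bilinear_dG] bilinear_rmul[OF bilinear_dG] bilinear_ladd[OF bilinear_dG]
      bilinear_lmul[OF bilinear_dG] dG_direction algebra_simps add_divide_distrib diff_divide_distrib)

lemma bilinear_dKos: "x \<in> U \<Longrightarrow> bilinear (dKos x b u)"
  unfolding bilinear_def dKos_def
  by (intro conjI allI linearI)
    (simp_all add: bilinear_radd[OF bilinear_ddG] bilinear_rmul[OF bilinear_ddG] bilinear_ladd[OF bilinear_ddG]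
      bilinear_lmul[OF bilinear_ddG] ddG_direction algebra_simps add_divide_distrib diff_divide_distrib)

lemma has_derivative_Kos: "x \<in> U \<Longrightarrow> ((\<lambda>x. Kos x b a w) has_derivative (\<lambda>u. dKos x b u a w)) (at x)"
  unfolding Kos_def dKos_def
  by (rule derivative_eq_intros has_derivative_dG refl | simp)+

lemma continuous_on_dKos: "continuous_on U (\<lambda>x. dKos x b u a w)"
  unfolding dKos_def by (intro continuous_intros continuous_on_ddG) auto

lemma continuous_on_dG: "continuous_on U (\<lambda>x. dG x u a b)"
  by (intro smooth_on_continuous smooth_dG)

lemma G_blinfun:
  "\<exists>T T'. (\<forall>x\<in>U. (\<forall>a b. blinfun_apply (blinfun_apply (T x) a) b = G x a b) \<and>
      (\<forall>v a b. blinfun_apply (blinfun_apply (blinfun_apply (T' x) v) a) b = dG x v a b) \<and>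
      (T has_derivative blinfun_apply (T' x)) (at x)) \<and> continuous_on U T'"
  by (rule C1_bilinear_blinfun[where B = G and B' = dG])
    (simp_all add: bilinear_G bilinear_dG has_derivative_G continuous_on_dG)

lemma Kos_blinfun:
  "\<exists>L L'. (\<forall>x\<in>U. (\<forall>a w. blinfun_apply (blinfun_apply (L x) a) w = Kos x b a w) \<and>
      (\<forall>v a w. blinfun_apply (blinfun_apply (blinfun_apply (L' x) v) a) w = dKos x b v a w) \<and>
      (L has_derivative blinfun_apply (L' x)) (at x)) \<and> continuous_on U L'"
  by (rule C1_bilinear_blinfun[where B = "\<lambda>x. Kos x b" and B' = "\<lambda>x. dKos x b"])
    (simp_all add: bilinear_Kos bilinear_dKos has_derivative_Kos continuous_on_dKos)

text \<open>A definite description carries no regularity, so \<open>Gam\<close> is treated as the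
  solution of the linear equation \<open>G x (Gam x a b) w = Kos x b a w\<close>, whose data are
  differentiable. Its derivative solves the differentiated equation, and continuity of that
  derivative follows by applying the same principle to the new equation.\<close>

lemma Gam_C1:
  assumes x: "x \<in> U"
  shows "((\<lambda>x. Gam x a b) has_derivative (\<lambda>v. dGam x v a b)) (at x)"
    and "\<And>v w. G x (dGam x v a b) w = dKos x b v a w - dG x v (Gam x a b) w"
    and "isCont (\<lambda>x. dGam x v a b) x"
proof -
  obtain T :: "'e \<Rightarrow> 'e \<Rightarrow>\<^sub>L 'e \<Rightarrow>\<^sub>L real"
    and T' :: "'e \<Rightarrow> 'e \<Rightarrow>\<^sub>L 'e \<Rightarrow>\<^sub>L 'e \<Rightarrow>\<^sub>L real" where
    TT: "\<forall>x\<in>U. (\<forall>a b. T x a b = G x a b) \<and> (\<forall>v a b. T' x v a b = dG x v a b) \<and> (T has_derivative T' x) (at x)"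
      "continuous_on U T'"
    using G_blinfun by (elim exE conjE)
  have T: "x \<in> U \<Longrightarrow> T x a b = G x a b" "x \<in> U \<Longrightarrow> T' x v a b = dG x v a b"
    "x \<in> U \<Longrightarrow> (T has_derivative T' x) (at x)" "continuous_on U T'" for x a b v
    using TT by simp_all
  obtain L :: "'e \<Rightarrow> 'e \<Rightarrow>\<^sub>L 'e \<Rightarrow>\<^sub>L real"
    and L' :: "'e \<Rightarrow> 'e \<Rightarrow>\<^sub>L 'e \<Rightarrow>\<^sub>L 'e \<Rightarrow>\<^sub>L real" where
    LL: "\<forall>x\<in>U. (\<forall>a w. L x a w = Kos x b a w) \<and> (\<forall>v a w. L' x v a w = dKos x b v a w) \<and> (L has_derivative L' x) (at x)"
      "continuous_on U L'"
    using Kos_blinfun[of b] by (elim exE conjE)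
  have L: "x \<in> U \<Longrightarrow> L x a w = Kos x b a w" "x \<in> U \<Longrightarrow> L' x v a w = dKos x b v a w"
    "x \<in> U \<Longrightarrow> (L has_derivative L' x) (at x)" "continuous_on U L'" for x a w v
    using LL by simp_all
  have bound: "\<exists>c>0. \<forall>u. norm (T x u) \<ge> c * norm u" if "x \<in> U" for x
    using positive_definite_bounded_below[of "T x"] T(1)[OF that] pos_G[OF that] by metis
  have Y: "\<exists>!y. \<forall>w. G x y w = dKos x b v a w - dG x v (Gam x a b) w" if x: "x \<in> U" for x v
  proof (rule Riesz[OF x])
    show "linear (\<lambda>w. dKos x b v a w - dG x v (Gam x a b) w)"
      using bilinear_dKos[OF x] bilinear_dG[OF x] by (intro linear_compose_sub) (auto simp: bilinear_def)
  qed
  define Y' where "Y' x v = (THE y. \<forall>w. G x y w = dKos x b v a w - dG x v (Gam x a b) w)" for x v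
  have Y': "G x (Y' x v) w = dKos x b v a w - dG x v (Gam x a b) w" if "x \<in> U" for x v w
    using theI'[OF Y[OF that, of v]] unfolding Y'_def by blast
  have der: "((\<lambda>x. Gam x a b) has_derivative Y' x) (at x)" if x: "x \<in> U" for x
  proof -
    obtain c where c: "c > 0" "\<forall>u. norm (T x u) \<ge> c * norm u" using bound[OF x] by blast
    show ?thesis
    proof (rule has_derivative_linear_solution[where T = T and L = "\<lambda>z. L z a" and L' = "\<lambda>v. L' x v a", OF open_U x T(3)[OF x]])
      show "((\<lambda>z. L z a) has_derivative (\<lambda>v. L' x v a)) (at x)"
        by (rule bounded_linear.has_derivative[OF blinfun.bounded_linear_left L(3)[OF x]])
      show "T z (Gam z a b) = L z a" if "z \<in> U" for z
        by (rule blinfun_eqI) (simp add: T L that Kos_Gam)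
      show "0 < c" "c * norm u \<le> norm (T x u)" for u using c by auto
      have "linear (Y' x)"
      proof (rule linearI; rule G_nondegenerate[OF x])
        have d: "linear (\<lambda>v. L' x v a w)" for w
          by (intro bounded_linear.linear bounded_linear_intros)
        note da = linear_add[OF d, unfolded L(2)[OF x]] and dm = linear_cmul[OF d, unfolded L(2)[OF x]]
        show "G x (Y' x (v + v')) w = G x (Y' x v + Y' x v') w" for v v' w
          by (simp add: Y' G_simps x dG_direction da)
        show "G x (Y' x (r *\<^sub>R v)) w = G x (r *\<^sub>R Y' x v) w" for r v w
          by (simp add: Y' G_simps x dG_direction dm right_diff_distrib)
      qed
      then show "bounded_linear (Y' x)" by (simp add: linear_conv_bounded_linear)
      show "T x (Y' x v) = L' x v a - T' x v (Gam x a b)" for v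
        by (rule blinfun_eqI) (simp add: T L x Y' blinfun.diff_left)
    qed
  qed
  have dGam_eq: "dGam x v a b = Y' x v" if "x \<in> U" for x v
    unfolding dGam_def frechet_derivative_eqI[OF der[OF that]] ..
  have "(\<lambda>v. dGam x v a b) = Y' x" by (rule ext) (rule dGam_eq[OF x])
  then show der': "((\<lambda>x. Gam x a b) has_derivative (\<lambda>v. dGam x v a b)) (at x)"
    using der[OF x] by simp
  show "G x (dGam x v a b) w = dKos x b v a w - dG x v (Gam x a b) w" for v w
    by (simp add: dGam_eq x Y')
  obtain c where c: "c > 0" "\<forall>u. norm (T x u) \<ge> c * norm u" using bound[OF x] by blast
  have cT: "isCont T x" using T(3)[OF x] by (rule has_derivative_continuous)
  have cL: "isCont L' x" "isCont T' x"
    using L(4) T(4) open_U x by (simp_all add: continuous_on_eq_continuous_at)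
  have cG: "isCont (\<lambda>x. Gam x a b) x" using der' by (rule has_derivative_continuous)
  show "isCont (\<lambda>x. dGam x v a b) x"
  proof (rule continuous_linear_solution[where T = T and L = "\<lambda>z. L' z v a - T' z v (Gam z a b)", OF open_U x cT])
    show "isCont (\<lambda>z. L' z v a - T' z v (Gam z a b)) x"
      by (intro continuous_intros cL cG)
    show "T z (dGam z v a b) = L' z v a - T' z v (Gam z a b)" if "z \<in> U" for z
      by (rule blinfun_eqI) (simp add: T L that dGam_eq Y' blinfun.diff_left)
    show "0 < c" "c * norm u \<le> norm (T x u)" for u using c by auto
  qed
qed

lemmas has_derivative_Gam = Gam_C1(1)

lemma continuous_on_dGam: "continuous_on U (\<lambda>x. dGam x v a b)"
  using Gam_C1(3) by (simp add: continuous_at_imp_continuous_on)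

lemma bilinear_dGam: assumes x: "x \<in> U" shows "bilinear (dGam x v)"
proof -
  have eqI: "dGam x v a b = f' v" if "\<And>y. y \<in> U \<Longrightarrow> Gam y a b = f y" "(f has_derivative f') (at x)" for a b f f'
  proof -
    have "((\<lambda>x. Gam x a b) has_derivative f') (at x)"
      by (rule has_derivative_transform_within_open[OF that(2) open_U x]) (simp add: that)
    then show ?thesis unfolding dGam_def by (simp add: frechet_derivative_eqI)
  qed
  show ?thesis unfolding bilinear_def
    by (intro conjI allI linearI;
      (rule eqI, (erule bilinear_ladd[OF bilinear_Gam] bilinear_radd[OF bilinear_Gam] bilinear_lmul[OF bilinear_Gam] bilinear_rmul[OF bilinear_Gam]),
       (auto intro!: derivative_eq_intros has_derivative_Gam x)))
qed

lemma dGam_sym: assumes x: "x \<in> U" shows "dGam x v a b = dGam x v b a"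
proof -
  have "((\<lambda>x. Gam x a b) has_derivative (\<lambda>v. dGam x v b a)) (at x)"
    by (rule has_derivative_transform_within_open[OF has_derivative_Gam[OF x] open_U x]) (simp add: Gam_sym)
  then show ?thesis unfolding dGam_def by (simp add: frechet_derivative_eqI)
qed

lemmas Gam_simps = bilinear_ladd[OF bilinear_Gam] bilinear_radd[OF bilinear_Gam] bilinear_lmul[OF bilinear_Gam]
  bilinear_rmul[OF bilinear_Gam] bilinear_lsub[OF bilinear_Gam] bilinear_rsub[OF bilinear_Gam]
  bilinear_lneg[OF bilinear_Gam] bilinear_rneg[OF bilinear_Gam]

lemmas dGam_simps = bilinear_ladd[OF bilinear_dGam] bilinear_radd[OF bilinear_dGam] bilinear_lmul[OF bilinear_dGam]
  bilinear_rmul[OF bilinear_dGam]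

text \<open>The product rule with all three arguments moving, the common source of the computations
  along curves and of the conservation law for parallel sections.\<close>

lemma has_derivative_G_compose:
  assumes s: "s \<in> S" and x: "X s \<in> U" and X: "(X has_derivative X') (at s within S)"
    and v: "(v has_derivative v') (at s within S)" and w: "(w has_derivative w') (at s within S)"
  shows "((\<lambda>s. G (X s) (v s) (w s)) has_derivative
    (\<lambda>a. dG (X s) (X' a) (v s) (w s) + G (X s) (v' a) (w s) + G (X s) (v s) (w' a))) (at s within S)"
proof -
  obtain T :: "'e \<Rightarrow> 'e \<Rightarrow>\<^sub>L 'e \<Rightarrow>\<^sub>L real"
    and T' :: "'e \<Rightarrow> 'e \<Rightarrow>\<^sub>L 'e \<Rightarrow>\<^sub>L 'e \<Rightarrow>\<^sub>L real" where
    TT: "\<forall>x\<in>U. (\<forall>a b. T x a b = G x a b) \<and> (\<forall>v a b. T' x v a b = dG x v a b) \<and> (T has_derivative T' x) (at x)"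
      "continuous_on U T'"
    using G_blinfun by (elim exE conjE)
  have T: "x \<in> U \<Longrightarrow> T x a b = G x a b" "x \<in> U \<Longrightarrow> T' x v a b = dG x v a b"
    "x \<in> U \<Longrightarrow> (T has_derivative T' x) (at x)" for x a b v
    using TT by simp_all
  have "((\<lambda>s. T (X s)) has_derivative (\<lambda>a. T' (X s) (X' a))) (at s within S)"
    by (rule has_derivative_compose[OF X T(3)[OF x]])
  then have "((\<lambda>s. T (X s) (v s) (w s)) has_derivative
      (\<lambda>a. T (X s) (v s) (w' a) + (T (X s) (v' a) + T' (X s) (X' a) (v s)) (w s))) (at s within S)"
    by (intro blinfun.FDERIV v w)
  then have d: "((\<lambda>s. T (X s) (v s) (w s)) has_derivative
      (\<lambda>a. dG (X s) (X' a) (v s) (w s) + G (X s) (v' a) (w s) + G (X s) (v s) (w' a))) (at s within S)"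
    by (rule has_derivative_eq_rhs) (simp add: fun_eq_iff T x blinfun.add_left)
  have "\<forall>\<^sub>F t in at s within S. X t \<in> U"
    using has_derivative_continuous[OF X] open_U x unfolding continuous_within by (rule topological_tendstoD)
  then have ev: "\<forall>\<^sub>F t in at s within S. T (X t) (v t) (w t) = G (X t) (v t) (w t)"
    by eventually_elim (simp add: T)
  show ?thesis
    by (rule has_derivative_transform_eventually[OF d ev]) (simp_all add: T x s)
qed

section \<open>Symmetries of the curvature tensor\<close>

lemma Riem_swap: "Riem x a b v = - Riem x b a v"
  by (simp add: Riem_def)

lemma Bianchi: "x \<in> U \<Longrightarrow> Riem x a b v + Riem x b v a + Riem x v a b = 0"
  using dGam_sym[of x a b v] dGam_sym[of x b v a] dGam_sym[of x v a b]
    Gam_sym[of x a b] Gam_sym[of x b v] Gam_sym[of x v a]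
  by (simp add: Riem_def)

text \<open>Both mixed second derivatives of \<open>G y v v\<close> are expanded by metric
  compatibility. They are equal, and their difference is twice the quantity in question.\<close>

lemma Riem_skew_diag:
  assumes x: "x \<in> U"
  shows "G x (Riem x a b v) v = 0"
proof -
  have dd: "ddG x a b v v = 2 * (G x (Gam x a (Gam x b v)) v + G x (Gam x b v) (Gam x a v) + G x (dGam x a b v) v)" for a b
  proof -
    have d: "((\<lambda>y. 2 * G y (Gam y b v) v) has_derivative (\<lambda>a. 2 * (dG x a (Gam x b v) v + G x (dGam x a b v) v + G x (Gam x b v) 0))) (at x)"
      by (intro has_derivative_mult_right has_derivative_G_compose[where X = "\<lambda>y. y"] UNIV_I x has_derivative_Gam has_derivative_const has_derivative_ident)
    have eq: "dG y b v v = 2 * G y (Gam y b v) v" if "y \<in> U" for y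
      using metric_compatible[OF that, of b v v] sym_G[OF that, of v] by simp
    have "((\<lambda>y. dG y b v v) has_derivative (\<lambda>a. 2 * (dG x a (Gam x b v) v + G x (dGam x a b v) v + G x (Gam x b v) 0))) (at x)"
      by (rule has_derivative_transform_within_open[OF d open_U x]) (simp add: eq)
    then have "ddG x a b v v = 2 * (dG x a (Gam x b v) v + G x (dGam x a b v) v + G x (Gam x b v) 0)"
      unfolding ddG_def by (simp add: frechet_derivative_eqI)
    then show ?thesis by (simp add: metric_compatible[OF x] G_simps x)
  qed
  show ?thesis
    using dd[of a b] dd[of b a] ddG_commute[OF x, of a b v v] sym_G[OF x, of "Gam x b v" "Gam x a v"]
    by (simp add: Riem_def G_simps x)
qed

lemma Riem_linear:
  assumes x: "x \<in> U"
  shows "Riem x (a + a') b v = Riem x a b v + Riem x a' b v" "Riem x a (b + b') v = Riem x a b v + Riem x a b' v"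
    "Riem x a b (v + v') = Riem x a b v + Riem x a b v'"
    "Riem x (r *\<^sub>R a) b v = r *\<^sub>R Riem x a b v" "Riem x a (r *\<^sub>R b) v = r *\<^sub>R Riem x a b v" 
proof -
  have dd: "dGam x (a + a') b v = dGam x a b v + dGam x a' b v" "dGam x (r *\<^sub>R a) b v = r *\<^sub>R dGam x a b v" for a a' b v r
    using linear_add[OF has_derivative_linear[OF has_derivative_Gam[OF x]]]
      linear_cmul[OF has_derivative_linear[OF has_derivative_Gam[OF x]]] by blast+
  show "Riem x (a + a') b v = Riem x a b v + Riem x a' b v" "Riem x a (b + b') v = Riem x a b v + Riem x a b' v"
    "Riem x a b (v + v') = Riem x a b v + Riem x a b v'"
    "Riem x (r *\<^sub>R a) b v = r *\<^sub>R Riem x a b v" "Riem x a (r *\<^sub>R b) v = r *\<^sub>R Riem x a b v"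
    by (simp_all add: Riem_def dd dGam_simps Gam_simps x algebra_simps)
qed

lemma Riem_skew:
  assumes x: "x \<in> U"
  shows "G x (Riem x a b v) w = - G x (Riem x a b w) v"
proof -
  have "G x (Riem x a b (v + w)) (v + w) = 0" by (rule Riem_skew_diag[OF x])
  then show ?thesis
    using Riem_skew_diag[OF x, of a b v] Riem_skew_diag[OF x, of a b w] by (simp add: Riem_linear G_simps x)
qed

lemma constant_sectional_curvature:
  assumes x: "x \<in> U" and sec: "\<And>a b. G x (Riem x a b b) a = \<kappa> * (G x a a * G x b b - (G x a b)\<^sup>2)"
  shows "Riem x a b v = \<kappa> *\<^sub>R (G x b v *\<^sub>R a - G x a v *\<^sub>R b)"
proof -
  define T where "T a b v w = G x (Riem x a b v) w - \<kappa> * (G x b v * G x a w - G x a v * G x b w)" for a b v w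
    \<comment> \<open>an algebraic curvature tensor whose sectional curvatures vanish, hence zero by polarization\<close>
  note lin = G_simps[OF x] Riem_linear[OF x]
  have T_add: "T (a + a') b v w = T a b v w + T a' b v w" "T a (b + b') v w = T a b v w + T a b' v w"
    "T a b (v + v') w = T a b v w + T a b v' w" "T a b v (w + w') = T a b v w + T a b v w'" for a a' b b' v v' w w'
    by (simp_all add: T_def lin algebra_simps)
  have sw1: "T a b v w = - T b a v w" for a b v w
    using Riem_swap[of x a b v] by (simp add: T_def lin algebra_simps)
  have sw2: "T a b v w = - T a b w v" for a b v w
    using Riem_skew[OF x, of a b v w] by (simp add: T_def lin algebra_simps)
  have bia: "T a b v w + T b v a w + T v a b w = 0" for a b v w
  proof -
    have "G x (Riem x a b v) w + G x (Riem x b v a) w + G x (Riem x v a b) w = 0"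
      using Bianchi[OF x, of a b v] by (simp add: lin G_zero[OF x] flip: G_add(1)[OF x])
    then show ?thesis
      using sym_G[OF x, of a b] sym_G[OF x, of b v] sym_G[OF x, of v a] by (simp add: T_def algebra_simps)
  qed
  \<comment> \<open>The classical consequence of four Bianchi identities; the remaining facts only
    normalize their terms by the two skew symmetries.\<close>
  have pair: "T a b v w = T v w a b" for a b v w
    using bia[of a b v w] bia[of b v w a] bia[of v w a b] bia[of w a b v]
      sw1[of a b v w] sw2[of a b v w] sw1[of b v a w] sw2[of b v a w] sw1[of v a b w] sw2[of v a b w]
      sw1[of b v w a] sw2[of b v w a] sw1[of v w b a] sw2[of v w b a] sw1[of w b v a] sw2[of w b v a]
      sw1[of v w a b] sw2[of v w a b] sw1[of w a v b] sw2[of w a v b] sw1[of a v w b] sw2[of a v w b]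
      sw1[of w a b v] sw2[of w a b v] sw1[of a b w v] sw2[of a b w v] sw1[of b w a v] sw2[of b w a v]
    by linarith
  have diag: "T a b b a = 0" for a b
    using sec[of a b] sym_G[OF x, of a b] by (simp add: T_def power2_eq_square algebra_simps)
  have diag2: "T a b v a = 0" for a b v
    using diag[of a "b + v"] diag[of a b] diag[of a v] pair[of a v b a] sw1[of b a a v] sw2[of a b a v]
    by (simp add: T_add)
  \<comment> \<open>Polarizing \<open>diag2\<close> in its outer arguments and using pair symmetry
    shows invariance under cyclic permutation of the last three arguments. The Bianchi identity then
    reads \<open>3 * T a b v w = 0\<close>.\<close>
  have cyc: "T a b v w = T a v w b" for a b v w
    using diag2[of "a + w" b v] diag2[of a b v] diag2[of w b v] pair[of w b v a] sw1[of v a w b]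
    by (simp add: T_add)
  have T0: "T a b v w = 0" for a b v w
  proof -
    have "T b v a w = - T v a b w - T a b v w" using bia[of a b v w] by linarith
    moreover have "T v a b w = - T a v b w" "T a v b w = - T a v w b" by (rule sw1, rule sw2)
    moreover have "T a v w b = T a b v w" using cyc[of a b v w] by simp
    moreover have "T b v a w = - T b v w a" "T b v w a = T b a v w" "T b a v w = - T a b v w"
      by (rule sw2, simp add: cyc[of b a v w], rule sw1)
    ultimately show ?thesis by linarith
  qed
  show ?thesis
  proof (rule G_nondegenerate[OF x])
    fix w show "G x (Riem x a b v) w = G x (\<kappa> *\<^sub>R (G x b v *\<^sub>R a - G x a v *\<^sub>R b)) w"
      using T0[of a b v w] by (simp add: T_def lin)
  qed
qed

end

section \<open>The flat connection of a space form\<close>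

locale coordinate_space_form = coordinate_metric U G
  for U :: "'e::euclidean_space set" and G +
  fixes K :: real
  assumes curvature: "x \<in> U \<Longrightarrow> Riem x a b v = K *\<^sub>R (G x b v *\<^sub>R a - G x a v *\<^sub>R b)"
begin

text \<open>
  The connection \<open>\<nabla>\<^sub>a (v, f) = (\<nabla>\<^sub>a v + K f a, D f a - G v a)\<close> on the sum of the tangent bundle and a
  trivial line bundle is flat exactly when the sectional curvature is \<open>K\<close>. The first components of its
  parallel sections are the gradients of the second.
\<close>

definition parallel_at :: "('e \<Rightarrow> 'e) \<Rightarrow> ('e \<Rightarrow> real) \<Rightarrow> 'e \<Rightarrow> bool"
  where "parallel_at v f x \<longleftrightarrow>
    (v has_derivative (\<lambda>a. - Gam x a (v x) - (K * f x) *\<^sub>R a)) (at x) \<and>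
    (f has_derivative (\<lambda>a. G x (v x) a)) (at x)"

text \<open>The connection with the sign that makes a parallel section \<open>S\<close> a solution
  of the system whose derivative in the direction \<open>a\<close> is \<open>conn x a (S x)\<close>,
  the shape required by \<open>frobenius_linear\<close>.\<close>

definition conn :: "'e \<Rightarrow> 'e \<Rightarrow> 'e \<times> real \<Rightarrow> 'e \<times> real"
  where "conn x a w = (- Gam x a (fst w) - (K * snd w) *\<^sub>R a, G x (fst w) a)"

text \<open>The term with \<open>K\<close> in \<open>conn\<close> does not depend on the base point
  and leaves no trace here.\<close>

definition dconn :: "'e \<Rightarrow> 'e \<Rightarrow> 'e \<Rightarrow> 'e \<times> real \<Rightarrow> 'e \<times> real"
  where "dconn x u a w = (- dGam x u a (fst w), dG x u (fst w) a)"

lemma conn_blinfun: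
  "\<exists>A A'. (\<forall>x\<in>U. (\<forall>a w. blinfun_apply (blinfun_apply (A x) a) w = conn x a w) \<and>
      (\<forall>u a w. blinfun_apply (blinfun_apply (blinfun_apply (A' x) u) a) w = dconn x u a w) \<and>
      (A has_derivative blinfun_apply (A' x)) (at x)) \<and> continuous_on U A'"
proof (rule C1_bilinear_blinfun[where B = conn and B' = dconn])
  show "bilinear (conn x)" if "x \<in> U" for x
    unfolding bilinear_def conn_def
    by (intro conjI allI linearI) (simp_all add: Gam_simps G_simps that algebra_simps)
  show "bilinear (dconn x u)" if "x \<in> U" for x u
    unfolding bilinear_def dconn_def
    by (intro conjI allI linearI)
      (simp_all add: dGam_simps bilinear_ladd[OF bilinear_dG] bilinear_radd[OF bilinear_dG]
        bilinear_lmul[OF bilinear_dG] bilinear_rmul[OF bilinear_dG] that algebra_simps)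
  show "((\<lambda>x. conn x a w) has_derivative (\<lambda>u. dconn x u a w)) (at x)" if "x \<in> U" for x a w
    unfolding conn_def dconn_def
    by (rule derivative_eq_intros has_derivative_Gam has_derivative_G that refl | simp)+
  show "continuous_on U (\<lambda>x. dconn x u a w)" for u a w
    unfolding dconn_def by (intro continuous_intros continuous_on_dGam continuous_on_dG)
qed

text \<open>In the vector component the two sides differ by the curvature tensor minus its space
  form expression, the terms with \<open>f\<close> cancelling by symmetry of \<open>Gam\<close>. In
  the function component the symmetry of \<open>Gam\<close> and \<open>G\<close> suffices.\<close>

lemma conn_flat:
  assumes x: "x \<in> U"
  shows "dconn x a b w + conn x b (conn x a w) = dconn x b a w + conn x a (conn x b w)"
proof -
  obtain v f where w: "w = (v, f)" by (cases w)
  have 1: "dGam x a b v - dGam x b a v + Gam x a (Gam x b v) - Gam x b (Gam x a v)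
      = K *\<^sub>R (G x b v *\<^sub>R a - G x a v *\<^sub>R b)"
    using curvature[OF x, of a b v] by (simp add: Riem_def)
  have 2: "Gam x a b = Gam x b a" by (rule Gam_sym[OF x])
  have "- dGam x a b v - Gam x b (- Gam x a v - (K * f) *\<^sub>R a) - (K * G x v a) *\<^sub>R b
      = - dGam x b a v - Gam x a (- Gam x b v - (K * f) *\<^sub>R b) - (K * G x v b) *\<^sub>R a"
  proof -
    have "(- dGam x a b v - Gam x b (- Gam x a v - (K * f) *\<^sub>R a) - (K * G x v a) *\<^sub>R b)
      - (- dGam x b a v - Gam x a (- Gam x b v - (K * f) *\<^sub>R b) - (K * G x v b) *\<^sub>R a)
      = K *\<^sub>R (G x b v *\<^sub>R a - G x a v *\<^sub>R b) -
        (dGam x a b v - dGam x b a v + Gam x a (Gam x b v) - Gam x b (Gam x a v))"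
      by (simp add: Gam_simps x 2 sym_G[OF x, of v a] sym_G[OF x, of v b] algebra_simps)
    then show ?thesis unfolding 1 by simp
  qed
  moreover have "dG x a v b + G x (- Gam x a v - (K * f) *\<^sub>R a) b = dG x b v a + G x (- Gam x b v - (K * f) *\<^sub>R b) a"
    using 2 sym_G[OF x, of a b] by (simp add: metric_compatible[OF x] G_simps x)
  ultimately show ?thesis by (simp add: w dconn_def conn_def add_diff_eq)
qed

theorem ex_parallel:
  assumes V: "open V" "convex V" "V \<subseteq> U" and x0: "x0 \<in> V"
  shows "\<exists>v f. v x0 = v0 \<and> f x0 = f0 \<and> (\<forall>x\<in>V. parallel_at v f x)"
proof -
  obtain A :: "'e \<Rightarrow> 'e \<Rightarrow>\<^sub>L ('e \<times> real) \<Rightarrow>\<^sub>L ('e \<times> real)"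
    and A' :: "'e \<Rightarrow> 'e \<Rightarrow>\<^sub>L 'e \<Rightarrow>\<^sub>L ('e \<times> real) \<Rightarrow>\<^sub>L ('e \<times> real)" where
    A: "\<forall>x\<in>U. (\<forall>a w. A x a w = conn x a w) \<and> (\<forall>u a w. A' x u a w = dconn x u a w) \<and>
      (A has_derivative A' x) (at x)" "continuous_on U A'"
    using conn_blinfun by (elim exE conjE)
  have "\<exists>S. S x0 = (v0, f0) \<and> (\<forall>x\<in>V. (S has_derivative (\<lambda>a. A x a (S x))) (at x))"
  proof (rule frobenius_linear[OF V(1,2) _ _ _ x0])
    show "(A has_derivative A' x) (at x)" if "x \<in> V" for x using A(1) V(3) that by blast
    show "continuous_on V A'" using A(2) V(3) continuous_on_subset by blast
    show "A' x a b w + A x b (A x a w) = A' x b a w + A x a (A x b w)" if "x \<in> V" for x a b w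
    proof -
      have xU: "x \<in> U" using that V(3) by blast
      have "\<forall>a w. A x a w = conn x a w" "\<forall>u a w. A' x u a w = dconn x u a w" using A(1) xU by blast+
      then show ?thesis using conn_flat[OF xU] by metis
    qed
  qed
  then obtain S where S: "S x0 = (v0, f0)" "\<forall>x\<in>V. (S has_derivative (\<lambda>a. A x a (S x))) (at x)" by blast
  have "parallel_at (fst \<circ> S) (snd \<circ> S) x" if "x \<in> V" for x
  proof -
    have xU: "x \<in> U" using that V(3) by blast
    have "\<forall>a w. A x a w = conn x a w" using A(1) xU by blast
    then have "(\<lambda>a. A x a (S x)) = (\<lambda>a. conn x a (S x))" by presburger
    then have "(S has_derivative (\<lambda>a. conn x a (S x))) (at x)" using S(2) that by metis
    then show ?thesis
      unfolding parallel_at_def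
      by (auto simp: comp_def conn_def dest: has_derivative_fst has_derivative_snd)
  qed
  then show ?thesis using S(1) by (intro exI[of _ "fst \<circ> S"] exI[of _ "snd \<circ> S"]) simp
qed

text \<open>On the segment from \<open>x0\<close> to \<open>x\<close> the difference of the sections
  solves a homogeneous linear equation, and the Gronwall bound applies with inhomogeneity 0.\<close>

theorem parallel_unique:
  assumes V: "convex V" "V \<subseteq> U" and x0: "x0 \<in> V" and x: "x \<in> V"
    and p: "\<And>x. x \<in> V \<Longrightarrow> parallel_at v f x" and p': "\<And>x. x \<in> V \<Longrightarrow> parallel_at v' f' x"
    and eq: "v x0 = v' x0" "f x0 = f' x0"
  shows "v x = v' x \<and> f x = f' x"
proof -
  obtain A :: "'e \<Rightarrow> 'e \<Rightarrow>\<^sub>L ('e \<times> real) \<Rightarrow>\<^sub>L ('e \<times> real)"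
    and A' :: "'e \<Rightarrow> 'e \<Rightarrow>\<^sub>L 'e \<Rightarrow>\<^sub>L ('e \<times> real) \<Rightarrow>\<^sub>L ('e \<times> real)" where
    A: "\<forall>x\<in>U. (\<forall>a w. A x a w = conn x a w) \<and> (\<forall>u a w. A' x u a w = dconn x u a w) \<and>
      (A has_derivative A' x) (at x)" "continuous_on U A'"
    using conn_blinfun by (elim exE conjE)
  have Ac: "continuous_on U A"
    using A(1) by (meson continuous_at_imp_continuous_on has_derivative_continuous)
  define h where "h = x - x0"
  let ?p = "\<lambda>t. x0 + t *\<^sub>R h"
  have seg: "?p t \<in> V" if "t \<in> {0..1}" for t
  proof -
    have "?p t = (1 - t) *\<^sub>R x0 + t *\<^sub>R x" by (simp add: h_def algebra_simps)
    then show ?thesis using V(1) x0 x that by (simp add: convex_alt)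
  qed
  define D where "D x = (v x - v' x, f x - f' x)" for x
  have dD: "(D has_derivative (\<lambda>a. A x a (D x))) (at x)" if "x \<in> V" for x
  proof -
    have xU: "x \<in> U" using that V by auto
    have "(D has_derivative (\<lambda>a. ((- Gam x a (v x) - (K * f x) *\<^sub>R a) - (- Gam x a (v' x) - (K * f' x) *\<^sub>R a),
        G x (v x) a - G x (v' x) a))) (at x)"
      unfolding D_def using p[OF that] p'[OF that] unfolding parallel_at_def
      by (intro has_derivative_Pair has_derivative_diff) auto
    moreover have "A x a (D x) = ((- Gam x a (v x) - (K * f x) *\<^sub>R a) - (- Gam x a (v' x) - (K * f' x) *\<^sub>R a),
        G x (v x) a - G x (v' x) a)" for a
      using A(1) xU by (simp add: conn_def D_def Gam_simps G_simps algebra_simps)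
    ultimately show ?thesis by simp
  qed
  have "continuous_on {0..1} (\<lambda>t. A (?p t))"
    by (rule continuous_on_compose2[OF Ac]) (use seg V in \<open>auto intro!: continuous_intros\<close>)
  then have "bounded ((\<lambda>t. A (?p t)) ` {0..1})" by (intro compact_imp_bounded compact_continuous_image compact_Icc)
  then obtain C where C: "C > 0" "\<forall>t\<in>{0..1}. norm (A (?p t)) \<le> C" unfolding bounded_pos by auto
  have "norm (D (?p 1)) \<le> 0 * exp (C * norm h + 1)"
  proof (rule gronwall_unit_interval)
    fix t :: real assume t: "t \<in> {0..1}"
    have "((\<lambda>t. D (?p t)) has_derivative (\<lambda>u. A (?p t) (u *\<^sub>R h) (D (?p t)))) (at t within {0..1})"
      by (rule has_derivative_compose[where f = ?p, OF _ dD[OF seg[OF t]]]) (auto intro!: derivative_eq_intros)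
    then show "((\<lambda>t. D (?p t)) has_vector_derivative A (?p t) h (D (?p t))) (at t within {0..1})"
      by (simp add: has_vector_derivative_def blinfun.scaleR_right blinfun.scaleR_left)
    have "norm (A (?p t) h (D (?p t))) \<le> norm (A (?p t)) * norm h * norm (D (?p t))" by (rule norm_blinfun2)
    also have "\<dots> \<le> C * norm h * norm (D (?p t))" using C t by (intro mult_right_mono) auto
    finally show "norm (A (?p t) h (D (?p t))) \<le> C * norm h * norm (D (?p t)) + 0" by simp
  qed (use C eq in \<open>auto simp: D_def zero_prod_def\<close>)
  then show ?thesis by (simp add: D_def h_def zero_prod_def)
qed

text \<open>The connection is metric for the fibre form \<open>G x v v' + K * (f * f')\<close>. For
  negative \<open>K\<close> this form is Lorentzian, as in the hyperboloid model.\<close>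

lemma parallel_conserved:
  assumes x: "x \<in> U" and p: "parallel_at v f x" and p': "parallel_at v' f' x"
  shows "((\<lambda>x. G x (v x) (v' x) + K * (f x * f' x)) has_derivative (\<lambda>_. 0)) (at x)"
proof -
  note d = p[unfolded parallel_at_def] p'[unfolded parallel_at_def]
  have "((\<lambda>y. G y (v y) (v' y)) has_derivative (\<lambda>a. dG x a (v x) (v' x) +
      G x (- Gam x a (v x) - (K * f x) *\<^sub>R a) (v' x) + G x (v x) (- Gam x a (v' x) - (K * f' x) *\<^sub>R a))) (at x)"
    using d by (intro has_derivative_G_compose[where X = "\<lambda>y. y"] UNIV_I x has_derivative_ident) auto
  moreover have "((\<lambda>x. K * (f x * f' x)) has_derivative (\<lambda>a. K * (f x * G x (v' x) a + G x (v x) a * f' x))) (at x)"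
    using d by (intro has_derivative_mult_right has_derivative_mult) auto
  ultimately have "((\<lambda>x. G x (v x) (v' x) + K * (f x * f' x)) has_derivative (\<lambda>a. dG x a (v x) (v' x) +
      G x (- Gam x a (v x) - (K * f x) *\<^sub>R a) (v' x) + G x (v x) (- Gam x a (v' x) - (K * f' x) *\<^sub>R a)
      + K * (f x * G x (v' x) a + G x (v x) a * f' x))) (at x)"
    by (rule has_derivative_add)
  then show ?thesis
    by (rule has_derivative_eq_rhs)
      (simp add: fun_eq_iff metric_compatible[OF x] G_simps x sym_G[OF x, of _ "v' x"] algebra_simps)
qed

end

section \<open>Charts, tangent vectors and geodesics\<close>

lemma smooth_on_second_derivative_linear:
  fixes f :: "'a::euclidean_space \<Rightarrow> 'b::real_normed_vector"
  assumes f: "smooth_on S f" and S: "open S" "x \<in> S"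
  shows "linear (\<lambda>b. frechet_derivative (\<lambda>y. frechet_derivative f (at y) b) (at x) a)"
proof -
  have eqI: "frechet_derivative (\<lambda>y. frechet_derivative f (at y) b) (at x) a = h' a"
    if "\<And>y. y \<in> S \<Longrightarrow> frechet_derivative f (at y) b = h y" "(h has_derivative h') (at x)" for b h h'
  proof -
    have "((\<lambda>y. frechet_derivative f (at y) b) has_derivative h') (at x)"
      by (rule has_derivative_transform_within_open[OF that(2) S]) (simp add: that)
    then show ?thesis by (simp add: frechet_derivative_eqI)
  qed
  have l: "linear (frechet_derivative f (at y))" if "y \<in> S" for y
    by (rule has_derivative_linear[OF smooth_on_has_derivative[OF f that]])
  note d = smooth_on_has_derivative[OF smooth_on_directional[OF f] S(2)]
  show ?thesis
  proof (rule linearI)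
    fix b c :: 'a and r :: real
    show "frechet_derivative (\<lambda>y. frechet_derivative f (at y) (b + c)) (at x) a
      = frechet_derivative (\<lambda>y. frechet_derivative f (at y) b) (at x) a
        + frechet_derivative (\<lambda>y. frechet_derivative f (at y) c) (at x) a"
      by (rule eqI[OF linear_add[OF l]]) (auto intro!: derivative_eq_intros d)
    show "frechet_derivative (\<lambda>y. frechet_derivative f (at y) (r *\<^sub>R b)) (at x) a
      = r *\<^sub>R frechet_derivative (\<lambda>y. frechet_derivative f (at y) b) (at x) a"
      by (rule eqI[OF linear_cmul[OF l]]) (auto intro!: derivative_eq_intros d)
  qed
qed

text \<open>The chain rule for a Jacobian applied to a moving vector. Smoothness controls the
  Jacobian one fixed direction at a time, so the vector is expanded in a basis before
  differentiating.\<close>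

lemma has_derivative_frechet_derivative_compose:
  fixes f :: "'a::euclidean_space \<Rightarrow> 'b::real_normed_vector"
  assumes f: "smooth_on S f" and S: "open S" "X s \<in> S" and s: "s \<in> T"
    and X: "(X has_derivative X') (at s within T)" and w: "(w has_derivative w') (at s within T)"
  shows "((\<lambda>s. frechet_derivative f (at (X s)) (w s)) has_derivative
    (\<lambda>h. frechet_derivative (\<lambda>y. frechet_derivative f (at y) (w s)) (at (X s)) (X' h)
      + frechet_derivative f (at (X s)) (w' h))) (at s within T)"
proof -
  let ?D = "\<lambda>y. frechet_derivative f (at y)"
  let ?DD = "\<lambda>b. frechet_derivative (\<lambda>y. frechet_derivative f (at y) b) (at (X s))"
  have l: "linear (?D y)" if "y \<in> S" for y
    by (rule has_derivative_linear[OF smooth_on_has_derivative[OF f that]])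
  have expand: "F v = (\<Sum>i\<in>Basis. (v \<bullet> i) *\<^sub>R F i)" if "linear F" for F :: "'a \<Rightarrow> 'b" and v
    using linear_sum[OF that, of "\<lambda>i. (v \<bullet> i) *\<^sub>R i" Basis] linear_cmul[OF that]
    by (simp add: euclidean_representation)
  have d: "((\<lambda>s. ?D (X s) i) has_derivative (\<lambda>h. ?DD i (X' h))) (at s within T)" for i
    by (rule has_derivative_compose[OF X smooth_on_has_derivative[OF smooth_on_directional[OF f] S(2)]])
  have "((\<lambda>s. \<Sum>i\<in>Basis. (w s \<bullet> i) *\<^sub>R ?D (X s) i) has_derivative
      (\<lambda>h. \<Sum>i\<in>Basis. (w s \<bullet> i) *\<^sub>R ?DD i (X' h) + (w' h \<bullet> i) *\<^sub>R ?D (X s) i)) (at s within T)"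
    by (intro has_derivative_sum has_derivative_scaleR has_derivative_inner_left w d)
  then have 1: "((\<lambda>s. \<Sum>i\<in>Basis. (w s \<bullet> i) *\<^sub>R ?D (X s) i) has_derivative
      (\<lambda>h. ?DD (w s) (X' h) + ?D (X s) (w' h))) (at s within T)"
    by (rule has_derivative_eq_rhs)
      (simp add: fun_eq_iff sum.distrib flip: expand[OF l[OF S(2)]]
        expand[OF smooth_on_second_derivative_linear[OF f S]])
  have "\<forall>\<^sub>F t in at s within T. X t \<in> S"
    using has_derivative_continuous[OF X] S unfolding continuous_within by (rule topological_tendstoD)
  then have "\<forall>\<^sub>F t in at s within T. (\<Sum>i\<in>Basis. (w t \<bullet> i) *\<^sub>R ?D (X t) i) = ?D (X t) (w t)"
    by eventually_elim (simp flip: expand[OF l])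
  then show ?thesis
    by (rule has_derivative_transform_eventually[OF 1]) (simp_all add: s flip: expand[OF l[OF S(2)]])
qed

text \<open>Completeness enters already at this level because the transformation law of the
  Christoffel symbols is extracted from geodesics with prescribed initial velocity.\<close>

locale smooth_riemannian =
  fixes A :: "('m::{t2_space,second_countable_topology}, 'e::euclidean_space) chart set"
    and g :: "('m, 'e) metric"
  assumes riemannian: "riemannian_manifold A g"
    and complete: "geodesically_complete A g"
begin

section \<open>Charts and transition maps\<close>

definition img :: "('m, 'e) chart \<Rightarrow> 'e set"
  where "img c = cmap c ` cdom c"

lemma atlas: "smooth_atlas A"
  using riemannian by (simp add: riemannian_manifold_def)

lemma chart: "c \<in> A \<Longrightarrow> is_chart c"
  using atlas by (simp add: smooth_atlas_def)

lemma open_cdom: "c \<in> A \<Longrightarrow> open (cdom c)" and open_img: "c \<in> A \<Longrightarrow> open (img c)"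
  using chart by (auto simp: is_chart_def img_def)

lemma chart_homeomorphism: "c \<in> A \<Longrightarrow> homeomorphism (cdom c) (img c) (cmap c) (cinv c)"
  using chart by (simp add: is_chart_def img_def)

lemma cinv_cmap: "c \<in> A \<Longrightarrow> p \<in> cdom c \<Longrightarrow> cinv c (cmap c p) = p"
  and cmap_cinv: "c \<in> A \<Longrightarrow> x \<in> img c \<Longrightarrow> cmap c (cinv c x) = x"
  and cmap_img: "c \<in> A \<Longrightarrow> p \<in> cdom c \<Longrightarrow> cmap c p \<in> img c"
  and cinv_cdom: "c \<in> A \<Longrightarrow> x \<in> img c \<Longrightarrow> cinv c x \<in> cdom c"
  and continuous_on_cmap: "c \<in> A \<Longrightarrow> continuous_on (cdom c) (cmap c)"
  and continuous_on_cinv: "c \<in> A \<Longrightarrow> continuous_on (img c) (cinv c)"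
  using chart_homeomorphism[of c] by (auto simp: homeomorphism_def)

lemma ex_chart: "\<exists>c\<in>A. p \<in> cdom c"
  using atlas by (auto simp: smooth_atlas_def)

lemma isCont_cmap: "c \<in> A \<Longrightarrow> p \<in> cdom c \<Longrightarrow> continuous (at p) (cmap c)"
  using continuous_on_cmap open_cdom continuous_on_eq_continuous_at by blast

lemma open_cinv_preimage: "c \<in> A \<Longrightarrow> open W \<Longrightarrow> open (img c \<inter> cinv c -` W)"
  using continuous_on_open_vimage[OF open_img, THEN iffD1, OF _ continuous_on_cinv, rule_format, of c W]
  by (simp add: Int_commute)

lemma open_cinv_image:
  assumes c: "c \<in> A" and X: "open X" "X \<subseteq> img c"
  shows "open (cinv c ` X)"
proof -
  have "cinv c ` X = cdom c \<inter> cmap c -` X"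
  proof (intro set_eqI iffI)
    fix q assume "q \<in> cinv c ` X"
    then obtain x where "x \<in> X" "q = cinv c x" by blast
    then show "q \<in> cdom c \<inter> cmap c -` X" using X(2) cinv_cdom[OF c] cmap_cinv[OF c] by auto
  next
    fix q assume "q \<in> cdom c \<inter> cmap c -` X"
    then show "q \<in> cinv c ` X" using cinv_cmap[OF c, of q] by (intro image_eqI[of _ _ "cmap c q"]) auto
  qed
  then show ?thesis
    using continuous_on_open_vimage[OF open_cdom[OF c], THEN iffD1, OF continuous_on_cmap[OF c], rule_format, OF X(1)]
    by (simp add: Int_commute)
qed

definition trans_dom :: "('m, 'e) chart \<Rightarrow> ('m, 'e) chart \<Rightarrow> 'e set"
  where "trans_dom c d = cmap c ` (cdom c \<inter> cdom d)"

lemma trans_dom_iff: "c \<in> A \<Longrightarrow> x \<in> trans_dom c d \<longleftrightarrow> x \<in> img c \<and> cinv c x \<in> cdom d"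
  unfolding trans_dom_def img_def using cinv_cmap[of c] by auto

lemma open_trans_dom: "c \<in> A \<Longrightarrow> d \<in> A \<Longrightarrow> open (trans_dom c d)"
proof -
  assume c: "c \<in> A" and d: "d \<in> A"
  have "trans_dom c d = img c \<inter> cinv c -` cdom d"
    by (intro set_eqI) (simp only: trans_dom_iff[OF c] Int_iff vimage_eq)
  then show ?thesis using open_cinv_preimage[OF c open_cdom[OF d]] by simp
qed

definition tr :: "('m, 'e) chart \<Rightarrow> ('m, 'e) chart \<Rightarrow> 'e \<Rightarrow> 'e"
  where "tr c d = cmap d \<circ> cinv c"

lemma smooth_tr: "c \<in> A \<Longrightarrow> d \<in> A \<Longrightarrow> smooth_on (trans_dom c d) (tr c d)"
  using atlas by (simp add: smooth_atlas_def trans_dom_def tr_def)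

lemma cmap_trans_dom: "c \<in> A \<Longrightarrow> p \<in> cdom c \<Longrightarrow> p \<in> cdom d \<Longrightarrow> cmap c p \<in> trans_dom c d"
  by (simp add: trans_dom_def)

lemma tr_cmap: "c \<in> A \<Longrightarrow> p \<in> cdom c \<Longrightarrow> tr c d (cmap c p) = cmap d p"
  by (simp add: tr_def cinv_cmap)

lemma cinv_tr: "c \<in> A \<Longrightarrow> d \<in> A \<Longrightarrow> x \<in> trans_dom c d \<Longrightarrow> cinv d (tr c d x) = cinv c x"
  by (simp add: trans_dom_iff tr_def cinv_cmap)

lemma tr_has_derivative:
  assumes "c \<in> A" "d \<in> A" "p \<in> cdom c" "p \<in> cdom d"
  shows "(tr c d has_derivative chart_change c d p) (at (cmap c p))"
  unfolding chart_change_def tr_def[symmetric]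
  by (rule smooth_on_has_derivative[OF smooth_tr cmap_trans_dom]) (use assms in auto)

lemma linear_chart_change:
  "c \<in> A \<Longrightarrow> d \<in> A \<Longrightarrow> p \<in> cdom c \<Longrightarrow> p \<in> cdom d \<Longrightarrow> linear (chart_change c d p)"
  using tr_has_derivative has_derivative_linear by blast

lemma chart_change_trans:
  assumes "c \<in> A" "d \<in> A" "e \<in> A" "p \<in> cdom c" "p \<in> cdom d" "p \<in> cdom e"
  shows "chart_change d e p (chart_change c d p a) = chart_change c e p a"
proof -
  have 1: "(tr d e has_derivative chart_change d e p) (at (tr c d (cmap c p)))"
    using tr_has_derivative[of d e p] assms by (simp add: tr_cmap)
  have 2: "((\<lambda>x. tr d e (tr c d x)) has_derivative (\<lambda>a. chart_change d e p (chart_change c d p a))) (at (cmap c p))"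
    by (rule has_derivative_compose[where f = "tr c d", OF tr_has_derivative 1]) (use assms in auto)
  have 3: "open (trans_dom c d)" "cmap c p \<in> trans_dom c d"
    using assms by (auto intro: open_trans_dom cmap_trans_dom)
  have 4: "tr d e (tr c d x) = tr c e x" if "x \<in> trans_dom c d" for x
    using that assms by (simp add: tr_def trans_dom_iff cinv_cmap)
  have 5: "(tr c e has_derivative (\<lambda>a. chart_change d e p (chart_change c d p a))) (at (cmap c p))"
    by (rule has_derivative_transform_within_open[OF 2 3 4])
  have "chart_change c e p = (\<lambda>a. chart_change d e p (chart_change c d p a))"
    by (rule has_derivative_unique[OF tr_has_derivative 5]) (use assms in auto)
  then show ?thesis by simp
qed

lemma chart_change_self: "c \<in> A \<Longrightarrow> p \<in> cdom c \<Longrightarrow> chart_change c c p a = a"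
proof -
  assume c: "c \<in> A" "p \<in> cdom c"
  have 1: "(tr c c has_derivative (\<lambda>x. x)) (at (cmap c p))"
    by (rule has_derivative_transform_within_open[OF has_derivative_ident open_img[OF c(1)] cmap_img[OF c]])
      (simp add: tr_def cmap_cinv c)
  have "chart_change c c p = (\<lambda>x. x)"
    by (rule has_derivative_unique[OF tr_has_derivative 1]) (use c in auto)
  then show ?thesis by simp
qed

lemma chart_change_inverse:
  "c \<in> A \<Longrightarrow> d \<in> A \<Longrightarrow> p \<in> cdom c \<Longrightarrow> p \<in> cdom d \<Longrightarrow> chart_change d c p (chart_change c d p a) = a"
  by (simp add: chart_change_trans chart_change_self)

section \<open>Tangent vectors and the metric in charts\<close>

lemma tangent_change:
  "u \<in> tangent_space A p \<Longrightarrow> c \<in> A \<Longrightarrow> d \<in> A \<Longrightarrow> p \<in> cdom c \<Longrightarrow> p \<in> cdom d \<Longrightarrow> u d = chart_change c d p (u c)"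
  unfolding tangent_space_def by blast

lemma coord_vec_tangent: "c \<in> A \<Longrightarrow> p \<in> cdom c \<Longrightarrow> coord_vec A c p a \<in> tangent_space A p"
  unfolding tangent_space_def coord_vec_def by (auto simp: chart_change_trans)

lemma coord_vec_self: "c \<in> A \<Longrightarrow> p \<in> cdom c \<Longrightarrow> coord_vec A c p a c = a"
  by (simp add: coord_vec_def chart_change_self)

lemma coord_vec_tangent_eq: "u \<in> tangent_space A p \<Longrightarrow> c \<in> A \<Longrightarrow> p \<in> cdom c \<Longrightarrow> coord_vec A c p (u c) = u"
proof (rule ext)
  fix d assume u: "u \<in> tangent_space A p" and c: "c \<in> A" "p \<in> cdom c"
  show "coord_vec A c p (u c) d = u d"
  proof (cases "d \<in> A \<and> p \<in> cdom d")
    case True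
    then show ?thesis using tangent_change[OF u c(1) _ c(2), of d] by (simp add: coord_vec_def)
  next
    case False
    moreover have "u d = 0" using u False unfolding tangent_space_def by blast
    ultimately show ?thesis by (simp only: coord_vec_def if_False)
  qed
qed

lemma tangent_eqI:
  "u \<in> tangent_space A p \<Longrightarrow> v \<in> tangent_space A p \<Longrightarrow> c \<in> A \<Longrightarrow> p \<in> cdom c \<Longrightarrow> u c = v c \<Longrightarrow> u = v"
  using coord_vec_tangent_eq by metis

abbreviation G :: "('m, 'e) chart \<Rightarrow> 'e \<Rightarrow> 'e \<Rightarrow> 'e \<Rightarrow> real"
  where "G c \<equiv> coord_metric A g c"

lemma coordinate_metric: "c \<in> A \<Longrightarrow> coordinate_metric (img c) (G c)"
  using riemannian open_img[of c]
  unfolding riemannian_manifold_def coordinate_metric_def img_def by auto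

lemma g_coords:
  "u \<in> tangent_space A p \<Longrightarrow> v \<in> tangent_space A p \<Longrightarrow> c \<in> A \<Longrightarrow> p \<in> cdom c \<Longrightarrow>
    g p u v = G c (cmap c p) (u c) (v c)"
  by (simp add: coord_metric_def cinv_cmap coord_vec_tangent_eq)

lemma G_chart_change:
  assumes "c \<in> A" "d \<in> A" "p \<in> cdom c" "p \<in> cdom d"
  shows "G d (cmap d p) (chart_change c d p a) (chart_change c d p b) = G c (cmap c p) a b"
proof -
  have gc: "g p (coord_vec A c p a) (coord_vec A c p b) = G e (cmap e p) (coord_vec A c p a e) (coord_vec A c p b e)"
    if "e \<in> A" "p \<in> cdom e" for e
    by (rule g_coords[OF coord_vec_tangent coord_vec_tangent]) (use assms that in auto)
  have d: "coord_vec A c p a d = chart_change c d p a" for a using assms by (simp add: coord_vec_def)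
  show ?thesis
    using gc[OF assms(1,3)] gc[OF assms(2,4)] by (simp add: coord_vec_self[OF assms(1,3)] d)
qed

lemma christoffel_Gam: "c \<in> A \<Longrightarrow> christoffel A g c = coordinate_metric.Gam (G c)"
  using coordinate_metric[of c]
  by (intro ext) (simp add: christoffel_def coordinate_metric.Gam_def coordinate_metric.dG_def)

lemma curvature_Riem: "c \<in> A \<Longrightarrow> curvature_tensor A g c = coordinate_metric.Riem (G c)"
  using coordinate_metric[of c]
  by (intro ext) (simp add: curvature_tensor_def coordinate_metric.Riem_def coordinate_metric.dGam_def christoffel_Gam)

abbreviation \<Gamma> :: "('m, 'e) chart \<Rightarrow> 'e \<Rightarrow> 'e \<Rightarrow> 'e \<Rightarrow> 'e"
  where "\<Gamma> c \<equiv> coordinate_metric.Gam (G c)"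

text \<open>The second derivative of the transition map, which is the inhomogeneous term in the
  transformation law of the Christoffel symbols.\<close>

definition ddtr :: "('m, 'e) chart \<Rightarrow> ('m, 'e) chart \<Rightarrow> 'e \<Rightarrow> 'e \<Rightarrow> 'e \<Rightarrow> 'e"
  where "ddtr c d x a b = frechet_derivative (\<lambda>y. frechet_derivative (tr c d) (at y) b) (at x) a"

lemma chart_change_tr: "chart_change c d p = frechet_derivative (tr c d) (at (cmap c p))"
  by (simp add: chart_change_def tr_def)

lemma ddtr_sym:
  assumes "c \<in> A" "d \<in> A" "x \<in> trans_dom c d"
  shows "ddtr c d x a b = ddtr c d x b a"
  unfolding ddtr_def by (rule smooth_on_second_derivative_commute[OF open_trans_dom _ smooth_tr]) (use assms in auto)

lemma bilinear_ddtr: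
  assumes "c \<in> A" "d \<in> A" "x \<in> trans_dom c d"
  shows "bilinear (ddtr c d x)"
proof -
  have "linear (ddtr c d x a)" for a
    unfolding ddtr_def
    by (rule smooth_on_second_derivative_linear[OF smooth_tr open_trans_dom]) (use assms in auto)
  moreover have "ddtr c d x b = (\<lambda>a. ddtr c d x a b)" for b by (rule ext) (rule ddtr_sym[OF assms])
  ultimately show ?thesis unfolding bilinear_def by metis
qed

text \<open>The geodesic equation is stated for \<open>vector_derivative\<close>. The component of
  \<open>velocity\<close> agrees with it as long as the curve stays in the chart, which is an open
  set of times, so the second derivative carries over.\<close>

lemma geodesic_velocity:
  assumes \<gamma>: "geodesic A g \<gamma>" and c: "c \<in> A" "\<gamma> t \<in> cdom c"
  shows "((cmap c \<circ> \<gamma>) has_vector_derivative velocity A \<gamma> t c) (at t)"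
    and "((\<lambda>s. velocity A \<gamma> s c) has_vector_derivative
      - \<Gamma> c (cmap c (\<gamma> t)) (velocity A \<gamma> t c) (velocity A \<gamma> t c)) (at t)"
proof -
  have v: "velocity A \<gamma> s c = vector_derivative (cmap c \<circ> \<gamma>) (at s)" if "\<gamma> s \<in> cdom c" for s
    using that c by (simp add: velocity_def)
  have d: "(cmap c \<circ> \<gamma>) differentiable (at t)"
    "((\<lambda>s. vector_derivative (cmap c \<circ> \<gamma>) (at s)) has_vector_derivative
          - christoffel A g c (cmap c (\<gamma> t))
              (vector_derivative (cmap c \<circ> \<gamma>) (at t))
              (vector_derivative (cmap c \<circ> \<gamma>) (at t))) (at t)"
    using \<gamma> c unfolding geodesic_def by blast+
  show "((cmap c \<circ> \<gamma>) has_vector_derivative velocity A \<gamma> t c) (at t)"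
    unfolding v[OF c(2)] using d(1) by (simp add: vector_derivative_works)
  have "continuous_on UNIV \<gamma>" using \<gamma> by (simp add: geodesic_def)
  then have o: "open (\<gamma> -` cdom c)" by (rule open_vimage[OF open_cdom[OF c(1)]])
  show "((\<lambda>s. velocity A \<gamma> s c) has_vector_derivative
      - \<Gamma> c (cmap c (\<gamma> t)) (velocity A \<gamma> t c) (velocity A \<gamma> t c)) (at t)"
    unfolding v[OF c(2)] christoffel_Gam[OF c(1), symmetric]
    by (rule has_vector_derivative_transform_within_open[OF d(2) o]) (use c v in auto)
qed

lemma geodesic_continuous: "geodesic A g \<gamma> \<Longrightarrow> continuous_on UNIV \<gamma>"
  by (simp add: geodesic_def)

lemma velocity_tangent:
  assumes \<gamma>: "geodesic A g \<gamma>"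
  shows "velocity A \<gamma> t \<in> tangent_space A (\<gamma> t)"
proof -
  have "velocity A \<gamma> t d = chart_change c d (\<gamma> t) (velocity A \<gamma> t c)"
    if c: "c \<in> A" "\<gamma> t \<in> cdom c" and d: "d \<in> A" "\<gamma> t \<in> cdom d" for c d
  proof -
    have o: "open (\<gamma> -` cdom c)" by (rule open_vimage[OF open_cdom[OF c(1)] geodesic_continuous[OF \<gamma>]])
    have "(tr c d has_derivative chart_change c d (\<gamma> t)) (at ((cmap c \<circ> \<gamma>) t))"
      using tr_has_derivative[OF c(1) d(1) c(2) d(2)] by simp
    from has_derivative_compose[OF geodesic_velocity(1)[OF \<gamma> c, unfolded has_vector_derivative_def] this]
    have "((\<lambda>s. tr c d ((cmap c \<circ> \<gamma>) s)) has_vector_derivative chart_change c d (\<gamma> t) (velocity A \<gamma> t c)) (at t)"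
      unfolding has_vector_derivative_def using linear_cmul[OF linear_chart_change[OF c(1) d(1) c(2) d(2)]] by simp
    then have "((cmap d \<circ> \<gamma>) has_vector_derivative chart_change c d (\<gamma> t) (velocity A \<gamma> t c)) (at t)"
      by (rule has_vector_derivative_transform_within_open[OF _ o]) (use c in \<open>auto simp: tr_cmap\<close>)
    then show ?thesis by (rule vector_derivative_unique_at[OF geodesic_velocity(1)[OF \<gamma> d]])
  qed
  moreover have "velocity A \<gamma> t c = 0" if "c \<notin> A \<or> \<gamma> t \<notin> cdom c" for c
    using that by (auto simp: velocity_def)
  ultimately show ?thesis unfolding tangent_space_def by blast
qed

lemma ex_geodesic:
  assumes "u \<in> tangent_space A p"
  shows "\<exists>\<gamma>. geodesic A g \<gamma> \<and> \<gamma> 0 = p \<and> velocity A \<gamma> 0 = u"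
  using complete assms by (auto simp: geodesically_complete_def)

text \<open>
  The transformation law of the Christoffel symbols is read off from a geodesic in each direction,
  which satisfies the geodesic equation in both charts.
\<close>

lemma christoffel_transform_diag:
  assumes c: "c \<in> A" "p \<in> cdom c" and d: "d \<in> A" "p \<in> cdom d"
  shows "\<Gamma> d (cmap d p) (chart_change c d p a) (chart_change c d p a)
    = chart_change c d p (\<Gamma> c (cmap c p) a a) - ddtr c d (cmap c p) a a"
proof -
  obtain \<gamma> where \<gamma>: "geodesic A g \<gamma>" "\<gamma> 0 = p" "velocity A \<gamma> 0 = coord_vec A c p a"
    using ex_geodesic[OF coord_vec_tangent[OF c]] by blast
  have va: "velocity A \<gamma> 0 c = a" "velocity A \<gamma> 0 d = chart_change c d p a"
    using c d by (auto simp: \<gamma>(3) coord_vec_self) (simp add: coord_vec_def)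
  define S where "S = \<gamma> -` cdom c \<inter> \<gamma> -` cdom d"
  have S: "open S" "0 \<in> S"
    unfolding S_def using c d \<gamma>
    by (auto intro!: open_Int open_vimage open_cdom geodesic_continuous)
  have Dd: "velocity A \<gamma> s d = frechet_derivative (tr c d) (at ((cmap c \<circ> \<gamma>) s)) (velocity A \<gamma> s c)" if "s \<in> S" for s
    using tangent_change[OF velocity_tangent[OF \<gamma>(1), of s] c(1) d(1)] that by (simp add: S_def chart_change_tr)
  have x: "(cmap c \<circ> \<gamma>) 0 \<in> trans_dom c d" using c d \<gamma> by (simp add: cmap_trans_dom)
  have "((\<lambda>s. frechet_derivative (tr c d) (at ((cmap c \<circ> \<gamma>) s)) (velocity A \<gamma> s c)) has_derivative
    (\<lambda>h. frechet_derivative (\<lambda>y. frechet_derivative (tr c d) (at y) (velocity A \<gamma> 0 c)) (at ((cmap c \<circ> \<gamma>) 0)) (h *\<^sub>R velocity A \<gamma> 0 c)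
      + frechet_derivative (tr c d) (at ((cmap c \<circ> \<gamma>) 0))
       (h *\<^sub>R - \<Gamma> c (cmap c (\<gamma> 0)) (velocity A \<gamma> 0 c) (velocity A \<gamma> 0 c)))) (at 0)"
    by (rule has_derivative_frechet_derivative_compose[OF smooth_tr[OF c(1) d(1)] open_trans_dom[OF c(1) d(1)] x UNIV_I
        geodesic_velocity[OF \<gamma>(1) c(1), unfolded has_vector_derivative_def]]) (use \<gamma> c in auto)
  then have "((\<lambda>s. frechet_derivative (tr c d) (at ((cmap c \<circ> \<gamma>) s)) (velocity A \<gamma> s c)) has_derivative
    (\<lambda>h. h *\<^sub>R (ddtr c d (cmap c p) a a - chart_change c d p (\<Gamma> c (cmap c p) a a)))) (at 0)"
  proof (rule has_derivative_eq_rhs)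
    have "linear (\<lambda>a. ddtr c d (cmap c p) a b)" for b
      using bilinear_ddtr[OF c(1) d(1)] x \<gamma>(2) by (simp add: bilinear_def)
    note l1 = linear_cmul[OF this]
    note l2 = linear_cmul[OF linear_chart_change[OF c(1) d(1) c(2) d(2)]]
      linear_neg[OF linear_chart_change[OF c(1) d(1) c(2) d(2)]]
    show "(\<lambda>h. frechet_derivative (\<lambda>y. frechet_derivative (tr c d) (at y) (velocity A \<gamma> 0 c)) (at ((cmap c \<circ> \<gamma>) 0)) (h *\<^sub>R velocity A \<gamma> 0 c)
      + frechet_derivative (tr c d) (at ((cmap c \<circ> \<gamma>) 0))
       (h *\<^sub>R - \<Gamma> c (cmap c (\<gamma> 0)) (velocity A \<gamma> 0 c) (velocity A \<gamma> 0 c))) =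
      (\<lambda>h. h *\<^sub>R (ddtr c d (cmap c p) a a - chart_change c d p (\<Gamma> c (cmap c p) a a)))"
      by (rule ext) (simp only: va comp_def \<gamma>(2) ddtr_def[symmetric] chart_change_tr[symmetric] l1 l2 scaleR_right_diff_distrib scaleR_minus_right add_uminus_conv_diff)
  qed
  then have "((\<lambda>s. velocity A \<gamma> s d) has_vector_derivative
      (ddtr c d (cmap c p) a a - chart_change c d p (\<Gamma> c (cmap c p) a a))) (at 0)"
    unfolding has_vector_derivative_def
    by (rule has_derivative_transform_within_open[OF _ S]) (simp add: Dd)
  then have "- \<Gamma> d (cmap d p) (chart_change c d p a) (chart_change c d p a) = ddtr c d (cmap c p) a a - chart_change c d p (\<Gamma> c (cmap c p) a a)"
    using vector_derivative_unique_at[OF geodesic_velocity(2)[OF \<gamma>(1) d(1)]] \<gamma>(2) d(2) va by metis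
  then show ?thesis by (metis minus_diff_eq minus_minus)
qed

lemma bilinear_symmetric_zero:
  fixes B :: "'a::real_vector \<Rightarrow> 'a \<Rightarrow> 'b::real_vector"
  assumes "\<And>a b. B a b = B b a" "\<And>a b c. B (a + b) c = B a c + B b c" "\<And>a. B a a = 0"
  shows "B a b = 0"
proof -
  have "B (a + b) (a + b) = B a b + B a b"
    using assms(2)[of a b "a + b"] assms(1)[of a "a + b"] assms(1)[of b "a + b"]
      assms(2)[of a b a] assms(2)[of a b b] assms(1)[of b a] assms(3) by simp
  then show ?thesis using assms(3)[of "a + b"] by (simp add: scaleR_2[symmetric])
qed

text \<open>Both sides are symmetric and bilinear in the two vectors, so the diagonal case
  determines them by polarization.\<close>

lemma christoffel_transform:
  assumes c: "c \<in> A" "p \<in> cdom c" and d: "d \<in> A" "p \<in> cdom d"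
  shows "\<Gamma> d (cmap d p) (chart_change c d p a) (chart_change c d p b)
    = chart_change c d p (\<Gamma> c (cmap c p) a b) - ddtr c d (cmap c p) a b"
proof -
  interpret C: coordinate_metric "img c" "G c" by (rule coordinate_metric[OF c(1)])
  interpret D: coordinate_metric "img d" "G d" by (rule coordinate_metric[OF d(1)])
  note x = cmap_img[OF c] and y = cmap_img[OF d]
  note xt = cmap_trans_dom[OF c d(2)]
  note l = linear_chart_change[OF c(1) d(1) c(2) d(2)]
  define B where "B a b = \<Gamma> d (cmap d p) (chart_change c d p a) (chart_change c d p b)
    - (chart_change c d p (\<Gamma> c (cmap c p) a b) - ddtr c d (cmap c p) a b)" for a b
  have "B a b = 0"
  proof (rule bilinear_symmetric_zero[where B = B])
    show "B a b = B b a" for a b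
      by (simp add: B_def C.Gam_sym[OF x, of a b] D.Gam_sym[OF y, of "chart_change c d p a"] ddtr_sym[OF c(1) d(1) xt, of a b])
    show "B (a + b) e = B a e + B b e" for a b e
      by (simp add: B_def C.Gam_simps[OF x] D.Gam_simps[OF y] linear_add[OF l] bilinear_ladd[OF bilinear_ddtr[OF c(1) d(1) xt]])
    show "B a a = 0" for a
      using christoffel_transform_diag[OF c d] by (simp add: B_def)
  qed
  then show ?thesis by (simp add: B_def)
qed

end

section \<open>Parallel sections\<close>

locale hyperbolic_manifold =
  fixes A :: "('m::{t2_space,second_countable_topology}, 'e::euclidean_space) chart set"
    and g :: "('m, 'e) metric" and k :: real
  assumes hadamard: "hadamard_manifold A g"
    and k_pos: "k > 0"
    and const_curv: "constant_curvature A g (- (k\<^sup>2))"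

sublocale hyperbolic_manifold \<subseteq> smooth_riemannian A g
  using hadamard by unfold_locales (simp_all add: hadamard_manifold_def)

context hyperbolic_manifold
begin

text \<open>The hypothesis speaks of independent pairs only; for dependent pairs both sides of the
  required identity vanish.\<close>

lemma space_form:
  assumes c: "c \<in> A"
  shows "coordinate_space_form (img c) (G c) (- (k\<^sup>2))"
proof -
  interpret C: coordinate_metric "img c" "G c" by (rule coordinate_metric[OF c])
  show ?thesis
  proof
    fix x a b v assume x: "x \<in> img c"
    show "C.Riem x a b v = (- (k\<^sup>2)) *\<^sub>R (G c x b v *\<^sub>R a - G c x a v *\<^sub>R b)"
    proof (rule C.constant_sectional_curvature[OF x])
      fix a b
      show "G c x (C.Riem x a b b) a = - (k\<^sup>2) * (G c x a a * G c x b b - (G c x a b)\<^sup>2)"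
      proof (cases "a \<noteq> b \<and> independent {a, b}")
        case True
        then have "sectional_curvature A g c x a b = - (k\<^sup>2)"
          using const_curv c x by (auto simp: constant_curvature_def img_def)
        then have eq: "G c x (C.Riem x a b b) a / (G c x a a * G c x b b - (G c x a b)\<^sup>2) = - (k\<^sup>2)"
          by (simp add: sectional_curvature_def curvature_Riem[OF c])
        \<comment> \<open>Division by 0 yields 0, which differs from \<open>- (k\<^sup>2)\<close>;
          the equation itself therefore shows that the denominator is nonzero.\<close>
        then have "G c x a a * G c x b b - (G c x a b)\<^sup>2 \<noteq> 0" using k_pos by (auto simp del: right_minus_eq)
        then show ?thesis using eq by (simp add: divide_eq_eq)
      next
        case False
        have R0: "C.Riem x a a v = 0" for a v by (simp add: C.Riem_def)
        have "\<exists>r. a = r *\<^sub>R b \<or> b = r *\<^sub>R a"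
        proof (cases "a = b")
          case True then show ?thesis by (intro exI[of _ 1]) simp
        next
          case ab: False
          have "b = 0 \<or> a \<in> span {b}"
          proof (rule ccontr)
            assume "\<not> (b = 0 \<or> a \<in> span {b})"
            then have "independent {a, b}" by (intro independent_insertI) (auto simp: independent_empty)
            then show False using ab False by simp
          qed
          then show ?thesis by (auto simp: span_singleton intro: exI[of _ 0])
        qed
        then obtain r where "a = r *\<^sub>R b \<or> b = r *\<^sub>R a" by blast
        then show ?thesis
          using x by (auto simp: C.Riem_linear R0 C.G_simps power2_eq_square)
      qed
    qed
  qed
qed

type_synonym ('a, 'b) jet = "('a, 'b) tvec \<times> real"

definition par :: "('m, 'e) chart \<Rightarrow> ('m \<Rightarrow> ('m, 'e) jet) \<Rightarrow> 'm \<Rightarrow> bool"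
  where "par c \<sigma> p \<longleftrightarrow> coordinate_space_form.parallel_at (G c) (- (k\<^sup>2))
    (\<lambda>x. fst (\<sigma> (cinv c x)) c) (\<lambda>x. snd (\<sigma> (cinv c x))) (cmap c p)"

text \<open>\<open>par\<close> sees a section only through its components in one chart. Tangency on
  a whole neighbourhood relates the components in different charts, and so allows parallelism to
  pass from one chart to another.\<close>

definition parallel :: "('m \<Rightarrow> ('m, 'e) jet) \<Rightarrow> 'm \<Rightarrow> bool"
  where "parallel \<sigma> p \<longleftrightarrow> (\<exists>W. open W \<and> p \<in> W \<and> (\<forall>q\<in>W. fst (\<sigma> q) \<in> tangent_space A q)) \<and>
    (\<forall>c\<in>A. p \<in> cdom c \<longrightarrow> par c \<sigma> p)"

lemma parD:
  assumes c: "c \<in> A" "p \<in> cdom c" and p: "par c \<sigma> p"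
  shows "((\<lambda>x. fst (\<sigma> (cinv c x)) c) has_derivative (\<lambda>a. - \<Gamma> c (cmap c p) a (fst (\<sigma> p) c) + (k\<^sup>2 * snd (\<sigma> p)) *\<^sub>R a)) (at (cmap c p))"
    and "((\<lambda>x. snd (\<sigma> (cinv c x))) has_derivative (\<lambda>a. G c (cmap c p) (fst (\<sigma> p) c) a)) (at (cmap c p))"
proof -
  interpret C: coordinate_space_form "img c" "G c" "- (k\<^sup>2)" by (rule space_form[OF c(1)])
  show "((\<lambda>x. fst (\<sigma> (cinv c x)) c) has_derivative (\<lambda>a. - \<Gamma> c (cmap c p) a (fst (\<sigma> p) c) + (k\<^sup>2 * snd (\<sigma> p)) *\<^sub>R a)) (at (cmap c p))"
    and "((\<lambda>x. snd (\<sigma> (cinv c x))) has_derivative (\<lambda>a. G c (cmap c p) (fst (\<sigma> p) c) a)) (at (cmap c p))"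
    using p unfolding par_def C.parallel_at_def by (simp_all add: cinv_cmap[OF c])
qed

lemma parI:
  assumes c: "c \<in> A" "p \<in> cdom c"
    and "((\<lambda>x. fst (\<sigma> (cinv c x)) c) has_derivative (\<lambda>a. - \<Gamma> c (cmap c p) a (fst (\<sigma> p) c) + (k\<^sup>2 * snd (\<sigma> p)) *\<^sub>R a)) (at (cmap c p))"
    and "((\<lambda>x. snd (\<sigma> (cinv c x))) has_derivative (\<lambda>a. G c (cmap c p) (fst (\<sigma> p) c) a)) (at (cmap c p))"
  shows "par c \<sigma> p"
proof -
  interpret C: coordinate_space_form "img c" "G c" "- (k\<^sup>2)" by (rule space_form[OF c(1)])
  show ?thesis using assms(3,4) unfolding par_def C.parallel_at_def by (simp add: cinv_cmap[OF c])
qed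

text \<open>Differentiating the Jacobian in \<open>u d = chart_change c d p (u c)\<close> produces a
  second derivative of the transition map, which cancels the inhomogeneous term in the law for the
  Christoffel symbols.\<close>

lemma par_change_chart:
  assumes W: "open W" "p \<in> W" "\<And>q. q \<in> W \<Longrightarrow> fst (\<sigma> q) \<in> tangent_space A q"
    and c: "c \<in> A" "p \<in> cdom c" and d: "d \<in> A" "p \<in> cdom d" and par: "par c \<sigma> p"
  shows "par d \<sigma> p"
proof (rule parI[OF d])
  interpret C: coordinate_metric "img c" "G c" by (rule coordinate_metric[OF c(1)])
  let ?x = "cmap c p" and ?y = "cmap d p" and ?v = "fst (\<sigma> p) c"
  let ?\<psi> = "chart_change d c p" and ?\<phi> = "chart_change c d p"
  have trdc: "tr d c ?y = ?x" by (rule tr_cmap[OF d])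
  have dtr: "(tr d c has_derivative ?\<psi>) (at ?y)" by (rule tr_has_derivative[OF d(1) c(1) d(2) c(2)])
  have ytr: "?y \<in> trans_dom d c" by (rule cmap_trans_dom[OF d c(2)])
  have xtr: "?x \<in> trans_dom c d" by (rule cmap_trans_dom[OF c d(2)])
  define N where "N = trans_dom d c \<inter> (img d \<inter> cinv d -` W)"
  have oN: "open N"
    unfolding N_def by (rule open_Int[OF open_trans_dom[OF d(1) c(1)] open_cinv_preimage[OF d(1) W(1)]])
  have yN: "?y \<in> N" using ytr W(2) cmap_img[OF d] by (simp add: N_def cinv_cmap[OF d])
  have vp: "fst (\<sigma> p) d = ?\<phi> ?v" by (rule tangent_change[OF W(3)[OF W(2)] c(1) d(1) c(2) d(2)])
  have inv: "?\<phi> (?\<psi> a) = a" for a by (rule chart_change_inverse[OF d(1) c(1) d(2) c(2)])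
  note l\<phi> = linear_chart_change[OF c(1) d(1) c(2) d(2)]
  note D = parD[OF c par, folded trdc]
  have w: "((\<lambda>y. fst (\<sigma> (cinv c (tr d c y))) c) has_derivative
      (\<lambda>h. - \<Gamma> c (tr d c ?y) (?\<psi> h) ?v + (k\<^sup>2 * snd (\<sigma> p)) *\<^sub>R ?\<psi> h)) (at ?y)"
    by (rule has_derivative_compose[OF dtr D(1)])
  have "((\<lambda>y. frechet_derivative (tr c d) (at (tr d c y)) (fst (\<sigma> (cinv c (tr d c y))) c)) has_derivative
    (\<lambda>h. frechet_derivative (\<lambda>z. frechet_derivative (tr c d) (at z) (fst (\<sigma> (cinv c (tr d c ?y))) c)) (at (tr d c ?y)) (?\<psi> h)
      + frechet_derivative (tr c d) (at (tr d c ?y)) (- \<Gamma> c (tr d c ?y) (?\<psi> h) ?v + (k\<^sup>2 * snd (\<sigma> p)) *\<^sub>R ?\<psi> h))) (at ?y)"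
    by (rule has_derivative_frechet_derivative_compose[OF smooth_tr[OF c(1) d(1)] open_trans_dom[OF c(1) d(1)] _ UNIV_I dtr w])
      (simp add: trdc xtr)
  then have 1: "((\<lambda>y. frechet_derivative (tr c d) (at (tr d c y)) (fst (\<sigma> (cinv c (tr d c y))) c)) has_derivative
     (\<lambda>a. - \<Gamma> d ?y a (fst (\<sigma> p) d) + (k\<^sup>2 * snd (\<sigma> p)) *\<^sub>R a)) (at ?y)"
  proof (rule has_derivative_eq_rhs, intro ext)
    fix h
    have "\<Gamma> d ?y h (fst (\<sigma> p) d) = ?\<phi> (\<Gamma> c ?x (?\<psi> h) ?v) - ddtr c d ?x (?\<psi> h) ?v"
      using christoffel_transform[OF c d, of "?\<psi> h" ?v] by (simp add: inv vp)
    moreover have "frechet_derivative (\<lambda>z. frechet_derivative (tr c d) (at z) (fst (\<sigma> (cinv c (tr d c ?y))) c)) (at (tr d c ?y)) (?\<psi> h)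
      = ddtr c d ?x (?\<psi> h) ?v" by (simp add: ddtr_def trdc cinv_cmap[OF c])
    moreover have "frechet_derivative (tr c d) (at (tr d c ?y)) (- \<Gamma> c (tr d c ?y) (?\<psi> h) ?v + (k\<^sup>2 * snd (\<sigma> p)) *\<^sub>R ?\<psi> h)
      = - ?\<phi> (\<Gamma> c ?x (?\<psi> h) ?v) + (k\<^sup>2 * snd (\<sigma> p)) *\<^sub>R h"
      unfolding trdc chart_change_tr[symmetric]
      by (simp only: linear_add[OF l\<phi>] linear_neg[OF l\<phi>] linear_cmul[OF l\<phi>] inv)
    ultimately show "frechet_derivative (\<lambda>z. frechet_derivative (tr c d) (at z) (fst (\<sigma> (cinv c (tr d c ?y))) c)) (at (tr d c ?y)) (?\<psi> h)
      + frechet_derivative (tr c d) (at (tr d c ?y)) (- \<Gamma> c (tr d c ?y) (?\<psi> h) ?v + (k\<^sup>2 * snd (\<sigma> p)) *\<^sub>R ?\<psi> h)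
      = - \<Gamma> d ?y h (fst (\<sigma> p) d) + (k\<^sup>2 * snd (\<sigma> p)) *\<^sub>R h" by simp
  qed
  show "((\<lambda>x. fst (\<sigma> (cinv d x)) d) has_derivative (\<lambda>a. - \<Gamma> d ?y a (fst (\<sigma> p) d) + (k\<^sup>2 * snd (\<sigma> p)) *\<^sub>R a)) (at ?y)"
  proof (rule has_derivative_transform_within_open[OF 1 oN yN])
    fix y assume y: "y \<in> N"
    let ?q = "cinv d y"
    have q: "?q \<in> cdom d" "?q \<in> cdom c" "?q \<in> W" "cmap c ?q = tr d c y" "cinv c (tr d c y) = ?q"
      using y d c by (auto simp: N_def trans_dom_iff cinv_cdom cinv_tr) (simp add: tr_def)
    show "frechet_derivative (tr c d) (at (tr d c y)) (fst (\<sigma> (cinv c (tr d c y))) c) = fst (\<sigma> ?q) d"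
      using tangent_change[OF W(3)[OF q(3)] c(1) d(1) q(2,1)] by (simp add: q chart_change_tr)
  qed
  have "((\<lambda>y. snd (\<sigma> (cinv c (tr d c y)))) has_derivative (\<lambda>h. G c (tr d c ?y) ?v (?\<psi> h))) (at ?y)"
    by (rule has_derivative_compose[OF dtr D(2)])
  moreover have "G c (tr d c ?y) ?v (?\<psi> h) = G d ?y (fst (\<sigma> p) d) h" for h
    using G_chart_change[OF c(1) d(1) c(2) d(2), of ?v "?\<psi> h"] by (simp add: trdc vp inv)
  ultimately have 2: "((\<lambda>y. snd (\<sigma> (cinv c (tr d c y)))) has_derivative (\<lambda>h. G d ?y (fst (\<sigma> p) d) h)) (at ?y)" by simp
  show "((\<lambda>x. snd (\<sigma> (cinv d x))) has_derivative (\<lambda>a. G d ?y (fst (\<sigma> p) d) a)) (at ?y)"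
    by (rule has_derivative_transform_within_open[OF 2 oN yN]) (simp add: N_def cinv_tr d c)
qed

lemma par_germ:
  assumes U: "open U" "p \<in> U" "\<And>q. q \<in> U \<Longrightarrow> \<sigma> q = \<tau> q" and c: "c \<in> A" "p \<in> cdom c" and p: "par c \<sigma> p"
  shows "par c \<tau> p"
proof (rule parI[OF c])
  define N where "N = img c \<inter> cinv c -` U"
  have oN: "open N"
    unfolding N_def by (rule open_cinv_preimage[OF c(1) U(1)])
  have xN: "cmap c p \<in> N" using U(2) cmap_img[OF c] by (simp add: N_def cinv_cmap[OF c])
  show "((\<lambda>x. fst (\<tau> (cinv c x)) c) has_derivative (\<lambda>a. - \<Gamma> c (cmap c p) a (fst (\<tau> p) c) + (k\<^sup>2 * snd (\<tau> p)) *\<^sub>R a)) (at (cmap c p))"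
    unfolding U(3)[OF U(2), symmetric]
    by (rule has_derivative_transform_within_open[OF parD(1)[OF c p] oN xN]) (simp add: N_def U)
  show "((\<lambda>x. snd (\<tau> (cinv c x))) has_derivative (\<lambda>a. G c (cmap c p) (fst (\<tau> p) c) a)) (at (cmap c p))"
    unfolding U(3)[OF U(2), symmetric]
    by (rule has_derivative_transform_within_open[OF parD(2)[OF c p] oN xN]) (simp add: N_def U)
qed

text \<open>Coordinate balls are convex, as local existence and uniqueness of parallel sections
  require.\<close>

lemma chart_ball:
  assumes c: "c \<in> A" "p \<in> cdom c" and W: "open W" "p \<in> W"
  shows "\<exists>r>0. ball (cmap c p) r \<subseteq> img c \<and> cinv c ` ball (cmap c p) r \<subseteq> W \<and>
    open (cinv c ` ball (cmap c p) r) \<and> p \<in> cinv c ` ball (cmap c p) r \<and> path_connected (cinv c ` ball (cmap c p) r)"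
proof -
  have "open (img c \<inter> cinv c -` W)" by (rule open_cinv_preimage[OF c(1) W(1)])
  moreover have "cmap c p \<in> img c \<inter> cinv c -` W" using W(2) cmap_img[OF c] by (simp add: cinv_cmap[OF c])
  ultimately obtain r where r: "r > 0" "ball (cmap c p) r \<subseteq> img c \<inter> cinv c -` W"
    using open_contains_ball_eq by blast
  let ?B = "ball (cmap c p) r"
  have "open (cinv c ` ?B)" using open_cinv_image[OF c(1) open_ball] r(2) by blast
  moreover have "path_connected (cinv c ` ?B)"
    by (intro path_connected_continuous_image continuous_on_subset[OF continuous_on_cinv[OF c(1)]]
        convex_imp_path_connected convex_ball) (use r in auto)
  moreover have "p \<in> cinv c ` ?B" using cinv_cmap[OF c] r(1) by (intro image_eqI[of _ _ "cmap c p"]) auto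
  ultimately show ?thesis using r by (intro exI[of _ r]) auto
qed

text \<open>On a coordinate ball, flatness produces a section through any value, and
  \<open>par_change_chart\<close> makes it parallel in all charts. Two parallel sections that meet
  at one point of the ball agree on all of it, which is the dichotomy demanded by
  \<open>unique_local\<close>.\<close>

sublocale local_system parallel "\<lambda>p. tangent_space A p \<times> UNIV"
proof
  fix U x and \<sigma> \<tau> :: "'m \<Rightarrow> ('m, 'e) jet"
  assume U: "open U" "x \<in> U" "\<And>y. y \<in> U \<Longrightarrow> \<sigma> y = \<tau> y" and p: "parallel \<sigma> x"
  obtain W where W: "open W" "x \<in> W" "\<forall>q\<in>W. fst (\<sigma> q) \<in> tangent_space A q"
    using p unfolding parallel_def by blast
  show "parallel \<tau> x"
    unfolding parallel_def
  proof (intro conjI exI[of _ "U \<inter> W"] ballI impI)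
    show "fst (\<tau> q) \<in> tangent_space A q" if "q \<in> U \<inter> W" for q
      using that U(3)[of q] W(3) by auto
    show "par c \<tau> x" if "c \<in> A" "x \<in> cdom c" for c
    proof (rule par_germ[OF U that])
      show "par c \<sigma> x" using p that unfolding parallel_def by blast
    qed
  qed (use U W in auto)
next
  fix \<sigma> x assume "parallel \<sigma> x"
  then show "\<sigma> x \<in> tangent_space A x \<times> UNIV" unfolding parallel_def by (auto simp: mem_Times_iff)
next
  fix p
  obtain c where c: "c \<in> A" "p \<in> cdom c" using ex_chart by blast
  interpret C: coordinate_space_form "img c" "G c" "- (k\<^sup>2)" by (rule space_form[OF c(1)])
  obtain r where r: "r > 0" "ball (cmap c p) r \<subseteq> img c" "open (cinv c ` ball (cmap c p) r)"
    "p \<in> cinv c ` ball (cmap c p) r" "path_connected (cinv c ` ball (cmap c p) r)"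
    using chart_ball[OF c open_UNIV] by blast
  let ?B = "ball (cmap c p) r"
  show "\<exists>U. open U \<and> p \<in> U \<and> path_connected U \<and>
      (\<forall>x'\<in>U. \<forall>j\<in>tangent_space A x' \<times> UNIV. \<exists>\<sigma>. \<sigma> x' = j \<and> (\<forall>y\<in>U. parallel \<sigma> y))"
  proof (intro exI[of _ "cinv c ` ?B"] conjI ballI r(3-5))
    fix q j assume q: "q \<in> cinv c ` ?B" and j: "j \<in> tangent_space A q \<times> (UNIV::real set)"
    obtain x where x: "x \<in> ?B" "q = cinv c x" using q by blast
    have xq: "x = cmap c q" "q \<in> cdom c" using x r(2) cmap_cinv[OF c(1)] cinv_cdom[OF c(1)] by auto
    obtain v f where vf: "v x = fst j c" "f x = snd j" "\<forall>y\<in>?B. C.parallel_at v f y"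
      using C.ex_parallel[OF open_ball convex_ball r(2) x(1), of "fst j c" "snd j"] by blast
    define \<sigma> where "\<sigma> q' = (coord_vec A c q' (v (cmap c q')), f (cmap c q'))" for q'
    have "parallel \<sigma> q'" if q': "q' \<in> cinv c ` ?B" for q'
    proof -
      have t: "fst (\<sigma> q'') \<in> tangent_space A q''" if "q'' \<in> cinv c ` ?B" for q''
        using that r(2) cinv_cdom[OF c(1)] by (auto simp: \<sigma>_def intro!: coord_vec_tangent c)
      obtain x' where x': "x' \<in> ?B" "q' = cinv c x'" using q' by blast
      have xq': "x' = cmap c q'" "q' \<in> cdom c" using x' r(2) cmap_cinv[OF c(1)] cinv_cdom[OF c(1)] by auto
      have vx: "fst (\<sigma> (cinv c y)) c = v y" "snd (\<sigma> (cinv c y)) = f y" if "y \<in> ?B" for y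
        using that r(2) by (auto simp: \<sigma>_def coord_vec_self[OF c(1)] cinv_cdom[OF c(1)] cmap_cinv[OF c(1)] subset_iff)
      have p': "C.parallel_at v f x'" using vf(3) x' by blast
      have pc: "par c \<sigma> q'"
      proof (rule parI[OF c(1) xq'(2)])
        note e = vx[OF x'(1), folded x'(2)]
        show "((\<lambda>x. fst (\<sigma> (cinv c x)) c) has_derivative (\<lambda>a. - \<Gamma> c (cmap c q') a (fst (\<sigma> q') c) + (k\<^sup>2 * snd (\<sigma> q')) *\<^sub>R a)) (at (cmap c q'))"
          unfolding e xq'(1)[symmetric]
          by (rule has_derivative_transform_within_open[OF _ open_ball x'(1)])
            (use p' in \<open>auto simp: C.parallel_at_def vx\<close>)
        show "((\<lambda>x. snd (\<sigma> (cinv c x))) has_derivative (\<lambda>a. G c (cmap c q') (fst (\<sigma> q') c) a)) (at (cmap c q'))"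
          unfolding e xq'(1)[symmetric]
          by (rule has_derivative_transform_within_open[OF _ open_ball x'(1)])
            (use p' in \<open>auto simp: C.parallel_at_def vx\<close>)
      qed
      have "par d \<sigma> q'" if "d \<in> A" "q' \<in> cdom d" for d
        by (rule par_change_chart[OF r(3) q' t c(1) xq'(2) that pc])
      then show ?thesis
        unfolding parallel_def using r(3) q' t by blast
    qed
    moreover have "\<sigma> q = j"
      using coord_vec_tangent_eq[of "fst j" q c] j c xq vf(1,2) by (auto simp: \<sigma>_def mem_Times_iff prod_eq_iff)
    ultimately show "\<exists>\<sigma>. \<sigma> q = j \<and> (\<forall>y\<in>cinv c ` ?B. parallel \<sigma> y)" by blast
  qed
next
  fix U p \<sigma> \<tau>
  assume U: "open U" "p \<in> U" and P: "\<And>y. y \<in> U \<Longrightarrow> parallel \<sigma> y" "\<And>y. y \<in> U \<Longrightarrow> parallel \<tau> y"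
  obtain c where c: "c \<in> A" "p \<in> cdom c" using ex_chart by blast
  interpret C: coordinate_space_form "img c" "G c" "- (k\<^sup>2)" by (rule space_form[OF c(1)])
  obtain r where r: "r > 0" "ball (cmap c p) r \<subseteq> img c" "cinv c ` ball (cmap c p) r \<subseteq> U"
    "open (cinv c ` ball (cmap c p) r)" "p \<in> cinv c ` ball (cmap c p) r"
    using chart_ball[OF c U] by blast
  let ?B = "ball (cmap c p) r"
  let ?v = "\<lambda>\<sigma> x. fst (\<sigma> (cinv c x)) c" and ?f = "\<lambda>\<sigma> x. snd (\<sigma> (cinv c x))"
  have eqI: "\<sigma> (cinv c x) = \<tau> (cinv c x) \<longleftrightarrow> ?v \<sigma> x = ?v \<tau> x \<and> ?f \<sigma> x = ?f \<tau> x" if x: "x \<in> ?B" for x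
  proof -
    have "cinv c x \<in> U" "cinv c x \<in> cdom c" using x r cinv_cdom[OF c(1)] by auto
    then have "fst (\<sigma> (cinv c x)) \<in> tangent_space A (cinv c x)" "fst (\<tau> (cinv c x)) \<in> tangent_space A (cinv c x)"
      using P unfolding parallel_def by blast+
    then show ?thesis using tangent_eqI[OF _ _ c(1) \<open>cinv c x \<in> cdom c\<close>] by (auto simp: prod_eq_iff)
  qed
  have Cp: "C.parallel_at (?v \<rho>) (?f \<rho>) x" if "x \<in> ?B" "\<And>y. y \<in> U \<Longrightarrow> parallel \<rho> y" for x \<rho>
  proof -
    have "cinv c x \<in> U" "cinv c x \<in> cdom c" "cmap c (cinv c x) = x" using that r cinv_cdom[OF c(1)] cmap_cinv[OF c(1)] by auto
    then show ?thesis using that(2)[of "cinv c x"] c unfolding parallel_def par_def by metis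
  qed
  have "\<sigma> (cinv c y) = \<tau> (cinv c y)" if "x \<in> ?B" "\<sigma> (cinv c x) = \<tau> (cinv c x)" "y \<in> ?B" for x y
    using C.parallel_unique[OF convex_ball r(2) that(1,3) Cp[OF _ P(1)] Cp[OF _ P(2)]] eqI that by blast
  then show "\<exists>W. open W \<and> p \<in> W \<and> ((\<forall>y\<in>W. \<sigma> y = \<tau> y) \<or> (\<forall>y\<in>W. \<sigma> y \<noteq> \<tau> y))"
    using r(4,5) by (intro exI[of _ "cinv c ` ?B"]) blast
qed

definition global_section :: "('m \<Rightarrow> ('m, 'e) jet) \<Rightarrow> bool"
  where "global_section \<sigma> \<longleftrightarrow> (\<forall>p. parallel \<sigma> p)"

lemma simply_connected_UNIV: "simply_connected (UNIV :: 'm set)"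
  using hadamard by (simp add: hadamard_manifold_def)

lemma ex_section: "u \<in> tangent_space A p \<Longrightarrow> \<exists>\<sigma>. global_section \<sigma> \<and> \<sigma> p = (u, r)"
  using ex_global_section[OF simply_connected_UNIV, of "(u, r)" p] by (auto simp: global_section_def)

end

section \<open>Lifts of families of paths\<close>

text \<open>Extended by its limit at 0, so that formulas along geodesics also cover constant
  geodesics and depend continuously on the speed.\<close>

definition sinhc :: "real \<Rightarrow> real"
  where "sinhc x = (if x = 0 then 1 else sinh x / x)"

lemma sinh_sinhc: "sinh x = x * sinhc x"
  by (simp add: sinhc_def)

lemma sinhc_0 [simp]: "sinhc 0 = 1"
  by (simp add: sinhc_def)

lemma sinhc_pos: "sinhc x > 0"
proof (cases x "0::real" rule: linorder_cases)
  case less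
  then show ?thesis using sinh_real_neg_iff[of x] by (simp add: sinhc_def divide_neg_neg)
qed (simp_all add: sinhc_def)

lemma isCont_sinhc: "isCont sinhc x"
proof (cases "x = 0")
  case True
  have "(sinh has_real_derivative 1) (at (0::real))"
    by (auto intro!: derivative_eq_intros)
  then have "((\<lambda>h::real. (sinh (0 + h) - sinh 0) / h) \<longlongrightarrow> 1) (at 0)"
    by (simp add: DERIV_def)
  then have "(sinhc \<longlongrightarrow> 1) (at 0)"
    by (rule Lim_transform_eventually) (auto simp: sinhc_def eventually_at_filter)
  then show ?thesis using True by (simp add: isCont_def)
next
  case False
  then have "\<forall>\<^sub>F y in nhds x. y \<noteq> 0" by (rule t1_space_nhds)
  then have "\<forall>\<^sub>F y in nhds x. sinhc y = sinh y / y" by eventually_elim (simp add: sinhc_def)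
  moreover have "isCont (\<lambda>y. sinh y / y) x" using False by (intro continuous_intros)
  ultimately show ?thesis by (simp add: isCont_cong)
qed

lemma continuous_on_sinhc [continuous_intros]: "continuous_on S f \<Longrightarrow> continuous_on S (\<lambda>x. sinhc (f x))"
  using isCont_sinhc continuous_on_compose2[OF continuous_at_imp_continuous_on[of UNIV sinhc]] by blast

text \<open>The combinations of \<open>H\<close> and \<open>F\<close> with coefficients 1 and
  \<open>\<kappa>\<close> or \<open>- \<kappa>\<close> are exponentials. They coincide for vanishing
  \<kappa>, where the solution is affine.\<close>

lemma second_order_ode_solution:
  fixes F H :: "real \<Rightarrow> real"
  assumes F: "\<And>t. (F has_real_derivative H t) (at t)"
    and H: "\<And>t. (H has_real_derivative \<kappa>\<^sup>2 * F t) (at t)"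
  shows "F t = F 0 * cosh (\<kappa> * t) + H 0 * t * sinhc (\<kappa> * t)"
proof (cases "\<kappa> = 0")
  case True
  have Hc: "H t = H 0" for t
    by (rule DERIV_isconst_all) (use H True in auto)
  have "F t - H 0 * t = F 0 - H 0 * 0"
  proof (rule DERIV_isconst_all[of "\<lambda>t. F t - H 0 * t"], rule allI)
    show "((\<lambda>t. F t - H 0 * t) has_real_derivative 0) (at x)" for x
      using Hc[of x] by (auto intro!: derivative_eq_intros F)
  qed
  then show ?thesis using True by simp
next
  case False
  have 1: "(H t + \<kappa> * F t) * exp (- \<kappa> * t) = (H 0 + \<kappa> * F 0) * exp (- \<kappa> * 0)" for t
  proof (rule DERIV_isconst_all[of "\<lambda>t. (H t + \<kappa> * F t) * exp (- \<kappa> * t)"], rule allI)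
    show "((\<lambda>t. (H t + \<kappa> * F t) * exp (- \<kappa> * t)) has_real_derivative 0) (at x)" for x
      by (rule derivative_eq_intros F H refl)+ (simp add: algebra_simps power2_eq_square)
  qed
  have 2: "(H t - \<kappa> * F t) * exp (\<kappa> * t) = (H 0 - \<kappa> * F 0) * exp (\<kappa> * 0)" for t
  proof (rule DERIV_isconst_all[of "\<lambda>t. (H t - \<kappa> * F t) * exp (\<kappa> * t)"], rule allI)
    show "((\<lambda>t. (H t - \<kappa> * F t) * exp (\<kappa> * t)) has_real_derivative 0) (at x)" for x
      by (rule derivative_eq_intros F H refl)+ (simp add: algebra_simps power2_eq_square)
  qed
  have "H t + \<kappa> * F t = (H 0 + \<kappa> * F 0) * exp (\<kappa> * t)"
    using 1[of t] by (simp add: exp_minus field_simps)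
  moreover have "H t - \<kappa> * F t = (H 0 - \<kappa> * F 0) * exp (- (\<kappa> * t))"
    using 2[of t] by (simp add: exp_minus field_simps)
  ultimately have "2 * \<kappa> * F t = (H 0 + \<kappa> * F 0) * exp (\<kappa> * t) - (H 0 - \<kappa> * F 0) * exp (- (\<kappa> * t))"
    by linarith
  also have "\<dots> = 2 * \<kappa> * F 0 * cosh (\<kappa> * t) + 2 * H 0 * sinh (\<kappa> * t)"
    by (simp add: cosh_field_def sinh_field_def field_simps)
  also have "\<dots> = 2 * \<kappa> * (F 0 * cosh (\<kappa> * t) + H 0 * t * sinhc (\<kappa> * t))"
    by (simp add: sinh_sinhc algebra_simps)
  finally show ?thesis using False by simp
qed

text \<open>
  A family of paths depends continuously on the parameter as soon as its starting points do and its
  images under locally injective maps do: a path near the reference path cannot cross the boundary of a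
  small compact neighbourhood on which such a map is injective.
\<close>

lemma continuous_family_of_lifts:
  fixes \<Phi> :: "'p::topological_space \<Rightarrow> real \<Rightarrow> 'm::t2_space"
    and F :: "'m \<Rightarrow> 'm \<Rightarrow> 'b::metric_space"
  assumes path: "\<And>x. continuous_on {0..1} (\<Phi> x)"
    and start: "((\<lambda>x. \<Phi> x 0) \<longlongrightarrow> \<Phi> x0 0) (nhds x0)"
    and F: "\<And>p. continuous_on UNIV (F p)"
    and joint: "\<And>p. continuous_on (UNIV \<times> {0..1}) (\<lambda>z. F p (\<Phi> (fst z) (snd z)))"
    and inj: "\<And>p. \<exists>B C. open B \<and> compact C \<and> p \<in> B \<and> B \<subseteq> C \<and> inj_on (F p) C"
    and t: "t \<in> {0..1}"
  shows "((\<lambda>x. \<Phi> x t) \<longlongrightarrow> \<Phi> x0 t) (nhds x0)"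
proof (rule connected_induction_simple[of "{0..1}" 0 t "\<lambda>t. ((\<lambda>x. \<Phi> x t) \<longlongrightarrow> \<Phi> x0 t) (nhds x0)", OF connected_Icc _ t start])
  fix t1 :: real assume t1: "t1 \<in> {0..1}"
  define p where "p = \<Phi> x0 t1"
  obtain B C where BC: "open B" "compact C" "p \<in> B" "B \<subseteq> C" "inj_on (F p) C" using inj by blast
  have Cc: "closed C" using BC(2) compact_imp_closed by blast
  \<comment> \<open>Used twice: with \<open>C - B\<close>, to keep nearby paths from leaving the
    compact set, and with \<open>C - W\<close>, to locate their points at time
    \<open>b\<close>.\<close>
  have near: "\<exists>\<epsilon>>0. \<forall>y\<in>D. dist (F p y) (F p y0) \<ge> \<epsilon>"
    if D: "compact D" "D \<subseteq> C" "y0 \<in> C" "y0 \<notin> D" for D y0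
  proof -
    have "compact (F p ` D)" using D(1) F continuous_on_subset by (intro compact_continuous_image) blast
    then have "closed (F p ` D)" by (rule compact_imp_closed)
    moreover have "F p y0 \<notin> F p ` D" using BC(5) D by (auto dest: inj_onD)
    ultimately have o: "open (- F p ` D)" and m: "F p y0 \<in> - F p ` D" by auto
    obtain \<epsilon> where \<epsilon>: "\<epsilon> > 0" "ball (F p y0) \<epsilon> \<subseteq> - F p ` D"
      using m open_contains_ball_eq[OF o, of "F p y0"] by auto
    have "dist (F p y) (F p y0) \<ge> \<epsilon>" if "y \<in> D" for y
    proof (rule ccontr)
      assume "\<not> dist (F p y) (F p y0) \<ge> \<epsilon>"
      then have "F p y \<in> ball (F p y0) \<epsilon>" by (simp add: dist_commute)
      then show False using \<epsilon>(2) that by blast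
    qed
    then show ?thesis using \<epsilon>(1) by blast
  qed
  have joint_ev: "\<exists>N \<delta>. open N \<and> x0 \<in> N \<and> \<delta> > 0 \<and>
      (\<forall>x\<in>N. \<forall>s\<in>{0..1}. \<bar>s - s0\<bar> < \<delta> \<longrightarrow> dist (F p (\<Phi> x s)) (F p (\<Phi> x0 s0)) < \<epsilon>)"
    if s0: "s0 \<in> {0..1}" and \<epsilon>: "\<epsilon> > 0" for s0 \<epsilon>
  proof -
    have "\<exists>N. open N \<and> (\<forall>l\<in>UNIV \<times> {0..1}. l \<in> N \<longleftrightarrow> F p (\<Phi> (fst l) (snd l)) \<in> ball (F p (\<Phi> x0 s0)) \<epsilon>)"
      by (rule continuous_on_open_preimage_iff[OF joint open_ball])
    then obtain N where N: "open N" "\<forall>l\<in>UNIV \<times> {0..1}. l \<in> N \<longleftrightarrow> F p (\<Phi> (fst l) (snd l)) \<in> ball (F p (\<Phi> x0 s0)) \<epsilon>"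
      by blast
    have "(x0, s0) \<in> N" using N(2) s0 \<epsilon> by simp
    then obtain N1 I where NI: "open N1" "open I" "(x0, s0) \<in> N1 \<times> I" "N1 \<times> I \<subseteq> N"
      using N(1) open_prod_elim by metis
    then obtain \<delta> where \<delta>: "\<delta> > 0" "ball s0 \<delta> \<subseteq> I" using open_contains_ball_eq[OF NI(2), of s0] by auto
    show ?thesis
    proof (intro exI[of _ N1] exI[of _ \<delta>] conjI ballI impI)
      fix x s assume xs: "x \<in> N1" "s \<in> {0..1}" "\<bar>s - s0\<bar> < \<delta>"
      have "s \<in> I" using \<delta>(2) xs(3) by (auto simp: dist_real_def abs_minus_commute)
      then have "(x, s) \<in> N" using NI(4) xs(1) by blast
      then show "dist (F p (\<Phi> x s)) (F p (\<Phi> x0 s0)) < \<epsilon>" using N(2) xs(2) by (simp add: dist_commute)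
    qed (use NI \<delta> in auto)
  qed
  have "compact (C - B)" using BC(1,2) by (rule compact_diff[rotated])
  then obtain \<epsilon> where \<epsilon>: "\<epsilon> > 0" "\<forall>y\<in>C - B. dist (F p y) (F p p) \<ge> \<epsilon>"
    using near[of "C - B" p] BC by blast
  obtain N \<delta>1 where N: "open N" "x0 \<in> N" "\<delta>1 > 0"
    "\<forall>x\<in>N. \<forall>s\<in>{0..1}. \<bar>s - t1\<bar> < \<delta>1 \<longrightarrow> dist (F p (\<Phi> x s)) (F p p) < \<epsilon>"
    using joint_ev[OF t1 \<epsilon>(1)] unfolding p_def[symmetric] by blast
  have "\<exists>I. open I \<and> (\<forall>l\<in>{0..1}. l \<in> I \<longleftrightarrow> \<Phi> x0 l \<in> B)"
    by (rule continuous_on_open_preimage_iff[OF path BC(1)])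
  then obtain I where I: "open I" "\<forall>l\<in>{0..1}. l \<in> I \<longleftrightarrow> \<Phi> x0 l \<in> B" by blast
  have "t1 \<in> I" using I(2) t1 BC(3) by (simp add: p_def)
  then obtain \<delta>2 where \<delta>2: "\<delta>2 > 0" "ball t1 \<delta>2 \<subseteq> I" using open_contains_ball_eq[OF I(1), of t1] by auto
  define T where "T = {0..1} \<inter> ball t1 (min \<delta>1 \<delta>2)"
  have Tcon: "connected T" unfolding T_def
    by (intro convex_connected convex_Int convex_ball) auto
  have TB: "\<Phi> x0 s \<in> B" if "s \<in> T" for s
    using that \<delta>2(2) I(2) by (auto simp: T_def subset_iff)
  show "\<exists>T. openin (top_of_set {0..1}) T \<and> t1 \<in> T \<and> (\<forall>a\<in>T. \<forall>b\<in>T.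
      ((\<lambda>x. \<Phi> x a) \<longlongrightarrow> \<Phi> x0 a) (nhds x0) \<longrightarrow> ((\<lambda>x. \<Phi> x b) \<longlongrightarrow> \<Phi> x0 b) (nhds x0))"
  proof (intro exI[of _ T] conjI ballI impI)
    show "openin (top_of_set {0..1}) T" unfolding T_def openin_open by blast
    show "t1 \<in> T" using t1 N(3) \<delta>2(1) by (simp add: T_def)
    fix a b assume a: "a \<in> T" and b: "b \<in> T" and lim: "((\<lambda>x. \<Phi> x a) \<longlongrightarrow> \<Phi> x0 a) (nhds x0)"
    have evB: "\<forall>\<^sub>F x in nhds x0. \<Phi> x b \<in> B"
    proof -
      have 1: "\<forall>\<^sub>F x in nhds x0. \<Phi> x a \<in> B" using topological_tendstoD[OF lim BC(1) TB[OF a]] .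
      have 2: "\<forall>\<^sub>F x in nhds x0. x \<in> N" using N(1,2) by (rule eventually_nhds_in_open)
      show ?thesis using 1 2
      proof eventually_elim
        case (elim x)
        have c: "connected (\<Phi> x ` T)"
          by (intro connected_continuous_image Tcon continuous_on_subset[OF path]) (auto simp: T_def)
        have "\<Phi> x s \<notin> C - B" if "s \<in> T" for s
        proof
          assume "\<Phi> x s \<in> C - B"
          then have "\<epsilon> \<le> dist (F p (\<Phi> x s)) (F p p)" using \<epsilon>(2) by blast
          moreover have "dist (F p (\<Phi> x s)) (F p p) < \<epsilon>"
            using N(4) elim(2) that by (auto simp: T_def dist_real_def abs_minus_commute)
          ultimately show False by linarith
        qed
        \<comment> \<open>The connected image lies in the union of two disjoint open sets and meets
          \<open>B\<close> at time \<open>a\<close>, so it stays in \<open>B\<close>.\<close>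
        then have "\<Phi> x ` T \<subseteq> B \<union> - C" by blast
        moreover have "B \<inter> - C \<inter> \<Phi> x ` T = {}" using BC(4) by blast
        moreover have "B \<inter> \<Phi> x ` T \<noteq> {}" using elim(1) a by blast
        ultimately have "- C \<inter> \<Phi> x ` T = {}"
          using connectedD[OF c BC(1), of "- C"] Cc by (simp add: open_Compl)
        then show ?case using \<open>\<Phi> x ` T \<subseteq> B \<union> - C\<close> b by blast
      qed
    qed
    have b01: "b \<in> {0..1}" using b by (simp add: T_def)
    show "((\<lambda>x. \<Phi> x b) \<longlongrightarrow> \<Phi> x0 b) (nhds x0)"
    proof (rule topological_tendstoI)
      fix W assume W: "open W" "\<Phi> x0 b \<in> W"
      have "compact (C - W)" using W(1) BC(2) by (rule compact_diff[rotated])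
      moreover have "\<Phi> x0 b \<in> C" "\<Phi> x0 b \<notin> C - W" using TB[OF b] BC(4) W by auto
      ultimately obtain \<epsilon>' where \<epsilon>': "\<epsilon>' > 0" "\<forall>y\<in>C - W. dist (F p y) (F p (\<Phi> x0 b)) \<ge> \<epsilon>'"
        using near[of "C - W" "\<Phi> x0 b"] by blast
      obtain N' \<delta>' where N': "open N'" "x0 \<in> N'" "\<delta>' > 0"
        "\<forall>x\<in>N'. \<forall>s\<in>{0..1}. \<bar>s - b\<bar> < \<delta>' \<longrightarrow> dist (F p (\<Phi> x s)) (F p (\<Phi> x0 b)) < \<epsilon>'"
        using joint_ev[OF b01 \<epsilon>'(1)] by blast
      have "\<forall>\<^sub>F x in nhds x0. x \<in> N'" using N'(1,2) by (rule eventually_nhds_in_open)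
      with evB show "\<forall>\<^sub>F x in nhds x0. \<Phi> x b \<in> W"
      proof eventually_elim
        case (elim x)
        have "dist (F p (\<Phi> x b)) (F p (\<Phi> x0 b)) < \<epsilon>'" using N'(3,4) elim(2) b01 by simp
        then have "\<Phi> x b \<notin> C - W" using \<epsilon>'(2) by force
        then show ?case using elim(1) BC(4) by blast
      qed
    qed
  qed
qed simp

section \<open>Sections along geodesics\<close>

context hyperbolic_manifold
begin

lemma section_tangent: "global_section \<sigma> \<Longrightarrow> fst (\<sigma> p) \<in> tangent_space A p"
  unfolding global_section_def parallel_def by blast

lemma section_par: "global_section \<sigma> \<Longrightarrow> c \<in> A \<Longrightarrow> p \<in> cdom c \<Longrightarrow> par c \<sigma> p"
  unfolding global_section_def parallel_def by blast

lemma connected_manifold: "connected (UNIV :: 'm set)"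
proof -
  have "path_connected (UNIV :: 'm set)"
    unfolding path_connected_def pathstart_def pathfinish_def
    using path_connected_UNIV[OF simply_connected_UNIV] by (metis subset_UNIV)
  then show ?thesis by (rule path_connected_imp_connected)
qed

lemma section_continuous:
  assumes "global_section \<sigma>"
  shows "continuous_on UNIV (\<lambda>p. snd (\<sigma> p))"
proof (rule continuous_at_imp_continuous_on, rule ballI)
  fix p :: 'm
  obtain c where c: "c \<in> A" "p \<in> cdom c" using ex_chart by blast
  have "isCont (\<lambda>x. snd (\<sigma> (cinv c x))) (cmap c p)"
    by (rule has_derivative_continuous[OF parD(2)[OF c section_par[OF assms c]]])
  then have 1: "isCont (\<lambda>q. snd (\<sigma> (cinv c (cmap c q)))) p"
    by (rule isCont_o2[OF isCont_cmap[OF c]])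
  have "\<forall>\<^sub>F q in nhds p. q \<in> cdom c" by (rule eventually_nhds_in_open[OF open_cdom[OF c(1)] c(2)])
  then have "\<forall>\<^sub>F q in nhds p. snd (\<sigma> (cinv c (cmap c q))) = snd (\<sigma> q)"
    by eventually_elim (simp add: cinv_cmap[OF c(1)])
  from isCont_cong[OF this] 1 show "isCont (\<lambda>p. snd (\<sigma> p)) p" by simp
qed

text \<open>The conserved form is constant on coordinate balls, and the manifold is
  connected.\<close>

lemma section_invariant:
  assumes \<sigma>: "global_section \<sigma>" and \<tau>: "global_section \<tau>"
  shows "g p (fst (\<sigma> p)) (fst (\<tau> p)) - k\<^sup>2 * (snd (\<sigma> p) * snd (\<tau> p))
    = g q (fst (\<sigma> q)) (fst (\<tau> q)) - k\<^sup>2 * (snd (\<sigma> q) * snd (\<tau> q))"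
proof -
  define I where "I p = g p (fst (\<sigma> p)) (fst (\<tau> p)) - k\<^sup>2 * (snd (\<sigma> p) * snd (\<tau> p))" for p
  have "I q = I p"
  proof (rule connected_induction_simple[of UNIV p q "\<lambda>q. I q = I p", OF connected_manifold UNIV_I UNIV_I refl])
    fix a :: 'm
    obtain c where c: "c \<in> A" "a \<in> cdom c" using ex_chart by blast
    interpret C: coordinate_space_form "img c" "G c" "- (k\<^sup>2)" by (rule space_form[OF c(1)])
    obtain r where r: "r > 0" "ball (cmap c a) r \<subseteq> img c"
      "open (cinv c ` ball (cmap c a) r)" "a \<in> cinv c ` ball (cmap c a) r"
      using chart_ball[OF c open_UNIV UNIV_I] by blast
    let ?B = "ball (cmap c a) r"
    define J where "J x = G c x (fst (\<sigma> (cinv c x)) c) (fst (\<tau> (cinv c x)) c)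
      + (- (k\<^sup>2)) * (snd (\<sigma> (cinv c x)) * snd (\<tau> (cinv c x)))" for x
    have J: "(J has_derivative (\<lambda>_. 0)) (at x within ?B)" if "x \<in> ?B" for x
    proof (rule has_derivative_at_withinI)
      have x: "x \<in> img c" "cinv c x \<in> cdom c" "cmap c (cinv c x) = x"
        using that r(2) cinv_cdom[OF c(1)] cmap_cinv[OF c(1)] by auto
      show "(J has_derivative (\<lambda>_. 0)) (at x)"
        unfolding J_def
        using C.parallel_conserved[OF x(1)] section_par[OF \<sigma> c(1) x(2)] section_par[OF \<tau> c(1) x(2)]
        unfolding par_def x(3) by blast
    qed
    have "J x = J y" if "x \<in> ?B" "y \<in> ?B" for x y
      using has_derivative_zero_unique[OF convex_ball J that(2,1)] by simp
    moreover have "I (cinv c x) = J x" if "x \<in> ?B" for x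
    proof -
      have x: "cinv c x \<in> cdom c" "cmap c (cinv c x) = x"
        using that r(2) cinv_cdom[OF c(1)] cmap_cinv[OF c(1)] by auto
      show ?thesis
        using g_coords[OF section_tangent[OF \<sigma>] section_tangent[OF \<tau>] c(1) x(1)] by (simp add: I_def J_def x)
    qed
    ultimately have "I b = I b'" if "b \<in> cinv c ` ?B" "b' \<in> cinv c ` ?B" for b b'
      using that by (metis imageE)
    then show "\<exists>T. openin (top_of_set UNIV) T \<and> a \<in> T \<and> (\<forall>x\<in>T. \<forall>y\<in>T. I x = I p \<longrightarrow> I y = I p)"
      using r(3,4) by (intro exI[of _ "cinv c ` ?B"]) (metis open_openin subtopology_UNIV)
  qed
  then show ?thesis by (simp add: I_def)
qed

lemma geodesic_nhd:
  assumes \<gamma>: "geodesic A g \<gamma>" and c: "c \<in> A" "\<gamma> t \<in> cdom c"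
  shows "open (\<gamma> -` cdom c)" "t \<in> \<gamma> -` cdom c"
  using open_vimage[OF open_cdom[OF c(1)] geodesic_continuous[OF \<gamma>]] c by auto

lemma geodesic_speed:
  assumes \<gamma>: "geodesic A g \<gamma>"
  shows "g (\<gamma> t) (velocity A \<gamma> t) (velocity A \<gamma> t) = g (\<gamma> 0) (velocity A \<gamma> 0) (velocity A \<gamma> 0)"
proof (rule DERIV_isconst_all[of "\<lambda>t. g (\<gamma> t) (velocity A \<gamma> t) (velocity A \<gamma> t)"], rule allI)
  fix t
  obtain c where c: "c \<in> A" "\<gamma> t \<in> cdom c" using ex_chart by blast
  interpret C: coordinate_metric "img c" "G c" by (rule coordinate_metric[OF c(1)])
  have x: "(cmap c \<circ> \<gamma>) t \<in> img c" using cmap_img[OF c] by simp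
  note v = geodesic_velocity[OF \<gamma> c, unfolded has_vector_derivative_def]
  from C.has_derivative_G_compose[OF UNIV_I x v(1) v(2) v(2)]
  have "((\<lambda>s. G c ((cmap c \<circ> \<gamma>) s) (velocity A \<gamma> s c) (velocity A \<gamma> s c)) has_derivative (\<lambda>_. 0)) (at t)"
  proof (rule has_derivative_eq_rhs, intro ext)
    fix h
    show "C.dG ((cmap c \<circ> \<gamma>) t) (h *\<^sub>R velocity A \<gamma> t c) (velocity A \<gamma> t c) (velocity A \<gamma> t c)
      + G c ((cmap c \<circ> \<gamma>) t) (h *\<^sub>R - \<Gamma> c (cmap c (\<gamma> t)) (velocity A \<gamma> t c) (velocity A \<gamma> t c)) (velocity A \<gamma> t c)
      + G c ((cmap c \<circ> \<gamma>) t) (velocity A \<gamma> t c) (h *\<^sub>R - \<Gamma> c (cmap c (\<gamma> t)) (velocity A \<gamma> t c) (velocity A \<gamma> t c)) = 0"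
      using x by (simp add: C.metric_compatible C.G_simps C.Gam_simps algebra_simps)
  qed
  then have "((\<lambda>s. g (\<gamma> s) (velocity A \<gamma> s) (velocity A \<gamma> s)) has_derivative (\<lambda>_. 0)) (at t)"
    by (rule has_derivative_transform_within_open[OF _ geodesic_nhd[OF \<gamma> c]])
      (simp add: g_coords[OF velocity_tangent[OF \<gamma>] velocity_tangent[OF \<gamma>] c(1)])
  then show "((\<lambda>s. g (\<gamma> s) (velocity A \<gamma> s) (velocity A \<gamma> s)) has_real_derivative 0) (at t)"
    unfolding has_field_derivative_def by (rule has_derivative_eq_rhs) (simp add: fun_eq_iff)
qed

lemma g_tnorm: "u \<in> tangent_space A p \<Longrightarrow> g p u u = (tnorm g p u)\<^sup>2"
  and g_nonneg: "u \<in> tangent_space A p \<Longrightarrow> g p u u \<ge> 0"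
proof -
  assume u: "u \<in> tangent_space A p"
  obtain c where c: "c \<in> A" "p \<in> cdom c" using ex_chart by blast
  interpret C: coordinate_metric "img c" "G c" by (rule coordinate_metric[OF c(1)])
  have "G c (cmap c p) (u c) (u c) \<ge> 0"
    using C.pos_G[OF cmap_img[OF c], of "u c"] C.G_zero[OF cmap_img[OF c]] by (cases "u c = 0") (auto intro: less_imp_le)
  then show "g p u u \<ge> 0" by (simp add: g_coords[OF u u c])
  then show "g p u u = (tnorm g p u)\<^sup>2" by (simp add: tnorm_def)
qed

text \<open>The function restricted to \<gamma> has derivative \<open>g\<close> of the gradient and
  the velocity. As the velocity is parallel, the next derivative is \<open>k\<^sup>2\<close> times
  the squared speed times the function, and the speed is constant; hence the rate is
  \<open>k\<close> times the initial speed.\<close>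

lemma section_along_geodesic:
  assumes \<sigma>: "global_section \<sigma>" and \<gamma>: "geodesic A g \<gamma>"
  shows "snd (\<sigma> (\<gamma> t)) = snd (\<sigma> (\<gamma> 0)) * cosh (k * tnorm g (\<gamma> 0) (velocity A \<gamma> 0) * t)
    + g (\<gamma> 0) (fst (\<sigma> (\<gamma> 0))) (velocity A \<gamma> 0) * t * sinhc (k * tnorm g (\<gamma> 0) (velocity A \<gamma> 0) * t)"
proof (rule second_order_ode_solution)
  let ?H = "\<lambda>t. g (\<gamma> t) (fst (\<sigma> (\<gamma> t))) (velocity A \<gamma> t)"
  fix t
  obtain c where c: "c \<in> A" "\<gamma> t \<in> cdom c" using ex_chart by blast
  interpret C: coordinate_metric "img c" "G c" by (rule coordinate_metric[OF c(1)])
  have x: "(cmap c \<circ> \<gamma>) t \<in> img c" using cmap_img[OF c] by simp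
  note v = geodesic_velocity[OF \<gamma> c, unfolded has_vector_derivative_def]
  have cx: "cmap c (\<gamma> t) = (cmap c \<circ> \<gamma>) t" by simp
  note par = parD[OF c section_par[OF \<sigma> c], unfolded cx]
  have "((\<lambda>s. snd (\<sigma> (cinv c ((cmap c \<circ> \<gamma>) s)))) has_derivative
      (\<lambda>h. G c ((cmap c \<circ> \<gamma>) t) (fst (\<sigma> (\<gamma> t)) c) (h *\<^sub>R velocity A \<gamma> t c))) (at t)"
    by (rule has_derivative_compose[OF v(1) par(2)])
  then have "((\<lambda>s. snd (\<sigma> (\<gamma> s))) has_derivative
      (\<lambda>h. G c ((cmap c \<circ> \<gamma>) t) (fst (\<sigma> (\<gamma> t)) c) (h *\<^sub>R velocity A \<gamma> t c))) (at t)"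
    by (rule has_derivative_transform_within_open[OF _ geodesic_nhd[OF \<gamma> c]]) (simp add: cinv_cmap[OF c(1)])
  then show "((\<lambda>s. snd (\<sigma> (\<gamma> s))) has_real_derivative ?H t) (at t)"
    unfolding has_field_derivative_def
    by (rule has_derivative_eq_rhs)
      (use x in \<open>auto simp: fun_eq_iff C.G_simps g_coords[OF section_tangent[OF \<sigma>] velocity_tangent[OF \<gamma>] c]\<close>)
  have w: "((\<lambda>s. fst (\<sigma> (cinv c ((cmap c \<circ> \<gamma>) s))) c) has_derivative
      (\<lambda>h. - \<Gamma> c ((cmap c \<circ> \<gamma>) t) (h *\<^sub>R velocity A \<gamma> t c) (fst (\<sigma> (\<gamma> t)) c) + (k\<^sup>2 * snd (\<sigma> (\<gamma> t))) *\<^sub>R (h *\<^sub>R velocity A \<gamma> t c))) (at t)"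
    by (rule has_derivative_compose[OF v(1) par(1)])
  from C.has_derivative_G_compose[OF UNIV_I x v(1) w v(2)]
  have "((\<lambda>s. G c ((cmap c \<circ> \<gamma>) s) (fst (\<sigma> (cinv c ((cmap c \<circ> \<gamma>) s))) c) (velocity A \<gamma> s c)) has_derivative
      (*) (k\<^sup>2 * G c ((cmap c \<circ> \<gamma>) t) (velocity A \<gamma> t c) (velocity A \<gamma> t c) * snd (\<sigma> (\<gamma> t)))) (at t)"
  proof (rule has_derivative_eq_rhs, intro ext)
    fix h
    show "C.dG ((cmap c \<circ> \<gamma>) t) (h *\<^sub>R velocity A \<gamma> t c) (fst (\<sigma> (cinv c ((cmap c \<circ> \<gamma>) t))) c) (velocity A \<gamma> t c)
      + G c ((cmap c \<circ> \<gamma>) t) (- \<Gamma> c ((cmap c \<circ> \<gamma>) t) (h *\<^sub>R velocity A \<gamma> t c) (fst (\<sigma> (\<gamma> t)) c) + (k\<^sup>2 * snd (\<sigma> (\<gamma> t))) *\<^sub>R (h *\<^sub>R velocity A \<gamma> t c)) (velocity A \<gamma> t c)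
      + G c ((cmap c \<circ> \<gamma>) t) (fst (\<sigma> (cinv c ((cmap c \<circ> \<gamma>) t))) c) (h *\<^sub>R - \<Gamma> c (cmap c (\<gamma> t)) (velocity A \<gamma> t c) (velocity A \<gamma> t c))
      = (k\<^sup>2 * G c ((cmap c \<circ> \<gamma>) t) (velocity A \<gamma> t c) (velocity A \<gamma> t c) * snd (\<sigma> (\<gamma> t))) * h"
      using x by (simp add: C.metric_compatible C.G_simps C.Gam_simps cinv_cmap[OF c] algebra_simps)
  qed
  then have "(?H has_derivative
      (*) (k\<^sup>2 * G c ((cmap c \<circ> \<gamma>) t) (velocity A \<gamma> t c) (velocity A \<gamma> t c) * snd (\<sigma> (\<gamma> t)))) (at t)"
    by (rule has_derivative_transform_within_open[OF _ geodesic_nhd[OF \<gamma> c]])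
      (simp add: cinv_cmap[OF c(1)] g_coords[OF section_tangent[OF \<sigma>] velocity_tangent[OF \<gamma>] c(1)])
  moreover have "G c ((cmap c \<circ> \<gamma>) t) (velocity A \<gamma> t c) (velocity A \<gamma> t c) = (tnorm g (\<gamma> 0) (velocity A \<gamma> 0))\<^sup>2"
    using geodesic_speed[OF \<gamma>, of t] g_tnorm[OF velocity_tangent[OF \<gamma>], of 0]
      g_coords[OF velocity_tangent[OF \<gamma>] velocity_tangent[OF \<gamma>] c] by simp
  ultimately show "(?H has_real_derivative (k * tnorm g (\<gamma> 0) (velocity A \<gamma> 0))\<^sup>2 * snd (\<sigma> (\<gamma> t))) (at t)"
    unfolding has_field_derivative_def by (simp add: power_mult_distrib)
qed

end

section \<open>Local coordinates from sections\<close>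

context hyperbolic_manifold
begin

definition section_map :: "('e \<Rightarrow> 'm \<Rightarrow> ('m, 'e) jet) \<Rightarrow> 'm \<Rightarrow> 'e"
  where "section_map ss q = (\<Sum>b\<in>Basis. snd (ss b q) *\<^sub>R b)"

text \<open>The gradients at \<open>p\<close> are prescribed to be the coordinate basis, so
  definiteness of the metric makes the derivative of \<open>section_map\<close> injective there. Its
  continuity then gives injectivity on a ball, of which the ball of half the radius and its closure
  supply \<open>B\<close> and \<open>C\<close>.\<close>

lemma ex_local_coordinates:
  "\<exists>ss. (\<forall>b\<in>Basis. global_section (ss b)) \<and>
    (\<exists>B C. open B \<and> compact C \<and> p \<in> B \<and> B \<subseteq> C \<and> inj_on (section_map ss) C)"
proof -
  obtain c where c: "c \<in> A" "p \<in> cdom c" using ex_chart by blast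
  interpret C: coordinate_metric "img c" "G c" by (rule coordinate_metric[OF c(1)])
  have "\<exists>\<sigma>. global_section \<sigma> \<and> \<sigma> p = (coord_vec A c p b, 0)" for b
    by (rule ex_section[OF coord_vec_tangent[OF c]])
  then obtain ss where ss: "\<And>b. global_section (ss b)" "\<And>b. ss b p = (coord_vec A c p b, 0)" by metis
  obtain T :: "'e \<Rightarrow> 'e \<Rightarrow>\<^sub>L 'e \<Rightarrow>\<^sub>L real"
    and T' :: "'e \<Rightarrow> 'e \<Rightarrow>\<^sub>L 'e \<Rightarrow>\<^sub>L 'e \<Rightarrow>\<^sub>L real" where
    TT: "\<forall>x\<in>img c. (\<forall>a b. T x a b = G c x a b) \<and> (\<forall>v a b. T' x v a b = C.dG x v a b) \<and> (T has_derivative T' x) (at x)"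
    using C.G_blinfun by (elim exE conjE)
  define x0 where "x0 = cmap c p"
  have x0: "x0 \<in> img c" using cmap_img[OF c] by (simp add: x0_def)
  define w where "w b x = fst (ss b (cinv c x)) c" for b x
  define D where "D x = (\<Sum>b\<in>Basis. blinfun_scaleR_left b o\<^sub>L T x (w b x))" for x
  have D: "D x v = (\<Sum>b\<in>Basis. G c x (w b x) v *\<^sub>R b)" if "x \<in> img c" for x v
    using TT that by (simp add: D_def blinfun.sum_left)
  have der: "((\<lambda>x. section_map ss (cinv c x)) has_derivative D x) (at x)" if x: "x \<in> img c" for x
  proof -
    have cx: "cinv c x \<in> cdom c" "cmap c (cinv c x) = x" using x cinv_cdom[OF c(1)] cmap_cinv[OF c(1)] by auto
    have "((\<lambda>x. section_map ss (cinv c x)) has_derivative (\<lambda>v. \<Sum>b\<in>Basis. G c x (w b x) v *\<^sub>R b)) (at x)"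
      unfolding section_map_def w_def
      using parD(2)[OF c(1) cx(1) section_par[OF ss(1) c(1) cx(1)]] unfolding cx(2)
      by (intro has_derivative_sum has_derivative_scaleR_left)
    then show ?thesis by (rule has_derivative_eq_rhs) (simp add: fun_eq_iff D[OF x])
  qed
  have wc: "isCont (w b) x0" for b
    unfolding w_def x0_def
    by (rule has_derivative_continuous[OF parD(1)[OF c section_par[OF ss(1) c]]])
  have "isCont T x0" using TT x0 by (intro has_derivative_continuous) blast
  then have Dc: "isCont D x0"
    unfolding D_def
    by (intro continuous_sum bounded_bilinear.continuous[OF bounded_bilinear_blinfun_compose] continuous_const
        bounded_bilinear.continuous[OF bounded_bilinear_blinfun_apply] wc)
  have w0: "w b x0 = b" for b
    by (simp add: w_def x0_def cinv_cmap[OF c] ss(2) coord_vec_self[OF c])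
  have linD: "linear (blinfun_apply (D x0))" by (simp add: blinfun.bounded_linear_right bounded_linear.linear)
  have "inj (blinfun_apply (D x0))"
  proof (rule linear_injective_0[OF linD, THEN iffD2], intro allI impI)
    fix v assume "D x0 v = 0"
    then have sum0: "(\<Sum>b\<in>Basis. G c x0 b v *\<^sub>R b) = 0" by (simp add: D[OF x0] w0)
    have Gb: "G c x0 b v = 0" if "b \<in> Basis" for b
      using inner_sum_left_Basis[OF that, of "\<lambda>b. G c x0 b v"] by (simp add: sum0)
    have l: "linear (\<lambda>a. G c x0 a v)" using C.bilinear_G[OF x0] by (simp add: bilinear_def)
    have "G c x0 (\<Sum>b\<in>Basis. (v \<bullet> b) *\<^sub>R b) v = 0"
      by (simp add: linear_sum[OF l] linear_cmul[OF l] Gb)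
    then have "G c x0 v v = 0" by (simp add: euclidean_representation)
    then show "v = 0" using C.pos_G[OF x0, of v] by force
  qed
  then obtain g' where g': "linear g'" "g' \<circ> blinfun_apply (D x0) = id"
    using linear_injective_left_inverse[OF linD] by auto
  have cont: "\<exists>d>0. \<forall>x. dist x0 x < d \<longrightarrow> onorm (\<lambda>v. D x v - D x0 v) < e" if e: "e > 0" for e
  proof -
    obtain d where d: "d > 0" "\<forall>x. dist x x0 < d \<longrightarrow> dist (D x) (D x0) < e"
      using Dc[unfolded continuous_at_eps_delta, THEN spec, THEN mp, OF e] by (elim exE conjE)
    have "onorm (\<lambda>v. D x v - D x0 v) = dist (D x) (D x0)" for x
      by (simp add: dist_norm norm_blinfun.rep_eq minus_blinfun.rep_eq)
    then show ?thesis using d by (auto simp: dist_commute)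
  qed
  obtain r where r: "r > 0" "ball x0 r \<subseteq> img c" "inj_on (\<lambda>x. section_map ss (cinv c x)) (ball x0 r)"
    using has_derivative_locally_injective[OF x0 open_img[OF c(1)] _ g'(2) der cont] g'(1)
    by (auto simp: linear_conv_bounded_linear)
  have sub: "cball x0 (r/2) \<subseteq> ball x0 r" using r(1) by auto
  show ?thesis
  proof (rule exI[of _ ss], rule conjI, intro ballI ss(1),
      rule exI[of _ "cinv c ` ball x0 (r/2)"], rule exI[of _ "cinv c ` cball x0 (r/2)"], intro conjI)
    show "open (cinv c ` ball x0 (r/2))"
      using open_cinv_image[OF c(1) open_ball] sub r(2) ball_subset_cball by blast
    show "compact (cinv c ` cball x0 (r/2))"
      by (intro compact_continuous_image continuous_on_subset[OF continuous_on_cinv[OF c(1)]] compact_cball)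
        (use sub r(2) in blast)
    have "x0 \<in> ball x0 (r/2)" using r(1) by simp
    moreover have "p = cinv c x0" by (simp add: x0_def cinv_cmap[OF c])
    ultimately show "p \<in> cinv c ` ball x0 (r/2)" by blast
    show "cinv c ` ball x0 (r/2) \<subseteq> cinv c ` cball x0 (r/2)" by (intro image_mono ball_subset_cball)
    have "inj_on (section_map ss \<circ> cinv c) (cball x0 (r/2))"
      using inj_on_subset[OF r(3) sub] by (simp add: comp_def)
    then show "inj_on (section_map ss) (cinv c ` cball x0 (r/2))" by (rule inj_on_imageI)
  qed
qed

lemma section_map_continuous: "(\<And>b. b \<in> Basis \<Longrightarrow> global_section (ss b)) \<Longrightarrow> continuous_on UNIV (section_map ss)"
  unfolding section_map_def by (intro continuous_intros section_continuous)

text \<open>Around a common point the local coordinates force agreement, and around a time of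
  disagreement the Hausdorff property keeps the curves apart; so the set of agreement is open and
  closed.\<close>

lemma curves_eq_if_sections_eq:
  fixes \<gamma> \<delta> :: "real \<Rightarrow> 'm"
  assumes \<gamma>: "continuous_on UNIV \<gamma>" and \<delta>: "continuous_on UNIV \<delta>" and "\<gamma> 0 = \<delta> 0"
    and eq: "\<And>\<sigma> t. global_section \<sigma> \<Longrightarrow> snd (\<sigma> (\<gamma> t)) = snd (\<sigma> (\<delta> t))"
  shows "\<gamma> = \<delta>"
proof
  fix t
  show "\<gamma> t = \<delta> t"
  proof (rule connected_induction_simple[of UNIV 0 t "\<lambda>t. \<gamma> t = \<delta> t", OF connected_UNIV UNIV_I UNIV_I assms(3)])
    fix a :: real
    show "\<exists>T. openin (top_of_set UNIV) T \<and> a \<in> T \<and> (\<forall>x\<in>T. \<forall>y\<in>T. \<gamma> x = \<delta> x \<longrightarrow> \<gamma> y = \<delta> y)"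
    proof (cases "\<gamma> a = \<delta> a")
      case True
      obtain ss B C where F: "\<forall>b\<in>Basis. global_section (ss b)" "open B" "\<gamma> a \<in> B" "B \<subseteq> C"
        "inj_on (section_map ss) C" using ex_local_coordinates[of "\<gamma> a"] by blast
      have "section_map ss (\<gamma> t) = section_map ss (\<delta> t)" for t
        unfolding section_map_def using F(1) eq by (intro sum.cong refl) auto
      then have eqB: "\<gamma> t = \<delta> t" if "t \<in> \<gamma> -` B \<inter> \<delta> -` B" for t
        using that F(4,5) by (intro inj_onD[OF F(5)]) auto
      have "open (\<gamma> -` B \<inter> \<delta> -` B)" using F(2) \<gamma> \<delta> by (intro open_Int open_vimage)
      then have "openin (top_of_set UNIV) (\<gamma> -` B \<inter> \<delta> -` B)" by (metis open_openin subtopology_UNIV)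
      moreover have "a \<in> \<gamma> -` B \<inter> \<delta> -` B" using F(3) True by simp
      ultimately show ?thesis using eqB by (intro exI[of _ "\<gamma> -` B \<inter> \<delta> -` B"]) simp
    next
      case False
      then obtain B C where BC: "open B" "open C" "\<gamma> a \<in> B" "\<delta> a \<in> C" "B \<inter> C = {}"
        using hausdorff[of "\<gamma> a" "\<delta> a"] by auto
      have "open (\<gamma> -` B \<inter> \<delta> -` C)" using BC(1,2) \<gamma> \<delta> by (intro open_Int open_vimage)
      then have "openin (top_of_set UNIV) (\<gamma> -` B \<inter> \<delta> -` C)" by (metis open_openin subtopology_UNIV)
      moreover have "a \<in> \<gamma> -` B \<inter> \<delta> -` C" using BC by simp
      moreover have "\<gamma> x \<noteq> \<delta> x" if "x \<in> \<gamma> -` B \<inter> \<delta> -` C" for x using that BC(5) by auto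
      ultimately show ?thesis by blast
    qed
  qed
qed

lemma geodesic_unique:
  assumes "geodesic A g \<gamma>" "geodesic A g \<delta>" "\<gamma> 0 = \<delta> 0" "velocity A \<gamma> 0 = velocity A \<delta> 0"
  shows "\<gamma> = \<delta>"
proof (rule curves_eq_if_sections_eq[where \<gamma> = \<gamma> and \<delta> = \<delta>, OF _ _ assms(3)])
  show "snd (\<sigma> (\<gamma> t)) = snd (\<sigma> (\<delta> t))" if "global_section \<sigma>" for \<sigma> t
    unfolding section_along_geodesic[OF that assms(1), of t] section_along_geodesic[OF that assms(2), of t]
      assms(3,4) by (rule refl)
qed (use assms geodesic_continuous in auto)

section \<open>Linear algebra in the tangent spaces\<close>

lemma tscale_tangent: "u \<in> tangent_space A p \<Longrightarrow> tscale r u \<in> tangent_space A p"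
proof -
  assume u: "u \<in> tangent_space A p"
  show ?thesis
    unfolding tangent_space_def
  proof (intro CollectI conjI allI impI ballI)
    fix c assume "c \<notin> A \<or> p \<notin> cdom c"
    then have "u c = 0" using u unfolding tangent_space_def by blast
    then show "tscale r u c = 0" by (simp add: tscale_def)
  next
    fix c d assume cd: "c \<in> A" "d \<in> A" "p \<in> cdom c \<and> p \<in> cdom d"
    then have "u d = chart_change c d p (u c)" using tangent_change[OF u] by blast
    moreover have "linear (chart_change c d p)" using linear_chart_change cd by blast
    ultimately show "tscale r u d = chart_change c d p (tscale r u c)" by (simp add: tscale_def linear_cmul)
  qed
qed

lemma zero_tangent: "(\<lambda>_. 0) \<in> tangent_space A p"
proof -
  obtain c where c: "c \<in> A" "p \<in> cdom c" using ex_chart by blast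
  have "tscale 0 (coord_vec A c p 0) \<in> tangent_space A p" by (rule tscale_tangent[OF coord_vec_tangent[OF c]])
  then show ?thesis by (simp add: tscale_def)
qed

lemma g_tscale:
  assumes "u \<in> tangent_space A p" "v \<in> tangent_space A p"
  shows "g p (tscale r u) v = r * g p u v" "g p v (tscale r u) = r * g p v u" "g p (\<lambda>_. 0) v = 0" "g p v (\<lambda>_. 0) = 0"
    and g_sym: "g p u v = g p v u"
proof -
  obtain c where c: "c \<in> A" "p \<in> cdom c" using ex_chart by blast
  interpret C: coordinate_metric "img c" "G c" by (rule coordinate_metric[OF c(1)])
  note x = cmap_img[OF c]
  have ta: "tscale r u c = r *\<^sub>R u c" by (simp add: tscale_def)
  show "g p (tscale r u) v = r * g p u v" "g p v (tscale r u) = r * g p v u" "g p (\<lambda>_. 0) v = 0" "g p v (\<lambda>_. 0) = 0"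
    using assms by (simp_all add: g_coords[OF _ _ c] tscale_tangent zero_tangent C.G_simps[OF x] ta)
  show "g p u v = g p v u" using assms by (simp add: g_coords[OF _ _ c] C.sym_G[OF x])
qed

lemma tangent_g_eqI:
  assumes "u \<in> tangent_space A p" "v \<in> tangent_space A p" "\<And>w. w \<in> tangent_space A p \<Longrightarrow> g p w u = g p w v"
  shows "u = v"
proof -
  obtain c where c: "c \<in> A" "p \<in> cdom c" using ex_chart by blast
  interpret C: coordinate_metric "img c" "G c" by (rule coordinate_metric[OF c(1)])
  note x = cmap_img[OF c]
  have "G c (cmap c p) (u c) w = G c (cmap c p) (v c) w" for w
    using assms(3)[OF coord_vec_tangent[OF c, of w]] assms(1,2)
    by (simp add: g_coords[OF _ _ c] coord_vec_tangent[OF c] coord_vec_self[OF c] C.sym_G[OF x])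
  then have "u c = v c" by (rule C.G_nondegenerate[OF x])
  then show ?thesis by (rule tangent_eqI[OF assms(1,2) c])
qed

lemma tnorm_tscale: "u \<in> tangent_space A p \<Longrightarrow> tnorm g p (tscale r u) = \<bar>r\<bar> * tnorm g p u"
  by (simp add: tnorm_def g_tscale tscale_tangent real_sqrt_mult flip: power2_eq_square mult.assoc)

text \<open>In the hyperboloid model this corresponds, up to sign and scale, to the Lorentz product
  with \<open>q\<close>; its function is \<open>cosh\<close> of \<open>k\<close> times the distance
  to \<open>q\<close>.\<close>

definition height :: "'m \<Rightarrow> 'm \<Rightarrow> ('m, 'e) jet"
  where "height q = (SOME \<sigma>. global_section \<sigma> \<and> \<sigma> q = (\<lambda>_. 0, 1))"

lemma height: "global_section (height q)" "height q q = (\<lambda>_. 0, 1)"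
  using someI_ex[OF ex_section[OF zero_tangent, of q 1]] unfolding height_def by auto

text \<open>Pairing a section with \<open>height q\<close> in the conserved form evaluates it at \<open>q\<close>.\<close>

lemma height_pairing:
  assumes "global_section \<sigma>"
  shows "g x (fst (\<sigma> x)) (fst (height q x)) = k\<^sup>2 * (snd (\<sigma> x) * snd (height q x) - snd (\<sigma> q))"
  using section_invariant[OF assms height(1)[of q], of x q] height(2)[of q] section_tangent[OF assms, of q]
  by (simp add: g_tscale algebra_simps)

lemma height_gradient: "g x (fst (height q x)) (fst (height q x)) = k\<^sup>2 * ((snd (height q x))\<^sup>2 - 1)"
  using height_pairing[OF height(1)[of q], of x q] by (simp add: height(2) power2_eq_square)

text \<open>Nonnegativity of the squared gradient bounds the absolute value below by 1. The range is
  an interval that contains 1 and omits 0.\<close>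

lemma height_ge_1: "snd (height q x) \<ge> 1"
proof -
  have sq: "(snd (height q y))\<^sup>2 \<ge> 1" for y
  proof -
    have "0 \<le> k\<^sup>2 * ((snd (height q y))\<^sup>2 - 1)"
      using g_nonneg[OF section_tangent[OF height(1)]] height_gradient[of y q] by metis
    then show ?thesis using k_pos by (simp add: zero_le_mult_iff)
  qed
  have "connected ((\<lambda>y. snd (height q y)) ` UNIV)"
    by (intro connected_continuous_image section_continuous height connected_manifold)
  then have int: "is_interval (range (\<lambda>y. snd (height q y)))" by (simp only: is_interval_connected_1)
  have "snd (height q x) > 0"
  proof (rule ccontr)
    assume "\<not> snd (height q x) > 0"
    then have "0 \<in> range (\<lambda>y. snd (height q y))"
      using height(2)[of q] by (intro mem_is_interval_1_I[OF int rangeI[of _ x] rangeI[of _ q]]) simp_all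
    then obtain y where "snd (height q y) = 0" by auto
    then show False using sq[of y] by simp
  qed
  then show ?thesis using sq[of x] power2_le_imp_le[of 1 "snd (height q x)"] by simp
qed

end

section \<open>The exponential map\<close>

context hyperbolic_manifold
begin

lemma g_definite:
  assumes "u \<in> tangent_space A p" "g p u u = 0"
  shows "u = (\<lambda>_. 0)"
proof -
  obtain c where c: "c \<in> A" "p \<in> cdom c" using ex_chart by blast
  interpret C: coordinate_metric "img c" "G c" by (rule coordinate_metric[OF c(1)])
  have "u c = 0" using C.pos_G[OF cmap_img[OF c], of "u c"] assms(2) by (force simp: g_coords[OF assms(1,1) c])
  then show ?thesis using tangent_eqI[OF assms(1) zero_tangent c] by simp
qed

text \<open>The candidate for the distance to \<open>q\<close>; \<open>riem_dist_eq\<close>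
  identifies it with \<open>riem_dist\<close>.\<close>

definition rad :: "'m \<Rightarrow> 'm \<Rightarrow> real"
  where "rad q x = arcosh (snd (height q x)) / k"

lemma rad_nonneg: "rad q x \<ge> 0"
  using height_ge_1[of q x] k_pos by (simp add: rad_def)

lemma cosh_rad: "cosh (k * rad q x) = snd (height q x)"
  using height_ge_1[of q x] k_pos by (simp add: rad_def cosh_arcosh_real)

lemma rad_self [simp]: "rad q q = 0"
  by (simp add: rad_def height)

lemma rad_continuous: "continuous_on UNIV (rad q)"
  unfolding rad_def
proof (rule continuous_on_divide[OF continuous_on_compose2[OF continuous_on_arcosh[OF order.refl]] continuous_on_const])
  show "continuous_on UNIV (\<lambda>x. snd (height q x))" by (rule section_continuous[OF height(1)])
qed (use height_ge_1 k_pos in auto)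

text \<open>
  Following the negative gradient of \<open>height q\<close> from \<open>x\<close> along a geodesic leads to a minimum of the
  height. The endpoint depends continuously on \<open>x\<close> and the set of minima is discrete, so the endpoint is
  always \<open>q\<close> itself.
\<close>

theorem ex_geodesic_to:
  "\<exists>\<gamma>. geodesic A g \<gamma> \<and> \<gamma> 0 = x \<and> \<gamma> 1 = q \<and> tnorm g x (velocity A \<gamma> 0) = rad q x"
proof -
  define h where "h x = snd (height q x)" for x
  define V where "V x = fst (height q x)" for x
  \<comment> \<open>The gradient has norm \<open>k\<^sup>2 * sinhc (k * rad q x) * rad q x\<close>,
    so this factor makes the initial speed equal to \<open>rad q x\<close>. Written with
    \<open>sinhc\<close> it stays finite and continuous at \<open>q\<close>, where the gradient
    vanishes.\<close>
  define \<tau> where "\<tau> x = 1 / (k\<^sup>2 * sinhc (k * rad q x))" for x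
  have Vt: "V x \<in> tangent_space A x" for x unfolding V_def by (rule section_tangent[OF height(1)])
  have k2: "k\<^sup>2 > 0" using k_pos by simp
  have \<tau>: "\<tau> x > 0" "\<tau> x * (k\<^sup>2 * sinhc (k * rad q x)) = 1" for x
    using k2 sinhc_pos[of "k * rad q x"] by (simp_all add: \<tau>_def)
  have h2: "(h x)\<^sup>2 - 1 = (k * rad q x * sinhc (k * rad q x))\<^sup>2" for x
    using hyperbolic_pythagoras[of "k * rad q x"] by (simp add: cosh_rad h_def flip: sinh_sinhc)
  have "\<exists>\<gamma>. geodesic A g \<gamma> \<and> \<gamma> 0 = x \<and> velocity A \<gamma> 0 = tscale (- \<tau> x) (V x)" for x
    by (rule ex_geodesic[OF tscale_tangent[OF Vt]])
  then obtain \<gamma> where \<gamma>: "\<And>x. geodesic A g (\<gamma> x)" "\<And>x. \<gamma> x 0 = x" "\<And>x. velocity A (\<gamma> x) 0 = tscale (- \<tau> x) (V x)"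
    by metis
  have speed: "tnorm g x (velocity A (\<gamma> x) 0) = rad q x" for x
  proof -
    have "g x (V x) (V x) = k\<^sup>2 * (k * rad q x * sinhc (k * rad q x))\<^sup>2"
      using height_gradient[of x q] h2[of x] by (simp add: V_def h_def)
    also have "\<dots> = (k\<^sup>2 * sinhc (k * rad q x) * rad q x)\<^sup>2" by (simp add: power2_eq_square)
    finally have "tnorm g x (V x) = k\<^sup>2 * sinhc (k * rad q x) * rad q x"
      unfolding tnorm_def using rad_nonneg[of q x] k2 sinhc_pos[of "k * rad q x"] by simp
    then have "tnorm g x (velocity A (\<gamma> x) 0) = \<tau> x * (k\<^sup>2 * sinhc (k * rad q x)) * rad q x"
      using \<tau>(1)[of x] by (simp add: \<gamma>(3) tnorm_tscale[OF Vt] mult.assoc)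
    then show ?thesis by (simp add: \<tau>(2))
  qed
  have along: "snd (\<sigma> (\<gamma> x t)) = snd (\<sigma> x) * cosh (k * rad q x * t)
      - \<tau> x * k\<^sup>2 * (snd (\<sigma> x) * h x - snd (\<sigma> q)) * t * sinhc (k * rad q x * t)"
    if \<sigma>: "global_section \<sigma>" for \<sigma> x t
  proof -
    have hg: "g x (fst (\<sigma> x)) (velocity A (\<gamma> x) 0) = - \<tau> x * (k\<^sup>2 * (snd (\<sigma> x) * h x - snd (\<sigma> q)))"
      using height_pairing[OF \<sigma>, of x q, folded V_def h_def]
      by (simp add: \<gamma>(3) g_tscale(2)[OF Vt section_tangent[OF \<sigma>]])
    show ?thesis
      unfolding section_along_geodesic[OF \<sigma> \<gamma>(1), of x t] \<gamma>(2) speed hg by (simp add: algebra_simps)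
  qed
  have end_h: "h (\<gamma> x 1) = 1" for x
  proof -
    have "h (\<gamma> x 1) = h x * h x - \<tau> x * (k\<^sup>2 * sinhc (k * rad q x)) * (h x * h x - 1)"
      using along[OF height(1), of q x 1] cosh_rad[of q x] height(2)[of q] by (simp add: h_def algebra_simps)
    then show ?thesis unfolding \<tau>(2) by simp
  qed
  \<comment> \<open>At a point of height 1 the gradient vanishes, and the pairing gives every
    section the value it has at \<open>q\<close>. Sections thus cannot distinguish two such points,
    while local coordinates do: the minima are discrete.\<close>
  have minimum: "snd (\<sigma> z) = snd (\<sigma> q)" if \<sigma>: "global_section \<sigma>" and z: "h z = 1" for \<sigma> z
  proof -
    have "g z (V z) (V z) = 0" using height_gradient[of z q] z by (simp add: V_def h_def)
    then have "V z = (\<lambda>_. 0)" by (rule g_definite[OF Vt])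
    then have "g z (fst (\<sigma> z)) (V z) = 0" using g_tscale(4)[OF Vt section_tangent[OF \<sigma>]] by simp
    then show ?thesis using height_pairing[OF \<sigma>, of z q] z k2 by (simp add: V_def h_def)
  qed
  \<comment> \<open>Coordinates are chosen at all points at once, since the continuity argument uses
    a separating map around each point of the reference path.\<close>
  have "\<forall>p. \<exists>ss. (\<forall>b\<in>Basis. global_section (ss b)) \<and>
    (\<exists>B C. open B \<and> compact C \<and> p \<in> B \<and> B \<subseteq> C \<and> inj_on (section_map ss) C)"
    using ex_local_coordinates by blast
  then obtain ss where "\<forall>p. (\<forall>b\<in>Basis. global_section (ss p b)) \<and>
    (\<exists>B C. open B \<and> compact C \<and> p \<in> B \<and> B \<subseteq> C \<and> inj_on (section_map (ss p)) C)"
    unfolding choice_iff by (elim exE)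
  then have ss: "b \<in> Basis \<Longrightarrow> global_section (ss p b)"
    "\<exists>B C. open B \<and> compact C \<and> p \<in> B \<and> B \<subseteq> C \<and> inj_on (section_map (ss p)) C" for p b
    by simp_all
  have lim: "((\<lambda>x. \<gamma> x 1) \<longlongrightarrow> \<gamma> x0 1) (nhds x0)" for x0
  proof (rule continuous_family_of_lifts[where F = "\<lambda>p. section_map (ss p)", OF _ _ _ _ ss(2)])
    show "continuous_on {0..1} (\<gamma> x)" for x
      by (rule continuous_on_subset[OF geodesic_continuous[OF \<gamma>(1)]]) simp
    show "((\<lambda>x. \<gamma> x 0) \<longlongrightarrow> \<gamma> x0 0) (nhds x0)" unfolding \<gamma>(2) by (rule filterlim_ident)
    show "continuous_on UNIV (section_map (ss p))" for p by (rule section_map_continuous[OF ss(1)])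
    have c1: "continuous_on (UNIV \<times> {0..1}) (\<lambda>z. f (fst z))" if "continuous_on UNIV f" for f :: "'m \<Rightarrow> real"
      by (rule continuous_on_compose2[OF that]) (auto intro!: continuous_intros)
    have cs: "continuous_on (UNIV \<times> {0..1}) (\<lambda>z. snd (\<sigma> (\<gamma> (fst z) (snd z))))" if \<sigma>: "global_section \<sigma>" for \<sigma>
    proof -
      note c = c1[OF section_continuous[OF \<sigma>]] c1[OF section_continuous[OF height(1)[of q]]] c1[OF rad_continuous[of q]]
      have "continuous_on (UNIV \<times> {0..1}) (\<lambda>z. \<tau> (fst z))"
        unfolding \<tau>_def using k2 sinhc_pos by (intro continuous_intros c) (metis less_irrefl mult_pos_pos)
      then show ?thesis unfolding along[OF \<sigma>] h_def by (intro continuous_intros c)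
    qed
    show "continuous_on (UNIV \<times> {0..1}) (\<lambda>z. section_map (ss p) (\<gamma> (fst z) (snd z)))" for p
      unfolding section_map_def by (intro continuous_on_sum continuous_on_scaleR continuous_on_const cs ss(1))
  qed auto
  have "\<gamma> q = (\<lambda>_. q)"
  proof (rule curves_eq_if_sections_eq[where \<gamma> = "\<gamma> q" and \<delta> = "\<lambda>_. q"])
    show "snd (\<sigma> (\<gamma> q t)) = snd (\<sigma> q)" if "global_section \<sigma>" for \<sigma> t
      using along[OF that, of q t] by (simp add: h_def height)
  qed (auto simp: \<gamma> geodesic_continuous)
  then have \<gamma>q: "\<gamma> q 1 = q" by simp
  have "\<gamma> x 1 = q"
  proof (rule connected_induction_simple[of UNIV q x "\<lambda>x. \<gamma> x 1 = q", OF connected_manifold UNIV_I UNIV_I \<gamma>q])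
    fix a :: 'm
    obtain B C where BC: "open B" "\<gamma> a 1 \<in> B" "B \<subseteq> C" "inj_on (section_map (ss (\<gamma> a 1))) C"
      using ss(2)[of "\<gamma> a 1"] by blast
    have "\<forall>\<^sub>F y in nhds a. \<gamma> y 1 \<in> B" by (rule topological_tendstoD[OF lim BC(1,2)])
    then obtain T where T: "open T" "a \<in> T" "\<forall>y\<in>T. \<gamma> y 1 \<in> B" unfolding eventually_nhds by blast
    have const: "\<gamma> y 1 = \<gamma> a 1" if "y \<in> T" for y
    proof (rule inj_onD[OF BC(4)])
      show "section_map (ss (\<gamma> a 1)) (\<gamma> y 1) = section_map (ss (\<gamma> a 1)) (\<gamma> a 1)"
        unfolding section_map_def by (intro sum.cong refl) (simp add: minimum[OF ss(1) end_h])
      show "\<gamma> y 1 \<in> C" "\<gamma> a 1 \<in> C" using T(3) that BC(2,3) by auto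
    qed
    show "\<exists>T. openin (top_of_set UNIV) T \<and> a \<in> T \<and> (\<forall>x\<in>T. \<forall>y\<in>T. \<gamma> x 1 = q \<longrightarrow> \<gamma> y 1 = q)"
    proof (intro exI[of _ T] conjI ballI impI)
      show "openin (top_of_set UNIV) T" using T(1) by (metis open_openin subtopology_UNIV)
      show "\<gamma> y 1 = q" if "x \<in> T" "y \<in> T" "\<gamma> x 1 = q" for x y
        using const[OF that(1)] const[OF that(2)] that(3) by simp
    qed (rule T(2))
  qed
  then show ?thesis using \<gamma>(1,2) speed by blast
qed

section \<open>Sections at endpoints of geodesics\<close>

lemma riem_exp_eq: "geodesic A g \<gamma> \<Longrightarrow> riem_exp A g (\<gamma> 0) (velocity A \<gamma> 0) = \<gamma> 1"
proof -
  assume \<gamma>: "geodesic A g \<gamma>"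
  have "(THE \<delta>. geodesic A g \<delta> \<and> \<delta> 0 = \<gamma> 0 \<and> velocity A \<delta> 0 = velocity A \<gamma> 0) = \<gamma>"
    by (rule the_equality) (use \<gamma> geodesic_unique in auto)
  then show ?thesis by (simp add: riem_exp_def)
qed

lemma section_exp:
  assumes \<sigma>: "global_section \<sigma>" and u: "u \<in> tangent_space A p"
  shows "snd (\<sigma> (riem_exp A g p u)) = snd (\<sigma> p) * cosh (k * tnorm g p u) + g p (fst (\<sigma> p)) u * sinhc (k * tnorm g p u)"
proof -
  obtain \<gamma> where "geodesic A g \<gamma>" "\<gamma> 0 = p" "velocity A \<gamma> 0 = u" using ex_geodesic[OF u] by blast
  then show ?thesis using section_along_geodesic[OF \<sigma>, of \<gamma> 1] riem_exp_eq[of \<gamma>] by simp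
qed

lemma tnorm_nonneg: "u \<in> tangent_space A p \<Longrightarrow> tnorm g p u \<ge> 0"
  by (simp add: tnorm_def g_nonneg)

text \<open>Since \<open>riem_log\<close> is an \<open>inv_into\<close>, injectivity is what is at
  stake. The height at \<open>p\<close> recovers the norm of the vector from its endpoint, and the
  section with value \<open>(w, 0)\<close> at \<open>p\<close> recovers its inner product with
  \<open>w\<close> up to a positive factor.\<close>

lemma riem_log_exp:
  assumes u: "u \<in> tangent_space A p"
  shows "riem_log A g p (riem_exp A g p u) = u"
  unfolding riem_log_def
proof (rule inv_into_f_f[OF _ u], rule inj_onI)
  fix u v assume u: "u \<in> tangent_space A p" and v: "v \<in> tangent_space A p"
    and eq: "riem_exp A g p u = riem_exp A g p v"
  have "cosh (k * tnorm g p u) = cosh (k * tnorm g p v)"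
    using section_exp[OF height(1) u, of p] section_exp[OF height(1) v, of p] eq
    by (simp add: height g_tscale[OF u u] g_tscale[OF v v])
  then have n: "tnorm g p u = tnorm g p v"
    using arcosh_cosh_real[of "k * tnorm g p u"] arcosh_cosh_real[of "k * tnorm g p v"] k_pos
      tnorm_nonneg[OF u] tnorm_nonneg[OF v] by simp
  show "u = v"
  proof (rule tangent_g_eqI[OF u v])
    fix w assume "w \<in> tangent_space A p"
    then obtain \<sigma> where \<sigma>: "global_section \<sigma>" "\<sigma> p = (w, 0)" using ex_section by blast
    show "g p w u = g p w v"
      using section_exp[OF \<sigma>(1) u] section_exp[OF \<sigma>(1) v] eq sinhc_pos[of "k * tnorm g p v"] by (simp add: \<sigma>(2) n)
  qed
qed

text \<open>Pairing the height functions of \<open>p\<close> and of the endpoint at \<open>p\<close>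
  shows that height is symmetric in its two points; the other value is computed along the geodesic
  from \<open>p\<close>.\<close>

lemma height_exp:
  assumes v: "v \<in> tangent_space A p"
  shows "snd (height (riem_exp A g p v) p) = cosh (k * tnorm g p v)"
proof -
  have t: "fst (height q p) \<in> tangent_space A p" for q by (rule section_tangent[OF height(1)])
  show ?thesis
    using height_pairing[OF height(1), of p p "riem_exp A g p v"] section_exp[OF height(1) v, of p] k_pos
    by (simp add: height(2) g_tscale[OF v v] g_tscale[OF t t])
qed

text \<open>The gradient of \<open>height q\<close> at \<open>p\<close> is tested against
  \<open>w\<close> by pairing with the section of value \<open>(w, 0)\<close> at \<open>p\<close>,
  whose value at \<open>q\<close> is known. For nonzero vectors the last term is the product of the
  two \<open>sinh\<close> values and the cosine of the angle.\<close>

lemma height_law_of_cosines: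
  assumes v: "v \<in> tangent_space A p" and w: "w \<in> tangent_space A p"
  shows "snd (height (riem_exp A g p v) (riem_exp A g p w)) = cosh (k * tnorm g p v) * cosh (k * tnorm g p w)
    - k\<^sup>2 * g p w v * sinhc (k * tnorm g p v) * sinhc (k * tnorm g p w)"
proof -
  define q where "q = riem_exp A g p v"
  have t: "fst (height q p) \<in> tangent_space A p" by (rule section_tangent[OF height(1)])
  have 1: "snd (height q p) = cosh (k * tnorm g p v)" unfolding q_def by (rule height_exp[OF v])
  have 2: "g p (fst (height q p)) w = - (k\<^sup>2 * g p w v * sinhc (k * tnorm g p v))"
  proof -
    obtain \<sigma> where \<sigma>: "global_section \<sigma>" "\<sigma> p = (w, 0)" using ex_section[OF w] by blast
    show ?thesis
      using height_pairing[OF \<sigma>(1), of p q] section_exp[OF \<sigma>(1) v] g_sym[OF t w] by (simp add: \<sigma>(2) q_def[symmetric])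
  qed
  show ?thesis
    using section_exp[OF height(1) w, of q] by (simp add: 1 2 q_def[symmetric])
qed

end

section \<open>The Riemannian distance\<close>

context coordinate_metric
begin

lemma G_cauchy_schwarz:
  assumes x: "x \<in> U"
  shows "(G x a b)\<^sup>2 \<le> G x a a * G x b b"
proof (cases "b = 0")
  case False
  then have b: "G x b b > 0" by (rule pos_G[OF x])
  define t where "t = G x a b / G x b b"
  have "0 \<le> G x (a - t *\<^sub>R b) (a - t *\<^sub>R b)"
    using pos_G[OF x, of "a - t *\<^sub>R b"] G_zero[OF x] by (cases "a - t *\<^sub>R b = 0") (auto intro: less_imp_le)
  also have "\<dots> = G x a a - 2 * t * G x a b + t * t * G x b b"
    by (simp add: G_simps x sym_G[OF x, of b a] algebra_simps)
  also have "\<dots> = G x a a - (G x a b)\<^sup>2 / G x b b"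
    using b by (simp add: t_def power2_eq_square field_simps)
  finally show ?thesis using b by (simp add: field_simps)
qed (simp add: G_zero[OF x])

end

context hyperbolic_manifold
begin

section \<open>Lengths of curves\<close>

lemma g_cauchy_schwarz:
  assumes "u \<in> tangent_space A p" "v \<in> tangent_space A p"
  shows "\<bar>g p u v\<bar> \<le> tnorm g p u * tnorm g p v"
proof -
  obtain c where c: "c \<in> A" "p \<in> cdom c" using ex_chart by blast
  interpret C: coordinate_metric "img c" "G c" by (rule coordinate_metric[OF c(1)])
  have "(g p u v)\<^sup>2 \<le> g p u u * g p v v"
    using C.G_cauchy_schwarz[OF cmap_img[OF c]] assms by (simp add: g_coords[OF _ _ c])
  then have "sqrt ((g p u v)\<^sup>2) \<le> sqrt (g p u u * g p v v)" by (rule real_sqrt_le_mono)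
  then show ?thesis by (simp add: tnorm_def real_sqrt_mult)
qed

text \<open>The velocity taken within the piece. It differs from \<open>velocity\<close> at most at
  the two end points, where a two-sided derivative may fail to exist, and it is continuous in charts
  up to them.\<close>

definition vel :: "(real \<Rightarrow> 'm) \<Rightarrow> real \<Rightarrow> real \<Rightarrow> real \<Rightarrow> ('m, 'e) tvec"
  where "vel \<gamma> a b t = (\<lambda>c. if c \<in> A \<and> \<gamma> t \<in> cdom c
    then vector_derivative (cmap c \<circ> \<gamma>) (at t within {a..b}) else 0)"

context
  fixes \<gamma> :: "real \<Rightarrow> 'm" and a b :: real
  assumes C1: "C1_curve A \<gamma> a b"
begin

lemma C1_less: "a < b" and C1_continuous: "continuous_on {a..b} \<gamma>"
  using C1 by (simp_all add: C1_curve_def)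

lemma vel_derivative:
  assumes "c \<in> A" "t \<in> {a..b}" "\<gamma> t \<in> cdom c"
  shows "((cmap c \<circ> \<gamma>) has_vector_derivative vel \<gamma> a b t c) (at t within {a..b})"
    and "continuous_on {t\<in>{a..b}. \<gamma> t \<in> cdom c} (\<lambda>t. vel \<gamma> a b t c)"
proof -
  obtain v where v: "continuous_on {t\<in>{a..b}. \<gamma> t \<in> cdom c} v"
    "\<And>t. t \<in> {a..b} \<Longrightarrow> \<gamma> t \<in> cdom c \<Longrightarrow> ((cmap c \<circ> \<gamma>) has_vector_derivative v t) (at t within {a..b})"
    using C1 assms(1) unfolding C1_curve_def by blast
  have eq: "vel \<gamma> a b t c = v t" if "t \<in> {a..b}" "\<gamma> t \<in> cdom c" for t
    using vector_derivative_within_cbox[of a b t "cmap c \<circ> \<gamma>" "v t"] v(2)[OF that] that C1_less assms(1)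
    by (simp add: vel_def)
  show "((cmap c \<circ> \<gamma>) has_vector_derivative vel \<gamma> a b t c) (at t within {a..b})"
    using v(2)[OF assms(2,3)] eq[OF assms(2,3)] by simp
  show "continuous_on {t\<in>{a..b}. \<gamma> t \<in> cdom c} (\<lambda>t. vel \<gamma> a b t c)"
    using continuous_on_cong[OF refl eq, of "{t\<in>{a..b}. \<gamma> t \<in> cdom c}"] v(1) by simp
qed

lemma eventually_chart:
  assumes "c \<in> A" "t \<in> {a..b}" "\<gamma> t \<in> cdom c"
  shows "\<forall>\<^sub>F s in at t within {a..b}. \<gamma> s \<in> cdom c"
  using C1_continuous assms open_cdom[OF assms(1)]
  unfolding continuous_on_def by (auto intro: topological_tendstoD)

lemma vel_tangent:
  assumes t: "t \<in> {a..b}"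
  shows "vel \<gamma> a b t \<in> tangent_space A (\<gamma> t)"
proof -
  have "vel \<gamma> a b t d = chart_change c d (\<gamma> t) (vel \<gamma> a b t c)"
    if c: "c \<in> A" "\<gamma> t \<in> cdom c" and d: "d \<in> A" "\<gamma> t \<in> cdom d" for c d
  proof -
    have 1: "(tr c d has_derivative chart_change c d (\<gamma> t)) (at ((cmap c \<circ> \<gamma>) t))"
      using tr_has_derivative[OF c(1) d(1) c(2) d(2)] by simp
    have 2: "((\<lambda>s. tr c d ((cmap c \<circ> \<gamma>) s)) has_derivative (\<lambda>h. chart_change c d (\<gamma> t) (h *\<^sub>R vel \<gamma> a b t c))) (at t within {a..b})"
      by (rule has_derivative_compose[OF vel_derivative(1)[OF c(1) t c(2), unfolded has_vector_derivative_def] 1])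
    have "\<forall>\<^sub>F s in at t within {a..b}. tr c d ((cmap c \<circ> \<gamma>) s) = (cmap d \<circ> \<gamma>) s"
      using eventually_chart[OF c(1) t c(2)] by eventually_elim (simp add: tr_cmap[OF c(1)])
    then have "((cmap d \<circ> \<gamma>) has_derivative (\<lambda>h. chart_change c d (\<gamma> t) (h *\<^sub>R vel \<gamma> a b t c))) (at t within {a..b})"
      by (rule has_derivative_transform_eventually[OF 2]) (use c t in \<open>simp_all add: tr_cmap\<close>)
    then have "((cmap d \<circ> \<gamma>) has_vector_derivative chart_change c d (\<gamma> t) (vel \<gamma> a b t c)) (at t within {a..b})"
      unfolding has_vector_derivative_def using linear_cmul[OF linear_chart_change[OF c(1) d(1) c(2) d(2)]] by simp
    then show ?thesis
      using vector_derivative_within_cbox[of a b t "cmap d \<circ> \<gamma>"] C1_less t d by (simp add: vel_def)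
  qed
  moreover have "vel \<gamma> a b t c = 0" if "c \<notin> A \<or> \<gamma> t \<notin> cdom c" for c
    using that by (auto simp: vel_def)
  ultimately show ?thesis unfolding tangent_space_def by blast
qed

lemma speed_continuous: "continuous_on {a..b} (\<lambda>t. tnorm g (\<gamma> t) (vel \<gamma> a b t))"
  unfolding continuous_on_eq_continuous_within
proof
  fix t assume t: "t \<in> {a..b}"
  obtain c where c: "c \<in> A" "\<gamma> t \<in> cdom c" using ex_chart by blast
  interpret C: coordinate_metric "img c" "G c" by (rule coordinate_metric[OF c(1)])
  obtain T :: "'e \<Rightarrow> 'e \<Rightarrow>\<^sub>L 'e \<Rightarrow>\<^sub>L real"
    and T' :: "'e \<Rightarrow> 'e \<Rightarrow>\<^sub>L 'e \<Rightarrow>\<^sub>L 'e \<Rightarrow>\<^sub>L real" where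
    T: "\<forall>x\<in>img c. (\<forall>a b. T x a b = G c x a b) \<and> (\<forall>v a b. T' x v a b = C.dG x v a b) \<and> (T has_derivative T' x) (at x)"
    using C.G_blinfun by (elim exE conjE)
  have Tc: "continuous_on (img c) T"
    using T by (meson continuous_at_imp_continuous_on has_derivative_continuous)
  let ?S = "{t\<in>{a..b}. \<gamma> t \<in> cdom c}"
  have \<gamma>S: "continuous_on ?S (\<lambda>t. cmap c (\<gamma> t))"
    by (rule continuous_on_compose2[OF continuous_on_cmap[OF c(1)] continuous_on_subset[OF C1_continuous]]) auto
  have c1: "continuous_on ?S (\<lambda>t. sqrt (T (cmap c (\<gamma> t)) (vel \<gamma> a b t c) (vel \<gamma> a b t c)))"
    by (intro continuous_intros continuous_on_compose2[OF Tc \<gamma>S] vel_derivative(2)[OF c(1) t c(2)])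
      (auto simp: cmap_img[OF c(1)])
  have eq: "sqrt (T (cmap c (\<gamma> s)) (vel \<gamma> a b s c) (vel \<gamma> a b s c)) = tnorm g (\<gamma> s) (vel \<gamma> a b s)" if "s \<in> ?S" for s
    using that T g_coords[OF vel_tangent[of s] vel_tangent[of s] c(1)] cmap_img[OF c(1), of "\<gamma> s"] by (simp add: tnorm_def)
  have "continuous_on ?S (\<lambda>t. tnorm g (\<gamma> t) (vel \<gamma> a b t))"
    by (rule continuous_on_eq[OF c1 eq])
  then have "continuous (at t within ?S) (\<lambda>t. tnorm g (\<gamma> t) (vel \<gamma> a b t))"
    using t c by (simp add: continuous_on_eq_continuous_within)
  moreover have "at t within ?S = at t within {a..b}"
  proof -
    obtain N where N: "open N" "\<forall>l\<in>{a..b}. l \<in> N \<longleftrightarrow> \<gamma> l \<in> cdom c"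
      using continuous_on_open_preimage_iff[OF C1_continuous open_cdom[OF c(1)]] by blast
    show ?thesis
      by (rule at_within_nhd[of t N]) (use N t c in auto)
  qed
  ultimately show "continuous (at t within {a..b}) (\<lambda>t. tnorm g (\<gamma> t) (vel \<gamma> a b t))" by simp
qed

lemma velocity_eq_vel: "t \<in> {a..b} - {a, b} \<Longrightarrow> velocity A \<gamma> t = vel \<gamma> a b t"
  by (rule ext) (simp add: velocity_def vel_def at_within_Icc_at)

lemma C1_curve_length:
  "(\<lambda>t. tnorm g (\<gamma> t) (velocity A \<gamma> t)) integrable_on {a..b}"
  "curve_length A g \<gamma> a b = integral {a..b} (\<lambda>t. tnorm g (\<gamma> t) (vel \<gamma> a b t))"
proof -
  have i: "(\<lambda>t. tnorm g (\<gamma> t) (vel \<gamma> a b t)) integrable_on {a..b}"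
    by (rule integrable_continuous_real[OF speed_continuous])
  show "(\<lambda>t. tnorm g (\<gamma> t) (velocity A \<gamma> t)) integrable_on {a..b}"
    by (rule integrable_spike[OF i, of "{a, b}"]) (simp_all add: velocity_eq_vel)
  show "curve_length A g \<gamma> a b = integral {a..b} (\<lambda>t. tnorm g (\<gamma> t) (vel \<gamma> a b t))"
    unfolding curve_length_def by (rule integral_spike[of "{a, b}"]) (simp_all add: velocity_eq_vel)
qed

lemma section_along_curve:
  assumes \<sigma>: "global_section \<sigma>" and t: "t \<in> {a..b}"
  shows "((\<lambda>t. snd (\<sigma> (\<gamma> t))) has_real_derivative g (\<gamma> t) (fst (\<sigma> (\<gamma> t))) (vel \<gamma> a b t)) (at t within {a..b})"
proof -
  obtain c where c: "c \<in> A" "\<gamma> t \<in> cdom c" using ex_chart by blast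
  interpret C: coordinate_metric "img c" "G c" by (rule coordinate_metric[OF c(1)])
  have 1: "((\<lambda>x. snd (\<sigma> (cinv c x))) has_derivative (\<lambda>a. G c (cmap c (\<gamma> t)) (fst (\<sigma> (\<gamma> t)) c) a)) (at ((cmap c \<circ> \<gamma>) t))"
    using parD(2)[OF c section_par[OF \<sigma> c]] by simp
  have 2: "((\<lambda>s. snd (\<sigma> (cinv c ((cmap c \<circ> \<gamma>) s)))) has_derivative
      (\<lambda>h. G c (cmap c (\<gamma> t)) (fst (\<sigma> (\<gamma> t)) c) (h *\<^sub>R vel \<gamma> a b t c))) (at t within {a..b})"
    by (rule has_derivative_compose[OF vel_derivative(1)[OF c(1) t c(2), unfolded has_vector_derivative_def] 1])
  have "\<forall>\<^sub>F s in at t within {a..b}. snd (\<sigma> (cinv c ((cmap c \<circ> \<gamma>) s))) = snd (\<sigma> (\<gamma> s))"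
    using eventually_chart[OF c(1) t c(2)] by eventually_elim (simp add: cinv_cmap[OF c(1)])
  then have "((\<lambda>s. snd (\<sigma> (\<gamma> s))) has_derivative
      (\<lambda>h. G c (cmap c (\<gamma> t)) (fst (\<sigma> (\<gamma> t)) c) (h *\<^sub>R vel \<gamma> a b t c))) (at t within {a..b})"
    by (rule has_derivative_transform_eventually[OF 2]) (use c t in \<open>simp_all add: cinv_cmap\<close>)
  then show ?thesis
    unfolding has_field_derivative_def
    by (rule has_derivative_eq_rhs)
      (simp add: fun_eq_iff C.G_simps[OF cmap_img[OF c]] g_coords[OF section_tangent[OF \<sigma>] vel_tangent[OF t] c])
qed

text \<open>
  \<open>rad q\<close> need not be differentiable at \<open>q\<close>; shifting the height by \<open>\<epsilon>\<close> makes it so without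
  increasing its gradient.
\<close>

lemma C1_curve_length_ge: "\<bar>rad q (\<gamma> b) - rad q (\<gamma> a)\<bar> \<le> curve_length A g \<gamma> a b"
proof -
  define h where "h t = snd (height q (\<gamma> t))" for t
  define l where "l t = tnorm g (\<gamma> t) (vel \<gamma> a b t)" for t
  have h1: "h t \<ge> 1" for t unfolding h_def by (rule height_ge_1)
  have bound: "\<bar>arcosh (h b + \<epsilon>) / k - arcosh (h a + \<epsilon>) / k\<bar> \<le> integral {a..b} l" if \<epsilon>: "\<epsilon> > 0" for \<epsilon>
  proof -
    define h' where "h' t = g (\<gamma> t) (fst (height q (\<gamma> t))) (vel \<gamma> a b t)" for t
    define r' where "r' t = 1 / sqrt ((h t + \<epsilon>)\<^sup>2 - 1) * h' t / k" for t
    have der: "((\<lambda>t. arcosh (h t + \<epsilon>) / k) has_vector_derivative r' t) (at t within {a..b})" if t: "t \<in> {a..b}" for t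
    proof -
      have "((\<lambda>t. h t + \<epsilon>) has_real_derivative h' t) (at t within {a..b})"
        using DERIV_add[OF section_along_curve[OF height(1)[of q] t] DERIV_const[of \<epsilon>]]
        by (simp add: h_def h'_def)
      moreover have "h t + \<epsilon> > 1" using h1[of t] \<epsilon> by linarith
      ultimately have "((\<lambda>t. arcosh (h t + \<epsilon>)) has_real_derivative 1 / sqrt ((h t + \<epsilon>)\<^sup>2 - 1) * h' t) (at t within {a..b})"
        by (intro DERIV_chain2[OF arcosh_real_has_field_derivative])
      then show ?thesis unfolding r'_def has_real_derivative_iff_has_vector_derivative[symmetric]
        by (rule DERIV_cdivide)
    qed
    have int: "(r' has_integral (arcosh (h b + \<epsilon>) / k - arcosh (h a + \<epsilon>) / k)) {a..b}"
      by (rule fundamental_theorem_of_calculus) (use C1_less der in auto)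
    have le: "norm (r' t) \<le> l t" if t: "t \<in> {a..b}" for t
    proof -
      have hpos: "(h t)\<^sup>2 - 1 \<ge> 0" using h1[of t] by simp
      have less: "(h t)\<^sup>2 < (h t + \<epsilon>)\<^sup>2" using h1[of t] \<epsilon> by (intro power_strict_mono) auto
      have sq: "sqrt ((h t)\<^sup>2 - 1) \<le> sqrt ((h t + \<epsilon>)\<^sup>2 - 1)" "sqrt ((h t + \<epsilon>)\<^sup>2 - 1) > 0"
        using less hpos by auto
      have "tnorm g (\<gamma> t) (fst (height q (\<gamma> t))) = k * sqrt ((h t)\<^sup>2 - 1)"
        using height_gradient[of "\<gamma> t" q] k_pos by (simp add: tnorm_def h_def real_sqrt_mult)
      then have "\<bar>h' t\<bar> \<le> k * sqrt ((h t)\<^sup>2 - 1) * l t"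
        using g_cauchy_schwarz[OF section_tangent[OF height(1)] vel_tangent[OF t], of q] by (simp add: h'_def l_def)
      also have "\<dots> \<le> k * sqrt ((h t + \<epsilon>)\<^sup>2 - 1) * l t"
        using sq k_pos tnorm_nonneg[OF vel_tangent[OF t]] by (intro mult_right_mono mult_left_mono) (auto simp: l_def)
      finally show ?thesis using sq(2) k_pos by (simp add: r'_def abs_mult field_simps)
    qed
    have "l integrable_on {a..b}" unfolding l_def by (rule integrable_continuous_real[OF speed_continuous])
    from integral_norm_bound_integral[OF has_integral_integrable[OF int] this le] integral_unique[OF int]
    show ?thesis by simp
  qed
  have lim: "((\<lambda>\<epsilon>. \<bar>arcosh (h b + \<epsilon>) / k - arcosh (h a + \<epsilon>) / k\<bar>) \<longlongrightarrow> \<bar>arcosh (h b) / k - arcosh (h a) / k\<bar>) (at_right 0)"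
  proof -
    have ar: "((\<lambda>\<epsilon>. arcosh (h t + \<epsilon>)) \<longlongrightarrow> arcosh (h t)) (at_right 0)" for t
    proof (rule tendsto_arcosh_strong)
      have "((\<lambda>\<epsilon>. h t + \<epsilon>) \<longlongrightarrow> h t + 0) (at_right 0)" by (intro tendsto_intros)
      then show "((\<lambda>\<epsilon>. h t + \<epsilon>) \<longlongrightarrow> h t) (at_right 0)" by simp
      show "\<forall>\<^sub>F \<epsilon> in at_right 0. h t + \<epsilon> \<ge> 1"
        using eventually_at_right_less[of "0::real"] by eventually_elim (use h1[of t] in linarith)
    qed (rule h1)
    show ?thesis using k_pos by (intro tendsto_rabs tendsto_diff tendsto_divide ar tendsto_const) auto
  qed
  have "\<bar>arcosh (h b) / k - arcosh (h a) / k\<bar> \<le> integral {a..b} l"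
    by (rule tendsto_upperbound[OF lim])
      (use eventually_at_right_less[of "0::real"] in \<open>auto elim: eventually_mono intro: bound\<close>)
  then show ?thesis unfolding C1_curve_length(2) rad_def h_def l_def .
qed

end

text \<open>Integrability is carried through the induction because lengths of joined pieces add up
  only for integrable speed; the absolute value lets the differences be combined by the triangle
  inequality.\<close>

lemma piecewise_C1_curve_length_ge:
  "piecewise_C1_curve A \<gamma> a b \<Longrightarrow>
    a < b \<and> (\<lambda>t. tnorm g (\<gamma> t) (velocity A \<gamma> t)) integrable_on {a..b} \<and>
    \<bar>rad q (\<gamma> b) - rad q (\<gamma> a)\<bar> \<le> curve_length A g \<gamma> a b"
proof (induction rule: piecewise_C1_curve.induct)
  case (piece a b)
  then show ?case using C1_less C1_curve_length(1) C1_curve_length_ge by blast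
next
  case (join a b c)
  let ?f = "\<lambda>t. tnorm g (\<gamma> t) (velocity A \<gamma> t)"
  have i: "?f integrable_on {a..c}"
    by (rule Henstock_Kurzweil_Integration.integrable_combine[of a b c]) (use join.IH in auto)
  have "integral {a..b} ?f + integral {b..c} ?f = integral {a..c} ?f"
    by (rule Henstock_Kurzweil_Integration.integral_combine) (use join.IH i in auto)
  then show ?case using join.IH i unfolding curve_length_def by linarith
qed

lemma geodesic_C1: "geodesic A g \<gamma> \<Longrightarrow> C1_curve A \<gamma> 0 1"
  unfolding C1_curve_def
proof (intro conjI ballI)
  assume \<gamma>: "geodesic A g \<gamma>"
  show "continuous_on {0..1} \<gamma>" using geodesic_continuous[OF \<gamma>] by (rule continuous_on_subset) simp
  fix c assume c: "c \<in> A"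
  show "\<exists>v. continuous_on {t \<in> {0..1}. \<gamma> t \<in> cdom c} v \<and>
    (\<forall>t\<in>{0..1}. \<gamma> t \<in> cdom c \<longrightarrow> (cmap c \<circ> \<gamma> has_vector_derivative v t) (at t within {0..1}))"
  proof (intro exI[of _ "\<lambda>t. velocity A \<gamma> t c"] conjI ballI impI)
    show "continuous_on {t \<in> {0..1}. \<gamma> t \<in> cdom c} (\<lambda>t. velocity A \<gamma> t c)"
      using geodesic_velocity(2)[OF \<gamma> c] by (intro continuous_at_imp_continuous_on ballI has_vector_derivative_continuous) auto
    show "(cmap c \<circ> \<gamma> has_vector_derivative velocity A \<gamma> t c) (at t within {0..1})" if "\<gamma> t \<in> cdom c" for t
      by (rule has_vector_derivative_at_within[OF geodesic_velocity(1)[OF \<gamma> c that]])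
  qed
qed simp

lemma geodesic_length:
  assumes \<gamma>: "geodesic A g \<gamma>"
  shows "curve_length A g \<gamma> 0 1 = tnorm g (\<gamma> 0) (velocity A \<gamma> 0)"
proof -
  have "tnorm g (\<gamma> t) (velocity A \<gamma> t) = tnorm g (\<gamma> 0) (velocity A \<gamma> 0)" for t
    unfolding tnorm_def geodesic_speed[OF \<gamma>, of t] ..
  then have "(\<lambda>t. tnorm g (\<gamma> t) (velocity A \<gamma> t)) = (\<lambda>_. tnorm g (\<gamma> 0) (velocity A \<gamma> 0))" by (rule ext)
  then show ?thesis by (simp add: curve_length_def)
qed

text \<open>The bound for arbitrary curves is attained by the geodesic from
  \<open>ex_geodesic_to\<close>, whose length is its constant speed.\<close>

theorem riem_dist_eq: "riem_dist A g x q = rad q x"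
  unfolding riem_dist_def
proof (rule cInf_eq_minimum)
  obtain \<gamma> where \<gamma>: "geodesic A g \<gamma>" "\<gamma> 0 = x" "\<gamma> 1 = q" "tnorm g x (velocity A \<gamma> 0) = rad q x"
    using ex_geodesic_to by blast
  then show "rad q x \<in> {curve_length A g \<gamma> 0 1 |\<gamma>. piecewise_C1_curve A \<gamma> 0 1 \<and> \<gamma> 0 = x \<and> \<gamma> 1 = q}"
    using geodesic_length[OF \<gamma>(1)] piecewise_C1_curve.piece[OF geodesic_C1[OF \<gamma>(1)]] by force
next
  fix l assume "l \<in> {curve_length A g \<gamma> 0 1 |\<gamma>. piecewise_C1_curve A \<gamma> 0 1 \<and> \<gamma> 0 = x \<and> \<gamma> 1 = q}"
  then obtain \<gamma> where "l = curve_length A g \<gamma> 0 1" "piecewise_C1_curve A \<gamma> 0 1" "\<gamma> 0 = x" "\<gamma> 1 = q" by blast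
  then show "rad q x \<le> l" using piecewise_C1_curve_length_ge[of \<gamma> 0 1 q] rad_nonneg[of q x] by simp
qed

end

section \<open>The Busemann coupling\<close>

text \<open>In \<open>arcosh y = ln (y + sqrt (y\<^sup>2 - 1))\<close> the factor
  \<open>exp (k * t)\<close> is taken out of the logarithm and cancels \<open>t\<close>. The rest is
  continuous in \<open>E t = exp (- (2 * k) * t)\<close>, which tends to 0, and its value there is
  \<open>ln (C / 2 + C / 2) / k\<close>.\<close>

lemma tendsto_arcosh_cosh:
  fixes C k :: real
  assumes C: "C \<ge> 1" and k: "k > 0"
  shows "((\<lambda>t. arcosh (C * cosh (k * t)) / k - t) \<longlongrightarrow> ln C / k) at_top"
proof -
  define E where "E t = exp (- (2 * k) * t)" for t
  have E: "(E \<longlongrightarrow> 0) at_top"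
    unfolding E_def using k
    by (intro filterlim_compose[OF exp_at_bot] filterlim_tendsto_neg_mult_at_bot[OF tendsto_const] filterlim_ident) auto
  have "((\<lambda>t. ln (C * (1 + E t) / 2 + sqrt ((C * (1 + E t) / 2)\<^sup>2 - E t)) / k)
      \<longlongrightarrow> ln (C * (1 + 0) / 2 + sqrt ((C * (1 + 0) / 2)\<^sup>2 - 0)) / k) at_top"
    by (intro tendsto_intros E) (use C k in \<open>auto simp: add_pos_nonneg\<close>)
  then have lim: "((\<lambda>t. ln (C * (1 + E t) / 2 + sqrt ((C * (1 + E t) / 2)\<^sup>2 - E t)) / k) \<longlongrightarrow> ln C / k) at_top"
    using C by simp
  have "ln (C * (1 + E t) / 2 + sqrt ((C * (1 + E t) / 2)\<^sup>2 - E t)) / k = arcosh (C * cosh (k * t)) / k - t" for t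
  proof -
    define y where "y = C * cosh (k * t)"
    define x where "x = exp (k * t)"
    have x: "x > 0" "E t = 1 / x\<^sup>2" "y = C * (x + 1 / x) / 2"
      by (simp_all add: x_def E_def y_def cosh_field_def exp_minus field_simps power2_eq_square flip: exp_add)
    have y1: "y \<ge> 1" using C cosh_real_ge_1[of "k * t"] mult_mono[of 1 C 1 "cosh (k * t)"] by (simp add: y_def)
    have a: "C * (1 + E t) / 2 = y / x" unfolding x(2,3) using x(1) by (simp add: divide_simps power2_eq_square)
    have "(y / x)\<^sup>2 - E t = (y\<^sup>2 - 1) / x\<^sup>2" by (simp add: x(2) power_divide diff_divide_distrib)
    then have "sqrt ((y / x)\<^sup>2 - E t) = sqrt (y\<^sup>2 - 1) / x" using x(1) by (simp add: real_sqrt_divide)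
    then have "C * (1 + E t) / 2 + sqrt ((C * (1 + E t) / 2)\<^sup>2 - E t) = (y + sqrt (y\<^sup>2 - 1)) / x"
      by (simp add: a add_divide_distrib)
    moreover have "y + sqrt (y\<^sup>2 - 1) > 0" using y1 by (intro add_pos_nonneg) auto
    ultimately have "ln (C * (1 + E t) / 2 + sqrt ((C * (1 + E t) / 2)\<^sup>2 - E t)) = arcosh y - k * t"
      using x(1) y1 by (simp add: ln_div arcosh_real_def x_def)
    then show ?thesis using k by (simp add: y_def diff_divide_distrib)
  qed
  with lim show ?thesis by simp
qed

text \<open>The derivative has the sign of \<open>t * tanh t - ln (cosh t)\<close>, which vanishes
  at 0 and has the positive derivative \<open>t * (1 - (tanh t)\<^sup>2)\<close> for positive
  \<open>t\<close>.\<close>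

lemma log_cosh_ratio_strict_mono:
  assumes "0 < x" "x < y"
  shows "log_cosh_ratio x < log_cosh_ratio y"
proof -
  have ln_pos: "ln (cosh t) < t * tanh t" if t: "t > 0" for t :: real
  proof -
    have 1: "(tanh has_real_derivative 1 - (tanh z)\<^sup>2) (at z)" for z :: real
      by (auto intro!: derivative_eq_intros)
    have 2: "((\<lambda>t. ln (cosh t)) has_real_derivative tanh z) (at z)" for z :: real
      by (auto intro!: derivative_eq_intros simp: tanh_def)
    have 3: "((\<lambda>t. t * tanh t - ln (cosh t)) has_real_derivative z * (1 - (tanh z)\<^sup>2)) (at z)" for z
      using DERIV_diff[OF DERIV_mult[OF DERIV_ident 1] 2, of z] by (simp add: mult.commute)
    have "\<exists>z>0. z < t \<and> t * tanh t - ln (cosh t) - (0 * tanh 0 - ln (cosh 0)) = (t - 0) * (z * (1 - (tanh z)\<^sup>2))"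
      by (rule MVT2[OF t 3])
    then obtain z where z: "z > 0" "z < t" "t * tanh t - ln (cosh t) = t * (z * (1 - (tanh z)\<^sup>2))" by auto
    have "(tanh z)\<^sup>2 < 1" using tanh_real_bounds[of z] by (simp add: abs_square_less_1 abs_less_iff)
    then have "t * (z * (1 - (tanh z)\<^sup>2)) > 0" using t z by simp
    then show ?thesis using z(3) by linarith
  qed
  show ?thesis
    unfolding log_cosh_ratio_def
  proof (rule DERIV_pos_imp_increasing[OF assms(2)])
    fix t assume "x \<le> t" "t \<le> y"
    then have t: "t > 0" using assms by linarith
    have "((\<lambda>t. ln (cosh t) / t) has_real_derivative (tanh t * t - ln (cosh t)) / (t * t)) (at t)"
      using t by (auto intro!: derivative_eq_intros simp: tanh_def)
    moreover have "(tanh t * t - ln (cosh t)) / (t * t) > 0"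
      using ln_pos[OF t] t by (simp add: mult.commute)
    ultimately show "\<exists>y. ((\<lambda>t. ln (cosh t) / t) has_real_derivative y) (at t) \<and> 0 < y" by blast
  qed
qed

lemma tscale_tscale: "tscale a (tscale b u) = tscale (a * b) u"
  by (simp add: tscale_def)

context hyperbolic_manifold
begin

lemma riem_dist_exp: "u \<in> tangent_space A p \<Longrightarrow> riem_dist A g p (riem_exp A g p u) = tnorm g p u"
  using k_pos by (simp add: riem_dist_eq rad_def height_exp arcosh_cosh_real tnorm_nonneg)

text \<open>Orthogonality removes the mixed term of the law of cosines, so the height is a constant
  times \<open>cosh (k * t)\<close> and the preceding limit applies. The factor \<open>a\<close>
  disappears in the normalization.\<close>

lemma busemann_exp:
  assumes u: "u \<in> tangent_space A p" "tnorm g p u = 1" and w: "w \<in> tangent_space A p" "g p w u = 0"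
    and a: "a > 0"
  shows "busemann A g p (tscale a u) (riem_exp A g p w) = ln (cosh (k * tnorm g p w)) / k"
  unfolding busemann_def
proof (rule tendsto_Lim)
  let ?C = "cosh (k * tnorm g p w)"
  have "\<forall>\<^sub>F t in at_top. arcosh (?C * cosh (k * t)) / k - t =
      riem_dist A g (riem_exp A g p w) (riem_exp A g p (tscale t (tscale (1 / tnorm g p (tscale a u)) (tscale a u)))) - t"
    \<comment> \<open>For nonnegative \<open>t\<close> the norm of \<open>tscale t u\<close> is
      \<open>t\<close> itself.\<close>
    using eventually_ge_at_top[of 0]
  proof eventually_elim
    case (elim t)
    have "tscale t (tscale (1 / tnorm g p (tscale a u)) (tscale a u)) = tscale t u"
      using a by (simp add: tscale_tscale tnorm_tscale[OF u(1)] u(2))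
    moreover have "riem_dist A g (riem_exp A g p w) (riem_exp A g p (tscale t u)) = arcosh (?C * cosh (k * t)) / k"
      unfolding riem_dist_eq rad_def height_law_of_cosines[OF tscale_tangent[OF u(1)] w(1)]
      using elim by (simp add: tnorm_tscale[OF u(1)] u(2) g_tscale(2)[OF u(1) w(1)] w(2) mult.commute)
    ultimately show ?case by simp
  qed
  then show "((\<lambda>t. riem_dist A g (riem_exp A g p w) (riem_exp A g p (tscale t (tscale (1 / tnorm g p (tscale a u)) (tscale a u)))) - t)
      \<longlongrightarrow> ln ?C / k) at_top"
    by (rule Lim_transform_eventually[OF tendsto_arcosh_cosh[OF cosh_real_ge_1 k_pos]])
qed simp

text \<open>The coupling reverses the direction \<open>u\<close>. The reversed vector is still of
  unit length and orthogonal to \<open>w\<close>, so the Busemann value is the same for it; the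
  factor in front is the distance \<open>a\<close>.\<close>

lemma busemann_coupling_exp:
  assumes u: "u \<in> tangent_space A p" "tnorm g p u = 1" and w: "w \<in> tangent_space A p" "g p w u = 0"
    and a: "a > 0"
  shows "busemann_coupling A g p (riem_exp A g p (tscale a u)) (riem_exp A g p w) = a / k * ln (cosh (k * tnorm g p w))"
proof -
  have d: "riem_dist A g p (riem_exp A g p (tscale a u)) = a"
    using a by (simp add: riem_dist_exp tscale_tangent[OF u(1)] tnorm_tscale[OF u(1)] u(2))
  then have "riem_exp A g p (tscale a u) \<noteq> p" using a riem_dist_eq[of p p] by auto
  moreover have u': "tscale (- 1) u \<in> tangent_space A p" "tnorm g p (tscale (- 1) u) = 1" "g p w (tscale (- 1) u) = 0"
    by (simp_all add: tscale_tangent[OF u(1)] tnorm_tscale[OF u(1)] u(2) g_tscale(2)[OF u(1) w(1)] w(2))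
  moreover have "tscale (- 1) (riem_log A g p (riem_exp A g p (tscale a u))) = tscale a (tscale (- 1) u)"
    by (simp add: riem_log_exp[OF tscale_tangent[OF u(1)]] tscale_tscale)
  ultimately show ?thesis
    using busemann_exp[OF u'(1,2) w(1) u'(3) a] by (simp add: busemann_coupling_def d)
qed

end

theorem proposition2:
  fixes A :: "('m::{t2_space,second_countable_topology}, 'e::euclidean_space) chart set"
    and g :: "('m, 'e) metric"
    and k r s :: real
    and p y z :: 'm
    and \<eta> \<theta> :: "('m, 'e) tvec"
  assumes "hadamard_manifold A g"
    and "k > 0" and "constant_curvature A g (- (k\<^sup>2))"
    and "\<eta> \<in> tangent_space A p" and "\<theta> \<in> tangent_space A p"
    and "tnorm g p \<eta> = 1" and "tnorm g p \<theta> = 1" and "g p \<eta> \<theta> = 0"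
    and "r > 0" and "s > 0"
    and "y = riem_exp A g p (tscale (- s) \<eta>)"
    and "z = riem_exp A g p (tscale r \<theta>)"
  shows "busemann_coupling A g p y z = s / k * ln (cosh (k * r))
    \<and> busemann_coupling A g p z y = r / k * ln (cosh (k * s))
    \<and> busemann_coupling A g p z y - busemann_coupling A g p y z
        = r * s * (log_cosh_ratio (k * s) - log_cosh_ratio (k * r))
    \<and> (r < s \<longrightarrow> busemann_coupling A g p z y > busemann_coupling A g p y z)"
proof -
  interpret hyperbolic_manifold A g k using assms(1-3) by unfold_locales
  have orth: "g p (tscale r \<theta>) \<eta> = 0" "g p (tscale (- s) \<eta>) \<theta> = 0"
    unfolding g_tscale(1)[OF assms(5,4)] g_tscale(1)[OF assms(4,5)]
    using g_sym[OF assms(4,5)] assms(8) by auto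
  have norms: "tnorm g p (tscale r \<theta>) = r" "tnorm g p (tscale (- s) \<eta>) = s"
    using assms(6,7,9,10) by (simp_all add: tnorm_tscale[OF assms(4)] tnorm_tscale[OF assms(5)])
  \<comment> \<open>The sign is moved from the scalar into the unit vector, so that \<open>y\<close>
    lies at the positive parameter \<open>s\<close> and the coupling formula, which needs a positive
    factor, applies.\<close>
  have \<eta>': "tscale (- 1) \<eta> \<in> tangent_space A p" "tnorm g p (tscale (- 1) \<eta>) = 1"
    "g p (tscale r \<theta>) (tscale (- 1) \<eta>) = 0" "y = riem_exp A g p (tscale s (tscale (- 1) \<eta>))"
    using orth(1) assms(6,11) tscale_tangent[OF assms(4)]
    by (simp_all add: tnorm_tscale[OF assms(4)] g_tscale(2)[OF assms(4) tscale_tangent[OF assms(5)]] tscale_tscale)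
  have yz: "busemann_coupling A g p y z = s / k * ln (cosh (k * r))"
    using busemann_coupling_exp[OF \<eta>'(1,2) tscale_tangent[OF assms(5)] \<eta>'(3) assms(10)]
    by (simp add: \<eta>'(4) assms(12) norms)
  have zy: "busemann_coupling A g p z y = r / k * ln (cosh (k * s))"
    using busemann_coupling_exp[OF assms(5,7) tscale_tangent[OF assms(4)] orth(2) assms(9)]
    by (simp add: assms(11,12) norms)
  have diff: "busemann_coupling A g p z y - busemann_coupling A g p y z
      = r * s * (log_cosh_ratio (k * s) - log_cosh_ratio (k * r))"
    unfolding yz zy log_cosh_ratio_def using assms(2,9,10) by (simp add: field_simps)
  have "busemann_coupling A g p z y > busemann_coupling A g p y z" if "r < s"
  proof -
    have "log_cosh_ratio (k * r) < log_cosh_ratio (k * s)"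
      using assms(2,9) that by (intro log_cosh_ratio_strict_mono) simp_all
    then have "r * s * (log_cosh_ratio (k * s) - log_cosh_ratio (k * r)) > 0" using assms(9,10) by simp
    then show ?thesis using diff by linarith
  qed
  then show ?thesis using yz zy diff by blast
qed

end
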